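(* Let $N \geq 1$ be an integer, let $1 \leq p < \infty$ and let $f \in W^{1,p}(\mathbb{R}^N)$. Let $q$ satisfy $1 \leq q \leq \frac{N}{N-p}$ if $1 \leq p < N$, $1 \leq q < \infty$ if $p = N$, and $1 \leq q \leq \infty$ if $p > N$. Then $$\lim_{\epsilon \to 0^+} \int_{\mathbb{R}^N} \left( \frac{1}{|B(0,\epsilon)|}\int_{B(0,\epsilon)} \frac{|f(x+h) - f(x) - \nabla f(x) \cdot h|^{pq}}{|h|^{pq}} \, dh \right)^{\frac{1}{q}} dx = 0,$$ where, for $q=\infty$ (possible only when $p>N$), the inner expression $\left( \cdots \right)^{1/q}$ is understood as $$\left(\operatorname*{ess\,sup}_{h \in B(0,\epsilon)} \frac{|f(x+h) - f(x) - \nabla f(x) \cdot h|}{|h|}\right)^{p}.$$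
   Context: $W^{1,p}(\mathbb{R}^N)$ is the Sobolev space of real-valued functions in $L^p(\mathbb{R}^N)$ whose distributional gradient $\nabla f$ belongs to $L^p(\mathbb{R}^N;\mathbb{R}^N)$. $B(0,\epsilon)$ is the ball in $\mathbb{R}^N$ of radius $\epsilon$ centered at the origin, and $|B(0,\epsilon)|$ is its Lebesgue measure. *)

theory Defs
  imports "HOL-Analysis.Analysis" "HOL-Probability.Essential_Supremum"
begin

text \<open>Elements of Lebesgue and Sobolev spaces are represented by Lebesgue measurable functions
  (not by equivalence classes); a gradient is any representative of its class.\<close>

definition Lp_space :: "real \<Rightarrow> ('a::euclidean_space \<Rightarrow> 'b::euclidean_space) set" where
  "Lp_space p = {f. f \<in> borel_measurable lebesgue \<and> integrable lebesgue (\<lambda>x. norm (f x) powr p)}"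

definition locally_integrable :: "('a::euclidean_space \<Rightarrow> 'b::euclidean_space) \<Rightarrow> bool" where
  "locally_integrable f \<longleftrightarrow> (\<forall>K. compact K \<longrightarrow> f absolutely_integrable_on K)"

abbreviation partial_deriv :: "'a::euclidean_space \<Rightarrow> ('a \<Rightarrow> real) \<Rightarrow> 'a \<Rightarrow> real" where
  "partial_deriv b f \<equiv> (\<lambda>x. frechet_derivative f (at x) b)"

text \<open>\<open>Ck k f\<close>: \<open>f\<close> is of class \<open>C\<^sup>k\<close> on the whole space. Requiring total differentiability at every
  stage is harmless, as it follows from continuity of the partial derivatives.\<close>

primrec Ck :: "nat \<Rightarrow> ('a::euclidean_space \<Rightarrow> real) \<Rightarrow> bool" where
  "Ck 0 f \<longleftrightarrow> continuous_on UNIV f"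
| "Ck (Suc k) f \<longleftrightarrow> (\<forall>x. f differentiable (at x)) \<and> (\<forall>b\<in>Basis. Ck k (partial_deriv b f))"

definition test_function :: "('a::euclidean_space \<Rightarrow> real) \<Rightarrow> bool" where
  "test_function \<phi> \<longleftrightarrow> (\<forall>k. Ck k \<phi>) \<and> compact (closure {x. \<phi> x \<noteq> 0})"

definition has_weak_gradient :: "('a::euclidean_space \<Rightarrow> real) \<Rightarrow> ('a \<Rightarrow> 'a) \<Rightarrow> bool" where
  "has_weak_gradient f g \<longleftrightarrow>
     locally_integrable f \<and> locally_integrable g \<and>
     (\<forall>\<phi>. test_function \<phi> \<longrightarrow> (\<forall>b\<in>Basis.
        (\<integral>x. f x * partial_deriv b \<phi> x \<partial>lebesgue) = - (\<integral>x. (g x \<bullet> b) * \<phi> x \<partial>lebesgue)))"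

definition W1p :: "real \<Rightarrow> ('a::euclidean_space \<Rightarrow> real) set" where
  "W1p p = {f \<in> Lp_space p. \<exists>g \<in> Lp_space p. has_weak_gradient f g}"

text \<open>Powers on \<open>[0, \<infinity>]\<close>, for exponents \<open>r > 0\<close> only.\<close>

definition epowr :: "ennreal \<Rightarrow> real \<Rightarrow> ennreal" where
  "epowr a r = (if a = \<infinity> then \<infinity> else ennreal (enn2real a powr r))"

text \<open>The integrals below are taken in \<open>[0, \<infinity>]\<close>, so a divergent one has the value \<open>\<infinity>\<close>.
  The value of the quotients at the single point \<open>h = 0\<close> (a division by zero) is irrelevant.\<close>

definition taylor_mean ::
    "real \<Rightarrow> ereal \<Rightarrow> ('a::euclidean_space \<Rightarrow> real) \<Rightarrow> ('a \<Rightarrow> 'a) \<Rightarrow> real \<Rightarrow> 'a \<Rightarrow> ennreal" where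
  "taylor_mean p q f g \<epsilon> x =
     (if q = \<infinity> then
        epowr (esssup (lebesgue_on (ball 0 \<epsilon>))
                 (\<lambda>h. ennreal (\<bar>f (x + h) - f x - g x \<bullet> h\<bar> / norm h))) p
      else
        epowr ((\<integral>\<^sup>+h\<in>ball 0 \<epsilon>. ennreal (\<bar>f (x + h) - f x - g x \<bullet> h\<bar> powr (p * real_of_ereal q)
                                   / norm h powr (p * real_of_ereal q)) \<partial>lebesgue)
               / emeasure lebesgue (ball (0::'a) \<epsilon>))
              (1 / real_of_ereal q))"

end

theory Submission
  imports Defs
begin

text \<open>
  By mollification it suffices to find, for \<open>C\<^sup>1\<close> functions \<open>v\<close>, a measurable majorant \<open>m\<close> of the mean of the
  quotients \<open>\<bar>v (x + h) - v x\<bar> / \<bar>h\<bar>\<close> with \<open>\<integral>m \<le> C \<integral>\<bar>\<nabla>v\<bar>\<^sup>p\<close> uniformly in \<open>\<epsilon>\<close>: Fatou's lemma carries the bound over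
  to \<open>f - f\<^sub>\<delta>\<close>, while for fixed \<open>\<delta>\<close> the mollification \<open>f\<^sub>\<delta>\<close> has a quadratic Taylor remainder whose constant
  at \<open>x\<close> is a local mean of \<open>\<bar>f\<bar>\<close>, hence in \<open>L\<^sup>p\<close>. By Jensen's inequality only the largest \<open>q\<close> matters when
  \<open>p \<noteq> N\<close>.

  For \<open>p \<le> N\<close>, apply for each fixed \<open>x\<close> the Sobolev inequality on the ball of radius \<open>r\<close> to the function
  \<open>h \<mapsto> v (x + h) - v x\<close> multiplied by a cutoff. Integration over \<open>x\<close> gives the estimate on a single shell
  \<open>\<bar>h\<bar> \<approx> r\<close>, since \<open>\<integral>\<bar>v (x + h) - v x\<bar>\<^sup>p dx \<le> \<bar>h\<bar>\<^sup>p \<integral>\<bar>\<nabla>v\<bar>\<^sup>p\<close>, and the dyadic sum converges like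
  \<open>\<Sum>k. 2 powr (- k N / q)\<close>. For \<open>p > N\<close>, Morrey's inequality with an exponent \<open>N < s < p\<close> bounds the quotient by
  the maximal function of \<open>\<bar>\<nabla>v\<bar>\<^sup>s\<close> to the power \<open>1 / s\<close>, and the maximal operator is bounded on \<open>L\<^bsup>p/s\<^esup>\<close>.
\<close>

section \<open>Powers and Hoelder's inequality in the extended nonnegative reals\<close>

text \<open>The remainder of \<open>f\<close> splits into the difference quotient of
  \<open>f - f_delta\<close>, the gradient error and the remainder of \<open>f_delta\<close>; the
  gradient error is bounded pointwise by \<open>norm (g_delta x - g x)\<close>. Hence the uniform
  estimate is stated for plain difference quotients, with gradient argument 0. All comparisons are
  made pointwise in \<open>x\<close> with measurable majorants, and integrals are split only for
  these.

  For a single \<open>x\<close> the local Sobolev inequality leaves a zero-order term in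
  \<open>v (x + h) - v x\<close> that the gradient near \<open>x\<close> has yet to control; only
  the integration over \<open>x\<close> gives it the size \<open>r powr p\<close> times the gradient
  integral. Summing the scales under the outer root works because the exponent \<open>1 / q\<close>
  is at most 1. The ratio \<open>2 powr (- N / q)\<close> of the series tends to 1 as
  \<open>q\<close> grows, so the case of infinite \<open>q\<close> requires a bound that is
  pointwise in \<open>x\<close>. There \<open>s\<close> stays strictly below \<open>p\<close>,
  because the maximal operator is bounded only for exponents above 1.

  The order of choices matters: \<open>delta\<close> is fixed first, and the constants of
  \<open>f_delta\<close> may then be arbitrarily large, since they come with a positive power of
  \<epsilon>.\<close>

lemma epowr_ennreal: "0 \<le> a \<Longrightarrow> epowr (ennreal a) r = ennreal (a powr r)"
  by (simp add: epowr_def)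

lemma epowr_top [simp]: "epowr top r = top"
  by (simp add: epowr_def)

lemma epowr_0 [simp]: "epowr 0 r = 0"
  by (simp add: epowr_def)

lemma epowr_1_left [simp]: "epowr 1 r = 1"
  by (simp add: epowr_def)

lemma epowr_1 [simp]: "epowr a 1 = a"
  by (cases a) (simp_all add: epowr_def)

lemma epowr_mono:
  assumes "a \<le> b" "0 \<le> r"
  shows "epowr a r \<le> epowr b r"
  using assms by (cases a; cases b) (auto simp: epowr_ennreal powr_mono2 top_unique)

lemma epowr_eq_0_iff [simp]: "epowr a r = 0 \<longleftrightarrow> a = 0"
  by (cases a) (auto simp: epowr_ennreal)

lemma epowr_eq_top_iff [simp]: "epowr a r = top \<longleftrightarrow> a = top"
  by (cases a) (auto simp: epowr_ennreal)

lemma epowr_mult: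
  assumes "0 < r"
  shows "epowr (a * b) r = epowr a r * epowr b r"
proof (cases "a = 0 \<or> b = 0 \<or> (a \<noteq> top \<and> b \<noteq> top)")
  case True
  then show ?thesis
    by (cases a; cases b) (auto simp: epowr_ennreal powr_mult ennreal_mult[symmetric])
next
  case False
  then have "a * b = top" "epowr a r * epowr b r = top"
    by (auto simp: ennreal_mult_eq_top_iff)
  then show ?thesis by simp
qed

lemma epowr_epowr: "epowr (epowr a r) s = epowr a (r * s)"
  by (cases a) (auto simp: epowr_ennreal powr_powr)

lemma epowr_add: "epowr a (r + s) = epowr a r * epowr a s"
  by (cases a) (auto simp: epowr_ennreal powr_add ennreal_mult[symmetric] ennreal_top_mult)

text \<open>For \<open>0 < r\<close> the power is an order isomorphism of [0, \<infinity>], with the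
  power \<open>1 / r\<close> as inverse. This adjunction takes the place of continuity when powers
  meet suprema and lower limits.\<close>

lemma epowr_le_iff:
  assumes "0 < r"
  shows "epowr a r \<le> b \<longleftrightarrow> a \<le> epowr b (1 / r)"
proof
  assume "epowr a r \<le> b"
  from epowr_mono[OF this, of "1 / r"] assms show "a \<le> epowr b (1 / r)"
    by (simp add: epowr_epowr)
next
  assume "a \<le> epowr b (1 / r)"
  from epowr_mono[OF this, of r] assms show "epowr a r \<le> b"
    by (simp add: epowr_epowr)
qed

lemma epowr_SUP_le:
  assumes "0 < r"
  shows "epowr (SUP i\<in>I. a i) r \<le> (SUP i\<in>I. epowr (a i) r)"
  unfolding epowr_le_iff[OF assms]
  by (rule SUP_least, unfold epowr_le_iff[OF assms, symmetric], rule SUP_upper)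

text \<open>Lets Fatou's lemma pass through the outer power \<open>1 / q\<close>, and through the
  power \<open>p\<close> of an essential supremum.\<close>

lemma epowr_liminf_le:
  fixes a :: "nat \<Rightarrow> ennreal"
  assumes "0 < r"
  shows "epowr (liminf a) r \<le> liminf (\<lambda>n. epowr (a n) r)"
proof -
  have "epowr (liminf a) r \<le> (SUP n. epowr (INF m\<in>{n..}. a m) r)"
    unfolding liminf_SUP_INF using assms by (rule epowr_SUP_le)
  also have "\<dots> \<le> liminf (\<lambda>n. epowr (a n) r)"
    unfolding liminf_SUP_INF
  proof (rule SUP_mono)
    show "\<exists>m\<in>UNIV. epowr (INF m\<in>{n..}. a m) r \<le> (INF k\<in>{m..}. epowr (a k) r)" for n
      using assms by (intro bexI[of _ n] INF_greatest epowr_mono INF_lower) auto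
  qed
  finally show ?thesis .
qed

text \<open>By homogeneity one may divide by \<open>a + b\<close>; the quotients sum to 1, and
  \<open>x \<le> x powr r\<close> holds on the unit interval because
  \<open>r \<le> 1\<close>.\<close>

lemma powr_add_le_add_powr:
  fixes a b r :: real
  assumes "0 \<le> a" "0 \<le> b" "0 < r" "r \<le> 1"
  shows "(a + b) powr r \<le> a powr r + b powr r"
proof (cases "a + b = 0")
  case False
  then have s: "0 < a + b" using assms by simp
  have le: "x \<le> x powr r" if "0 \<le> x" "x \<le> 1" for x
  proof (cases "x = 0")
    case False
    with that assms have "x powr 1 \<le> x powr r" by (intro powr_mono') auto
    with that show ?thesis by simp
  qed simp
  have "1 = a / (a + b) + b / (a + b)" using s by (simp add: add_divide_distrib[symmetric])
  also have "\<dots> \<le> (a / (a + b)) powr r + (b / (a + b)) powr r"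
    using assms s by (intro add_mono le) auto
  also have "\<dots> = (a powr r + b powr r) / (a + b) powr r"
    using assms s by (simp add: powr_divide add_divide_distrib)
  finally show ?thesis using s by (simp add: pos_le_divide_eq)
qed (use assms in auto)

lemma epowr_add_le:
  assumes "0 < r" "r \<le> 1"
  shows "epowr (a + b) r \<le> epowr a r + epowr b r"
  using powr_add_le_add_powr[OF _ _ assms]
  by (cases a; cases b) (auto simp: epowr_ennreal ennreal_plus[symmetric] simp del: ennreal_plus)

lemma epowr_sum_le:
  assumes "0 < r" "r \<le> 1"
  shows "epowr (\<Sum>i\<in>I. a i) r \<le> (\<Sum>i\<in>I. epowr (a i) r)"
proof (induction I rule: infinite_finite_induct)
  case (insert i I)
  then have "epowr (\<Sum>i\<in>insert i I. a i) r \<le> epowr (a i) r + epowr (\<Sum>i\<in>I. a i) r"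
    using epowr_add_le[OF assms] by simp
  also have "\<dots> \<le> epowr (a i) r + (\<Sum>i\<in>I. epowr (a i) r)"
    by (intro add_mono insert order_refl)
  finally show ?case using insert by simp
qed auto

text \<open>Applied with \<open>r = 1 / q\<close>: the countable sum of dyadic contributions is
  taken out of the root.\<close>

lemma epowr_suminf_le:
  assumes "0 < r" "r \<le> 1"
  shows "epowr (\<Sum>n. a n) r \<le> (\<Sum>n. epowr (a n) r)"
proof -
  have "epowr (\<Sum>n. a n) r \<le> (SUP n. epowr (\<Sum>i<n. a i) r)"
    unfolding suminf_eq_SUP using assms(1) by (rule epowr_SUP_le)
  also have "\<dots> \<le> (SUP n. \<Sum>i<n. epowr (a i) r)"
    by (intro SUP_mono) (auto intro: epowr_sum_le assms)
  finally show ?thesis unfolding suminf_eq_SUP .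
qed

lemma powr_add_le_two:
  fixes a b r :: real
  assumes "0 \<le> a" "0 \<le> b" "0 < r"
  shows "(a + b) powr r \<le> 2 powr r * (a powr r + b powr r)"
proof -
  have "(a + b) powr r \<le> (2 * max a b) powr r"
    using assms by (intro powr_mono2) auto
  also have "\<dots> = 2 powr r * max a b powr r"
    using assms by (simp add: powr_mult)
  also have "\<dots> \<le> 2 powr r * (a powr r + b powr r)"
    by (intro mult_left_mono) (auto simp: max_def)
  finally show ?thesis .
qed

lemma epowr_add_le_two:
  assumes "0 < r"
  shows "epowr (a + b) r \<le> ennreal (2 powr r) * (epowr a r + epowr b r)"
  using powr_add_le_two[OF _ _ assms]
  by (cases a; cases b)
     (auto simp: epowr_ennreal ennreal_plus[symmetric] ennreal_mult[symmetric] ennreal_mult_top simp del: ennreal_plus)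

lemma borel_measurable_epowr [measurable (raw)]:
  assumes [measurable]: "f \<in> borel_measurable M"
  shows "(\<lambda>x. epowr (f x) r) \<in> borel_measurable M"
  unfolding epowr_def by measurable

lemma Youngs_inequality_weighted:
  fixes a b x y :: real
  assumes "0 < a" "0 < b" "a + b = 1" "0 \<le> x" "0 \<le> y"
  shows "x powr a * y powr b \<le> a * x + b * y"
  using Youngs_inequality_0[of a b x y] assms
  by (cases "x = 0 \<or> y = 0") auto

text \<open>The normalisation \<open>\<integral>f = \<integral>g = 1\<close> reduces the inequality to Young's, pointwise.\<close>

lemma nn_integral_Holder:
  assumes [measurable]: "f \<in> borel_measurable M" "g \<in> borel_measurable M"
    and ab: "0 < a" "0 < b" "a + b = 1"
  shows "(\<integral>\<^sup>+x. epowr (f x) a * epowr (g x) b \<partial>M)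
    \<le> epowr (\<integral>\<^sup>+x. f x \<partial>M) a * epowr (\<integral>\<^sup>+x. g x \<partial>M) b"
proof -
  define F where "F = (\<integral>\<^sup>+x. f x \<partial>M)"
  define G where "G = (\<integral>\<^sup>+x. g x \<partial>M)"
  consider "F = 0 \<or> G = 0" | "F \<noteq> 0" "G \<noteq> 0" "F = top \<or> G = top"
    | "F \<noteq> 0" "G \<noteq> 0" "F \<noteq> top" "G \<noteq> top" by blast
  then show ?thesis
  proof cases
    case 1
    \<comment> \<open>If one integral vanishes, so does the product almost everywhere, even where
      the other factor is infinite, since \<open>0 * top = 0\<close>.\<close>
    then have "AE x in M. f x = 0 \<or> g x = 0"
      by (auto simp: F_def G_def nn_integral_0_iff_AE)
    then have "AE x in M. epowr (f x) a * epowr (g x) b = 0"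
      by eventually_elim auto
    then have "(\<integral>\<^sup>+x. epowr (f x) a * epowr (g x) b \<partial>M) = 0"
      by (subst nn_integral_0_iff_AE) auto
    then show ?thesis by simp
  next
    case 2
    then have "epowr F a * epowr G b = top"
      by (auto simp: ennreal_mult_eq_top_iff)
    then show ?thesis by (simp add: F_def G_def)
  next
    case 3
    have young: "epowr u a * epowr w b \<le> ennreal a * u + ennreal b * w" for u w
    proof (cases "u = top \<or> w = top")
      case True
      then show ?thesis using ab by (auto simp: ennreal_mult_top)
    next
      case False
      then show ?thesis
        using Youngs_inequality_weighted[OF ab] ab
        by (cases u; cases w)
           (auto simp: epowr_ennreal ennreal_plus[symmetric] ennreal_mult[symmetric] simp del: ennreal_plus)
    qed
    have inv: "inverse F * F = 1" "inverse G * G = 1"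
      using 3 by (metis ennreal_divide_self divide_ennreal_def mult.commute less_top)+
    have eq: "epowr (f x) a * epowr (g x) b
        = epowr F a * epowr G b * (epowr (inverse F * f x) a * epowr (inverse G * g x) b)" for x
    proof -
      have 1: "epowr F a * epowr (inverse F) a = 1" "epowr G b * epowr (inverse G) b = 1"
        using inv ab by (simp_all add: epowr_mult[symmetric] mult.commute)
      have "epowr F a * epowr G b * (epowr (inverse F * f x) a * epowr (inverse G * g x) b)
        = (epowr F a * epowr (inverse F) a) * (epowr G b * epowr (inverse G) b) * (epowr (f x) a * epowr (g x) b)"
        using ab by (simp add: epowr_mult mult_ac)
      then show ?thesis by (simp add: 1)
    qed
    have "(\<integral>\<^sup>+x. epowr (f x) a * epowr (g x) b \<partial>M)
       = epowr F a * epowr G b * (\<integral>\<^sup>+x. epowr (inverse F * f x) a * epowr (inverse G * g x) b \<partial>M)"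
      unfolding eq by (rule nn_integral_cmult) measurable
    also have "(\<integral>\<^sup>+x. epowr (inverse F * f x) a * epowr (inverse G * g x) b \<partial>M)
       \<le> (\<integral>\<^sup>+x. ennreal a * (inverse F * f x) + ennreal b * (inverse G * g x) \<partial>M)"
      by (intro nn_integral_mono young)
    also have "\<dots> = ennreal a * (inverse F * F) + ennreal b * (inverse G * G)"
      by (simp add: nn_integral_add nn_integral_cmult F_def G_def)
    also have "\<dots> = 1"
      using ab by (simp add: inv ennreal_plus[symmetric] del: ennreal_plus)
    finally show ?thesis
      by (simp add: F_def G_def mult_left_mono)
  qed
qed

lemma epowr_prod:
  assumes "0 < r"
  shows "epowr (\<Prod>i\<in>I. a i) r = (\<Prod>i\<in>I. epowr (a i) r)"
  by (induction I rule: infinite_finite_induct) (simp_all add: epowr_mult assms)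

lemma nn_integral_Holder_prod:
  assumes "finite I" "I \<noteq> {}"
    and "\<And>i. i \<in> I \<Longrightarrow> f i \<in> borel_measurable M"
    and "\<And>i. i \<in> I \<Longrightarrow> 0 < a i" "(\<Sum>i\<in>I. a i) = 1"
  shows "(\<integral>\<^sup>+x. (\<Prod>i\<in>I. epowr (f i x) (a i)) \<partial>M) \<le> (\<Prod>i\<in>I. epowr (\<integral>\<^sup>+x. f i x \<partial>M) (a i))"
  using assms
proof (induction I arbitrary: a rule: finite_ne_induct)
  case (singleton i)
  then show ?case by simp
next
  case (insert j I)
  note [measurable] = insert.prems(1)
  \<comment> \<open>Hoelder's inequality for the pair \<open>a j\<close>, \<open>b\<close>. After
    division by \<open>b\<close> the remaining exponents sum to 1 again, which is why the induction
    keeps \<open>a\<close> arbitrary.\<close>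
  define b where "b = 1 - a j"
  have b: "b = (\<Sum>i\<in>I. a i)" using insert by (simp add: b_def)
  have "0 < b" unfolding b using insert by (intro sum_pos) auto
  have eq: "(\<Prod>i\<in>I. epowr (c i) (a i)) = epowr (\<Prod>i\<in>I. epowr (c i) (a i / b)) b" for c
    using \<open>0 < b\<close> by (simp add: epowr_prod epowr_epowr)
  have meas[measurable]: "(\<lambda>x. \<Prod>i\<in>I. epowr (f i x) (a i / b)) \<in> borel_measurable M"
    by (intro borel_measurable_prod_ennreal borel_measurable_epowr insert) auto
  have "(\<integral>\<^sup>+x. (\<Prod>i\<in>insert j I. epowr (f i x) (a i)) \<partial>M)
    = (\<integral>\<^sup>+x. epowr (f j x) (a j) * epowr (\<Prod>i\<in>I. epowr (f i x) (a i / b)) b \<partial>M)"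
    using insert by (simp add: eq)
  also have "\<dots> \<le> epowr (\<integral>\<^sup>+x. f j x \<partial>M) (a j) * epowr (\<integral>\<^sup>+x. (\<Prod>i\<in>I. epowr (f i x) (a i / b)) \<partial>M) b"
    using insert \<open>0 < b\<close> by (intro nn_integral_Holder) (auto simp: b_def)
  also have "\<dots> \<le> epowr (\<integral>\<^sup>+x. f j x \<partial>M) (a j) * epowr (\<Prod>i\<in>I. epowr (\<integral>\<^sup>+x. f i x \<partial>M) (a i / b)) b"
    using insert \<open>0 < b\<close>
    by (intro mult_left_mono epowr_mono insert.IH) (auto simp: sum_divide_distrib[symmetric] b)
  also have "\<dots> = (\<Prod>i\<in>insert j I. epowr (\<integral>\<^sup>+x. f i x \<partial>M) (a i))"
    using insert by (simp add: eq[symmetric])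
  finally show ?case .
qed

text \<open>Jensen's inequality for the probability density \<open>w\<close>, obtained from
  Hoelder's inequality by splitting \<open>w\<close> into its powers \<open>1 / r\<close> and
  \<open>1 - 1 / r\<close>. The densities used later are the uniform ones on [0, 1] and on balls,
  and the normalised bump.\<close>

lemma epowr_nn_integral_le:
  assumes [measurable]: "w \<in> borel_measurable M" "f \<in> borel_measurable M"
    and w: "(\<integral>\<^sup>+x. w x \<partial>M) = 1" and r: "1 \<le> r"
  shows "epowr (\<integral>\<^sup>+x. w x * f x \<partial>M) r \<le> (\<integral>\<^sup>+x. w x * epowr (f x) r \<partial>M)"
proof (cases "r = 1")
  case False
  with r have r: "1 < r" by simp
  have "w x * f x = epowr (w x * epowr (f x) r) (1 / r) * epowr (w x) (1 - 1 / r)" for x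
    using r epowr_add[of "w x" "1 / r" "1 - 1 / r"]
    by (simp add: epowr_mult epowr_epowr mult_ac)
  then have "(\<integral>\<^sup>+x. w x * f x \<partial>M)
      \<le> epowr (\<integral>\<^sup>+x. w x * epowr (f x) r \<partial>M) (1 / r) * epowr (\<integral>\<^sup>+x. w x \<partial>M) (1 - 1 / r)"
    using r by (simp, intro nn_integral_Holder) auto
  then show ?thesis
    using r by (simp add: w epowr_le_iff)
qed simp

section \<open>Continuously differentiable functions\<close>

lemma nn_integral_lborel_affine:
  fixes u :: "'a::euclidean_space \<Rightarrow> ennreal"
  assumes [measurable]: "u \<in> borel_measurable borel" and c: "c \<noteq> 0"
  shows "(\<integral>\<^sup>+x. u x \<partial>lborel) = ennreal (\<bar>c\<bar> ^ DIM('a)) * (\<integral>\<^sup>+x. u (t + c *\<^sub>R x) \<partial>lborel)"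
  by (subst lborel_affine[OF c, of t]) (simp add: nn_integral_density nn_integral_distr nn_integral_cmult)

lemma nn_integral_lborel_translate:
  fixes u :: "'a::euclidean_space \<Rightarrow> ennreal"
  assumes [measurable]: "u \<in> borel_measurable borel"
  shows "(\<integral>\<^sup>+x. u (x + h) \<partial>lborel) = (\<integral>\<^sup>+x. u x \<partial>lborel)"
  using nn_integral_lborel_affine[of u 1 h] by (simp add: add.commute)

lemma AE_lborel_translate:
  fixes h :: "'a::euclidean_space"
  assumes "AE x in lborel. P x"
  shows "AE x in lborel. P (h + x)"
proof -
  have "AE x in distr lborel borel ((+) h). P x"
    using assms by (simp only: lborel_distr_plus)
  then show ?thesis by (rule AE_distrD[rotated]) simp
qed

lemma emeasure_lborel_ball_pos:
  fixes x :: "'a::euclidean_space"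
  assumes "0 < r"
  shows "emeasure lborel (ball x r) \<noteq> 0" "emeasure lborel (ball x r) \<noteq> top"
  using assms unit_ball_vol_pos[of "real DIM('a)"] by (auto simp: emeasure_ball less_le)

lemma emeasure_lborel_ball_scale:
  fixes x y :: "'a::euclidean_space"
  assumes "0 \<le> r" "0 \<le> c"
  shows "emeasure lborel (ball x (c * r)) = ennreal (c ^ DIM('a)) * emeasure lborel (ball y r)"
  using assms by (simp add: emeasure_ball power_mult_distrib ennreal_mult[symmetric] mult_ac)

text \<open>The fundamental theorem of calculus in the Henstock sense asks for no regularity of
  \<open>\<phi>'\<close>; only the continuous majorant \<open>k\<close> has to be turned into a
  Lebesgue integral.\<close>

lemma nn_integral_segment_bound:
  fixes \<phi> :: "real \<Rightarrow> real"
  assumes "a \<le> b"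
    and "\<And>t. t \<in> {a..b} \<Longrightarrow> (\<phi> has_real_derivative \<phi>' t) (at t within {a..b})"
    and "\<And>t. t \<in> {a..b} \<Longrightarrow> \<bar>\<phi>' t\<bar> \<le> k t"
    and "continuous_on {a..b} k" "\<And>t. 0 \<le> k t"
  shows "ennreal \<bar>\<phi> b - \<phi> a\<bar> \<le> (\<integral>\<^sup>+t\<in>{a..b}. ennreal (k t) \<partial>lborel)"
proof -
  have 1: "(\<phi>' has_integral \<phi> b - \<phi> a) {a..b}"
    using assms by (intro fundamental_theorem_of_calculus)
      (auto simp: has_real_derivative_iff_has_vector_derivative)
  have 2: "k integrable_on {a..b}"
    using assms by (intro integrable_continuous_real)
  then have "norm (integral {a..b} \<phi>') \<le> integral {a..b} k"
    using 1 assms by (intro integral_norm_bound_integral) auto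
  with 1 have "\<bar>\<phi> b - \<phi> a\<bar> \<le> integral {a..b} k"
    by (simp add: integral_unique)
  also have "ennreal (integral {a..b} k) = (\<integral>\<^sup>+t\<in>{a..b}. ennreal (k t) \<partial>lborel)"
    using assms(5) 2 by (intro nn_integral_has_integral_lebesgue'[symmetric]) auto
  finally show ?thesis
    by (simp add: ennreal_leI)
qed

text \<open>Continuous differentiability with the gradient carried along as a vector field, so that
  estimates can name it.\<close>

definition C1_grad :: "('a::euclidean_space \<Rightarrow> real) \<Rightarrow> ('a \<Rightarrow> 'a) \<Rightarrow> bool" where
  "C1_grad v G \<longleftrightarrow> continuous_on UNIV G \<and> (\<forall>x. (v has_derivative (\<lambda>h. G x \<bullet> h)) (at x))"

lemma C1_gradD:
  assumes "C1_grad v G"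
  shows "continuous_on UNIV G" "(v has_derivative (\<lambda>h. G x \<bullet> h)) (at x)" "continuous_on UNIV v"
    "v \<in> borel_measurable borel" "G \<in> borel_measurable borel"
proof -
  show 1: "continuous_on UNIV G" "(v has_derivative (\<lambda>h. G x \<bullet> h)) (at x)" for x
    using assms by (auto simp: C1_grad_def)
  show 2: "continuous_on UNIV v"
    using has_derivative_continuous[OF 1(2)] by (simp add: continuous_on_eq_continuous_within)
  show "v \<in> borel_measurable borel" "G \<in> borel_measurable borel"
    using 1(1) 2 by (auto intro: borel_measurable_continuous_onI)
qed

lemma C1_grad_translate:
  assumes "C1_grad v G"
  shows "C1_grad (\<lambda>h. v (x + h) - c) (\<lambda>h. G (x + h))"
  unfolding C1_grad_def
proof (intro conjI allI)
  show "continuous_on UNIV (\<lambda>h. G (x + h))"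
    by (rule continuous_on_compose2[OF C1_gradD(1)[OF assms]]) (auto intro!: continuous_intros)
  fix y
  have "((\<lambda>h. v (x + h)) has_derivative (\<lambda>h. G (x + y) \<bullet> h)) (at y)"
    by (rule has_derivative_compose[OF _ C1_gradD(2)[OF assms], of "\<lambda>h. x + h" "\<lambda>h. h"])
       (auto intro!: derivative_eq_intros)
  from has_derivative_diff[OF this has_derivative_const[of c]]
  show "((\<lambda>h. v (x + h) - c) has_derivative (\<lambda>h. G (x + y) \<bullet> h)) (at y)" by simp
qed

lemma C1_grad_scale:
  assumes "C1_grad v G"
  shows "C1_grad (\<lambda>h. v (r *\<^sub>R h)) (\<lambda>h. r *\<^sub>R G (r *\<^sub>R h))"
  unfolding C1_grad_def
proof (intro conjI allI)
  show "continuous_on UNIV (\<lambda>h. r *\<^sub>R G (r *\<^sub>R h))"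
    by (intro continuous_intros continuous_on_compose2[OF C1_gradD(1)[OF assms]]) auto
  fix y
  have "((\<lambda>h. v (r *\<^sub>R h)) has_derivative (\<lambda>h. G (r *\<^sub>R y) \<bullet> (r *\<^sub>R h))) (at y)"
    by (rule has_derivative_compose[OF _ C1_gradD(2)[OF assms], of "\<lambda>h. r *\<^sub>R h" "\<lambda>h. r *\<^sub>R h"])
       (auto intro!: derivative_eq_intros)
  then show "((\<lambda>h. v (r *\<^sub>R h)) has_derivative (\<lambda>h. (r *\<^sub>R G (r *\<^sub>R y)) \<bullet> h)) (at y)"
    by simp
qed

lemma C1_grad_diff:
  assumes "C1_grad v G" "C1_grad v' G'"
  shows "C1_grad (\<lambda>h. v h - v' h) (\<lambda>h. G h - G' h)"
  using assms unfolding C1_grad_def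
  by (auto intro!: continuous_intros derivative_eq_intros simp: inner_diff_left)

lemma C1_grad_diff_le:
  assumes "C1_grad v G"
  shows "ennreal \<bar>v (x + h) - v x\<bar>
    \<le> ennreal (norm h) * (\<integral>\<^sup>+t\<in>{0..1}. ennreal (norm (G (x + t *\<^sub>R h))) \<partial>lborel)"
proof -
  note [measurable] = C1_gradD(4,5)[OF assms]
  have "ennreal \<bar>v (x + 1 *\<^sub>R h) - v (x + 0 *\<^sub>R h)\<bar>
    \<le> (\<integral>\<^sup>+t\<in>{0..1}. ennreal (norm h * norm (G (x + t *\<^sub>R h))) \<partial>lborel)"
  proof (rule nn_integral_segment_bound)
    fix t :: real
    have "((\<lambda>t. v (x + t *\<^sub>R h)) has_derivative (\<lambda>s. G (x + t *\<^sub>R h) \<bullet> (s *\<^sub>R h))) (at t within {0..1})"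
      by (rule has_derivative_compose[OF _ C1_gradD(2)[OF assms], of "\<lambda>t. x + t *\<^sub>R h" "\<lambda>s. s *\<^sub>R h"])
         (auto intro!: derivative_eq_intros)
    then show "((\<lambda>t. v (x + t *\<^sub>R h)) has_real_derivative G (x + t *\<^sub>R h) \<bullet> h) (at t within {0..1})"
      by (simp add: has_field_derivative_def mult_commute_abs)
    show "\<bar>G (x + t *\<^sub>R h) \<bullet> h\<bar> \<le> norm h * norm (G (x + t *\<^sub>R h))"
      using Cauchy_Schwarz_ineq2[of "G (x + t *\<^sub>R h)" h] by (simp add: mult.commute)
    show "continuous_on {0..1} (\<lambda>t. norm h * norm (G (x + t *\<^sub>R h)))"
      by (intro continuous_intros continuous_on_compose2[OF C1_gradD(1)[OF assms]]) auto
  qed auto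
  also have "\<dots> = (\<integral>\<^sup>+t. ennreal (norm h) * (ennreal (norm (G (x + t *\<^sub>R h))) * indicator {0..1} t) \<partial>lborel)"
    by (simp add: ennreal_mult mult_ac)
  also have "\<dots> = ennreal (norm h) * (\<integral>\<^sup>+t\<in>{0..1}. ennreal (norm (G (x + t *\<^sub>R h))) \<partial>lborel)"
    by (rule nn_integral_cmult) measurable
  finally show ?thesis by simp
qed

text \<open>The segment formula bounds the increment by an average over \<open>t\<close> in [0, 1].
  Jensen's inequality moves the power inside, and translation invariance of the measure removes the
  shift \<open>t *\<^sub>R h\<close>.\<close>

lemma C1_grad_translation_Lp:
  fixes v :: "'a::euclidean_space \<Rightarrow> real"
  assumes "C1_grad v G" and p: "1 \<le> p"
  shows "(\<integral>\<^sup>+x. ennreal (\<bar>v (x + h) - v x\<bar> powr p) \<partial>lborel)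
    \<le> ennreal (norm h powr p) * (\<integral>\<^sup>+x. ennreal (norm (G x) powr p) \<partial>lborel)"
proof -
  note [measurable] = C1_gradD(4,5)[OF assms(1)]
  have "(\<integral>\<^sup>+x. ennreal (\<bar>v (x + h) - v x\<bar> powr p) \<partial>lborel)
     \<le> (\<integral>\<^sup>+x. ennreal (norm h powr p) * (\<integral>\<^sup>+t. indicator {0..1} t * ennreal (norm (G (x + t *\<^sub>R h)) powr p) \<partial>lborel) \<partial>lborel)"
  proof (rule nn_integral_mono)
    fix x
    have "ennreal (\<bar>v (x + h) - v x\<bar> powr p) = epowr (ennreal \<bar>v (x + h) - v x\<bar>) p"
      by (simp add: epowr_ennreal)
    also have "\<dots> \<le> epowr (ennreal (norm h) * (\<integral>\<^sup>+t\<in>{0..1::real}. ennreal (norm (G (x + t *\<^sub>R h))) \<partial>lborel)) p"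
      using p by (intro epowr_mono C1_grad_diff_le assms) auto
    also have "\<dots> = ennreal (norm h powr p) * epowr (\<integral>\<^sup>+t. indicator {0..1::real} t * ennreal (norm (G (x + t *\<^sub>R h))) \<partial>lborel) p"
      using p by (simp add: epowr_mult epowr_ennreal mult.commute)
    also have "\<dots> \<le> ennreal (norm h powr p) * (\<integral>\<^sup>+t. indicator {0..1::real} t * epowr (ennreal (norm (G (x + t *\<^sub>R h)))) p \<partial>lborel)"
      using p by (intro mult_left_mono epowr_nn_integral_le) auto
    finally show "ennreal (\<bar>v (x + h) - v x\<bar> powr p) \<le> ennreal (norm h powr p)
       * (\<integral>\<^sup>+t. indicator {0..1} t * ennreal (norm (G (x + t *\<^sub>R h)) powr p) \<partial>lborel)"
      by (simp add: epowr_ennreal)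
  qed
  also have "\<dots> = ennreal (norm h powr p) * (\<integral>\<^sup>+x. (\<integral>\<^sup>+t. indicator {0..1} t * ennreal (norm (G (x + t *\<^sub>R h)) powr p) \<partial>lborel) \<partial>lborel)"
    by (rule nn_integral_cmult) measurable
  also have "(\<integral>\<^sup>+x. (\<integral>\<^sup>+t. indicator {0..1} t * ennreal (norm (G (x + t *\<^sub>R h)) powr p) \<partial>lborel) \<partial>lborel)
     = (\<integral>\<^sup>+t. (\<integral>\<^sup>+x. indicator {0..1::real} t * ennreal (norm (G (x + t *\<^sub>R h)) powr p) \<partial>lborel) \<partial>lborel)"
    by (rule lborel_pair.Fubini') measurable
  also have "\<dots> = (\<integral>\<^sup>+t. indicator {0..1::real} t * (\<integral>\<^sup>+x. ennreal (norm (G x) powr p) \<partial>lborel) \<partial>lborel)"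
    by (simp add: nn_integral_cmult nn_integral_lborel_translate[of "\<lambda>x. ennreal (norm (G x) powr p)"])
  also have "\<dots> = (\<integral>\<^sup>+x. ennreal (norm (G x) powr p) \<partial>lborel)"
    by (simp add: nn_integral_multc)
  finally show ?thesis .
qed

section \<open>The Gagliardo--Nirenberg--Sobolev inequality\<close>

text \<open>Integrating along coordinate \<open>j\<close> first and applying Hoelder's inequality on that line reproduces the
  statement for \<open>\<integral>f dx\<^sub>j\<close> and one coordinate fewer. The case distinction gives \<open>epowr a 0\<close> the value \<open>1\<close>
  also for \<open>a \<in> {0, \<infinity>}\<close>.\<close>

lemma nn_integral_grid_lines:
  fixes f :: "('i \<Rightarrow> real) \<Rightarrow> ennreal"
  assumes "finite I" "f \<in> borel_measurable (Pi\<^sub>M I (\<lambda>_. lborel))"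
    and "0 < t" "(real (card I) - 1) * t \<le> 1"
  shows "(\<integral>\<^sup>+x. (if (real (card I) - 1) * t = 1 then 1 else epowr (f x) (1 - (real (card I) - 1) * t))
      * (\<Prod>i\<in>I. epowr (\<integral>\<^sup>+s. f (x(i := s)) \<partial>lborel) t) \<partial>Pi\<^sub>M I (\<lambda>_. lborel))
    \<le> epowr (\<integral>\<^sup>+x. f x \<partial>Pi\<^sub>M I (\<lambda>_. lborel)) (1 + t)"
  using assms
proof (induction I arbitrary: f rule: finite_induct)
  case empty
  then show ?case
    by (simp add: PiM_empty nn_integral_count_space_finite)
next
  case (insert j I)
  interpret product_sigma_finite "\<lambda>_::'i. lborel :: real measure" ..
  note [measurable] = insert.prems(1)
  let ?M = "\<lambda>I. Pi\<^sub>M I (\<lambda>_::'i. lborel :: real measure)"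
  define n where "n = real (card I)"
  have n: "real (card (insert j I)) = n + 1" using insert by (simp add: n_def)
  have t: "0 < t" "n * t \<le> 1" using insert.prems(2,3) unfolding n by auto
  define F where "F = (\<lambda>x. \<integral>\<^sup>+y. f (x(j := y)) \<partial>lborel)"
  have upd_j: "(\<lambda>z. (fst z)(j := snd z)) \<in> ?M I \<Otimes>\<^sub>M lborel \<rightarrow>\<^sub>M ?M (insert j I)"
    by (rule measurable_fun_upd[where J=I]) auto
  have F_meas[measurable]: "F \<in> borel_measurable (?M I)"
    unfolding F_def using measurable_compose[OF upd_j insert.prems(1)]
    by (intro lborel.borel_measurable_nn_integral) (simp only: split_beta')
  have upd_jy[measurable]: "(\<lambda>y. x(j := y)) \<in> lborel \<rightarrow>\<^sub>M ?M (insert j I)" if "x \<in> space (?M I)" for x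
    using measurable_compose[OF measurable_Pair1'[OF that, of lborel] upd_j] by simp
  have upd_i: "(\<lambda>z. (fst z)(i := snd z)) \<in> ?M K \<Otimes>\<^sub>M lborel \<rightarrow>\<^sub>M ?M K" if "i \<in> K" for i K
    using that by (intro measurable_fun_upd[where J=K]) auto
  have line_meas: "(\<lambda>x. \<integral>\<^sup>+s. f (x(i := s)) \<partial>lborel) \<in> borel_measurable (?M (insert j I))"
    if "i \<in> insert j I" for i
    using measurable_compose[OF upd_i[OF that] insert.prems(1)]
    by (intro lborel.borel_measurable_nn_integral) (simp only: split_beta')
  \<comment> \<open>Integration along coordinate \<open>j\<close> with the others fixed. The factor
    belonging to line \<open>j\<close> itself is constant in \<open>y\<close> and is restored
    afterwards.\<close>
  have step: "(\<integral>\<^sup>+y. (if n * t = 1 then 1 else epowr (f (x(j := y))) (1 - n * t))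
        * (\<Prod>i\<in>I. epowr (\<integral>\<^sup>+s. f ((x(j := y))(i := s)) \<partial>lborel) t) \<partial>lborel)
      \<le> (if n * t = 1 then 1 else epowr (F x) (1 - n * t)) * (\<Prod>i\<in>I. epowr (\<integral>\<^sup>+s. F (x(i := s)) \<partial>lborel) t)"
    if x: "x \<in> space (?M I)" for x
  proof -
    note [measurable] = upd_jy[OF x]
    have [measurable]: "(\<lambda>y. \<integral>\<^sup>+s. f ((x(j := y))(i := s)) \<partial>lborel) \<in> borel_measurable lborel" if "i \<in> I" for i
      using measurable_compose[OF upd_jy[OF x] line_meas] that by simp
    have fub: "(\<integral>\<^sup>+y. (\<integral>\<^sup>+s. f ((x(j := y))(i := s)) \<partial>lborel) \<partial>lborel) = (\<integral>\<^sup>+s. F (x(i := s)) \<partial>lborel)"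
      if i: "i \<in> I" for i
    proof -
      have ij: "i \<noteq> j" using i insert by auto
      have "(\<lambda>z. ((x(j := fst z))(i := snd z))) \<in> lborel \<Otimes>\<^sub>M lborel \<rightarrow>\<^sub>M ?M (insert j I)"
        using i by (intro measurable_fun_upd[where J="insert j I"] measurable_compose[OF measurable_fst upd_jy[OF x]]) auto
      from measurable_compose[OF this insert.prems(1)]
      have [measurable]: "(\<lambda>(y, s). f ((x(j := y))(i := s))) \<in> borel_measurable (lborel \<Otimes>\<^sub>M lborel)"
        by (simp only: split_beta')
      have "(\<integral>\<^sup>+y. (\<integral>\<^sup>+s. f ((x(j := y))(i := s)) \<partial>lborel) \<partial>lborel)
          = (\<integral>\<^sup>+s. (\<integral>\<^sup>+y. f ((x(j := y))(i := s)) \<partial>lborel) \<partial>lborel)"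
        by (rule lborel_pair.Fubini'[symmetric]) measurable
      then show ?thesis by (simp add: F_def fun_upd_twist[OF ij])
    qed
    show ?thesis
    proof (cases "n * t = 1")
      case True
      \<comment> \<open>Here the power of \<open>f\<close> is absent, and Hoelder's inequality
        involves only the line factors, whose \<open>n\<close> exponents \<open>t\<close> already
        sum to 1.\<close>
      then have "I \<noteq> {}" using t by (auto simp: n_def)
      then have "(\<integral>\<^sup>+y. (\<Prod>i\<in>I. epowr (\<integral>\<^sup>+s. f ((x(j := y))(i := s)) \<partial>lborel) t) \<partial>lborel)
          \<le> (\<Prod>i\<in>I. epowr (\<integral>\<^sup>+y. (\<integral>\<^sup>+s. f ((x(j := y))(i := s)) \<partial>lborel) \<partial>lborel) t)"
        using insert t True by (intro nn_integral_Holder_prod) (auto simp: n_def)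
      also have "\<dots> = (\<Prod>i\<in>I. epowr (\<integral>\<^sup>+s. F (x(i := s)) \<partial>lborel) t)"
        by (intro prod.cong refl) (simp add: fub)
      finally show ?thesis using True by simp
    next
      case False
      \<comment> \<open>The free label \<open>j\<close> indexes the power of \<open>f\<close>
        itself, with the exponent \<open>1 - n * t\<close> that completes the sum to 1.\<close>
      define h where "h = (\<lambda>i y. if i = j then f (x(j := y)) else (\<integral>\<^sup>+s. f ((x(j := y))(i := s)) \<partial>lborel))"
      define a where "a = (\<lambda>i. if i = j then 1 - n * t else t)"
      have split: "(\<Prod>i\<in>insert j I. epowr (c i) (a i)) = epowr (c j) (1 - n * t) * (\<Prod>i\<in>I. epowr (c i) t)" for c
      proof -
        have "(\<Prod>i\<in>I. epowr (c i) (a i)) = (\<Prod>i\<in>I. epowr (c i) t)"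
          using insert by (intro prod.cong) (auto simp: a_def)
        then show ?thesis using insert by (simp add: a_def)
      qed
      have suma: "(\<Sum>i\<in>insert j I. a i) = 1"
      proof -
        have "(\<Sum>i\<in>I. a i) = (\<Sum>i\<in>I. t)"
          using insert by (intro sum.cong) (auto simp: a_def)
        then show ?thesis using insert by (simp add: a_def n_def)
      qed
      have "(\<integral>\<^sup>+y. (\<Prod>i\<in>insert j I. epowr (h i y) (a i)) \<partial>lborel)
          \<le> (\<Prod>i\<in>insert j I. epowr (\<integral>\<^sup>+y. h i y \<partial>lborel) (a i))"
        using insert t False suma by (intro nn_integral_Holder_prod) (auto simp: h_def a_def)
      moreover have "(\<Prod>i\<in>I. epowr (h i y) t) = (\<Prod>i\<in>I. epowr (\<integral>\<^sup>+s. f ((x(j := y))(i := s)) \<partial>lborel) t)" for y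
        using insert by (intro prod.cong) (auto simp: h_def)
      moreover have "(\<Prod>i\<in>I. epowr (\<integral>\<^sup>+y. h i y \<partial>lborel) t) = (\<Prod>i\<in>I. epowr (\<integral>\<^sup>+s. F (x(i := s)) \<partial>lborel) t)"
      proof (intro prod.cong refl)
        fix i assume i: "i \<in> I"
        then have "i \<noteq> j" using insert by auto
        then show "epowr (\<integral>\<^sup>+y. h i y \<partial>lborel) t = epowr (\<integral>\<^sup>+s. F (x(i := s)) \<partial>lborel) t"
          by (simp only: h_def if_False fub[OF i])
      qed
      ultimately show ?thesis
        using False by (simp add: split) (simp add: h_def F_def)
    qed
  qed
  let ?g = "\<lambda>x. (if n * t = 1 then 1 else epowr (f x) (1 - n * t))
      * (\<Prod>i\<in>insert j I. epowr (\<integral>\<^sup>+s. f (x(i := s)) \<partial>lborel) t)"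
  have [measurable]: "(\<lambda>x. \<Prod>i\<in>insert j I. epowr (\<integral>\<^sup>+s. f (x(i := s)) \<partial>lborel) t) \<in> borel_measurable (?M (insert j I))"
    by (intro borel_measurable_prod_ennreal borel_measurable_epowr line_meas)
  have "(\<integral>\<^sup>+x. ?g x \<partial>?M (insert j I)) = (\<integral>\<^sup>+x. (\<integral>\<^sup>+y. ?g (x(j := y)) \<partial>lborel) \<partial>?M I)"
    using insert.hyps by (intro product_nn_integral_insert) measurable
  also have "\<dots> \<le> (\<integral>\<^sup>+x. (if (n - 1) * t = 1 then 1 else epowr (F x) (1 - (n - 1) * t))
      * (\<Prod>i\<in>I. epowr (\<integral>\<^sup>+s. F (x(i := s)) \<partial>lborel) t) \<partial>?M I)"
  proof (rule nn_integral_mono)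
    fix x assume x: "x \<in> space (?M I)"
    note [measurable] = upd_jy[OF x]
    have [measurable]: "(\<lambda>y. \<integral>\<^sup>+s. f ((x(j := y))(i := s)) \<partial>lborel) \<in> borel_measurable lborel" if "i \<in> I" for i
      using measurable_compose[OF upd_jy[OF x] line_meas] that by simp
    have [measurable]: "(\<lambda>y. \<Prod>i\<in>I. epowr (\<integral>\<^sup>+s. f ((x(j := y))(i := s)) \<partial>lborel) t) \<in> borel_measurable lborel"
      by (intro borel_measurable_prod_ennreal) measurable
    \<comment> \<open>The constant factor of line \<open>j\<close> is \<open>epowr (F x) t\<close>.
      It raises the exponent of \<open>F x\<close> by \<open>t\<close>, to exactly the one demanded
      by the induction hypothesis for \<open>F\<close> and \<open>n\<close> coordinates.\<close>
    have e: "epowr (F x) t * (if n * t = 1 then 1 else epowr (F x) (1 - n * t)) = epowr (F x) (1 - (n - 1) * t)"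
      using epowr_add[of "F x" t "1 - n * t"] by (auto simp: algebra_simps)
    have "(\<integral>\<^sup>+y. ?g (x(j := y)) \<partial>lborel)
      = (\<integral>\<^sup>+y. epowr (F x) t * ((if n * t = 1 then 1 else epowr (f (x(j := y))) (1 - n * t))
        * (\<Prod>i\<in>I. epowr (\<integral>\<^sup>+s. f ((x(j := y))(i := s)) \<partial>lborel) t)) \<partial>lborel)"
      using insert by (simp add: F_def mult_ac)
    also have "\<dots> = epowr (F x) t * (\<integral>\<^sup>+y. ((if n * t = 1 then 1 else epowr (f (x(j := y))) (1 - n * t))
        * (\<Prod>i\<in>I. epowr (\<integral>\<^sup>+s. f ((x(j := y))(i := s)) \<partial>lborel) t)) \<partial>lborel)"
      by (rule nn_integral_cmult) measurable
    also have "\<dots> \<le> epowr (F x) t * ((if n * t = 1 then 1 else epowr (F x) (1 - n * t)) * (\<Prod>i\<in>I. epowr (\<integral>\<^sup>+s. F (x(i := s)) \<partial>lborel) t))"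
      by (intro mult_left_mono step x) auto
    also have "\<dots> = epowr (F x) (1 - (n - 1) * t) * (\<Prod>i\<in>I. epowr (\<integral>\<^sup>+s. F (x(i := s)) \<partial>lborel) t)"
      unfolding mult.assoc[symmetric] e ..
    \<comment> \<open>As \<open>n * t \<le> 1\<close> and \<open>0 < t\<close>, the exponent
      \<open>1 - (n - 1) * t\<close> is positive, so the first branch never occurs.\<close>
    also have "\<dots> = (if (n - 1) * t = 1 then 1 else epowr (F x) (1 - (n - 1) * t))
      * (\<Prod>i\<in>I. epowr (\<integral>\<^sup>+s. F (x(i := s)) \<partial>lborel) t)"
      using t by (auto simp: left_diff_distrib)
    finally show "(\<integral>\<^sup>+y. ?g (x(j := y)) \<partial>lborel) \<le> \<dots>" .
  qed
  also have "\<dots> \<le> epowr (\<integral>\<^sup>+x. F x \<partial>?M I) (1 + t)"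
    unfolding n_def using t by (intro insert.IH) (auto simp: n_def algebra_simps)
  also have "(\<integral>\<^sup>+x. F x \<partial>?M I) = (\<integral>\<^sup>+x. f x \<partial>?M (insert j I))"
    unfolding F_def using insert.hyps by (intro product_nn_integral_insert[symmetric]) measurable
  finally show ?case unfolding n add_diff_cancel_right' .
qed

lemma nn_integral_lborel_PiM:
  fixes u :: "'a::euclidean_space \<Rightarrow> ennreal"
  assumes [measurable]: "u \<in> borel_measurable borel"
  shows "(\<integral>\<^sup>+x. u x \<partial>lborel) = (\<integral>\<^sup>+y. u (\<Sum>b\<in>Basis. y b *\<^sub>R b) \<partial>Pi\<^sub>M Basis (\<lambda>_. lborel))"
  by (subst lborel_eq) (simp add: nn_integral_distr)

text \<open>The case \<open>t = 1 / (N - 1)\<close> of the inequality on lines, where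
  \<open>N\<close> is the dimension: the power of \<open>k\<close> outside the product drops out,
  and the left integrand is a product of \<open>N\<close> equal factors, each bounded by one line
  integral. With \<open>k\<close> abstract the inequality also serves powers of a function.\<close>

lemma Gagliardo_Nirenberg_lines:
  fixes w :: "'a::euclidean_space \<Rightarrow> real" and k :: "'a \<Rightarrow> ennreal"
  assumes [measurable]: "w \<in> borel_measurable borel" "k \<in> borel_measurable borel"
    and dim: "2 \<le> DIM('a)"
    and line: "\<And>x b. b \<in> Basis \<Longrightarrow> ennreal \<bar>w x\<bar> \<le> (\<integral>\<^sup>+s. k (x + (s - x \<bullet> b) *\<^sub>R b) \<partial>lborel)"
  shows "(\<integral>\<^sup>+x. epowr (ennreal \<bar>w x\<bar>) (real DIM('a) / (real DIM('a) - 1)) \<partial>lborel)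
    \<le> epowr (\<integral>\<^sup>+x. k x \<partial>lborel) (real DIM('a) / (real DIM('a) - 1))"
proof -
  let ?M = "Pi\<^sub>M (Basis :: 'a set) (\<lambda>_. lborel :: real measure)"
  let ?N = "real DIM('a)"
  define t where "t = 1 / (?N - 1)"
  define P where "P = (\<lambda>y. \<Sum>b\<in>Basis. y b *\<^sub>R b :: 'a)"
  have t: "0 < t" "(?N - 1) * t = 1" "?N / (?N - 1) = 1 + t" "?N / (?N - 1) = ?N * t"
    using dim by (auto simp: t_def field_simps)
  have [measurable]: "P \<in> ?M \<rightarrow>\<^sub>M borel" unfolding P_def by measurable
  have upd: "P (y(b := s)) = P y + (s - P y \<bullet> b) *\<^sub>R b" if "b \<in> Basis" for y b s
  proof -
    have "P y \<bullet> b = y b" using that by (simp add: P_def inner_sum_left_Basis)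
    moreover have "P (y(b := s)) = s *\<^sub>R b + (\<Sum>c\<in>Basis - {b}. y c *\<^sub>R c)"
      unfolding P_def by (subst sum.remove[OF _ that]) (auto intro!: sum.cong)
    moreover have "P y = y b *\<^sub>R b + (\<Sum>c\<in>Basis - {b}. y c *\<^sub>R c)"
      unfolding P_def by (subst sum.remove[OF _ that]) auto
    ultimately show ?thesis by (simp add: algebra_simps)
  qed
  have "(\<integral>\<^sup>+x. epowr (ennreal \<bar>w x\<bar>) (?N / (?N - 1)) \<partial>lborel)
      = (\<integral>\<^sup>+y. epowr (ennreal \<bar>w (P y)\<bar>) (?N * t) \<partial>?M)"
    unfolding t(4) P_def by (rule nn_integral_lborel_PiM) measurable
  also have "\<dots> \<le> (\<integral>\<^sup>+y. (if (real (card (Basis::'a set)) - 1) * t = 1 then 1 else epowr (k (P y)) (1 - (real (card (Basis::'a set)) - 1) * t))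
      * (\<Prod>b\<in>Basis. epowr (\<integral>\<^sup>+s. k (P (y(b := s))) \<partial>lborel) t) \<partial>?M)"
  proof (rule nn_integral_mono)
    fix y
    have "epowr a (?N * t) = (\<Prod>b\<in>(Basis::'a set). epowr a t)" for a
      by (cases a) (auto simp: epowr_ennreal powr_powr[symmetric] mult.commute[of _ t] powr_realpow' ennreal_power top_power_ennreal)
    also have "(\<Prod>b\<in>(Basis::'a set). epowr (ennreal \<bar>w (P y)\<bar>) t) \<le> (\<Prod>b\<in>Basis. epowr (\<integral>\<^sup>+s. k (P (y(b := s))) \<partial>lborel) t)"
      using line[of _ "P y"] t(1) by (intro prod_mono_ennreal epowr_mono) (auto simp: upd)
    finally show "epowr (ennreal \<bar>w (P y)\<bar>) (?N * t)
      \<le> (if (real (card (Basis::'a set)) - 1) * t = 1 then 1 else epowr (k (P y)) (1 - (real (card (Basis::'a set)) - 1) * t))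
      * (\<Prod>b\<in>Basis. epowr (\<integral>\<^sup>+s. k (P (y(b := s))) \<partial>lborel) t)"
      using t by simp
  qed
  also have "\<dots> \<le> epowr (\<integral>\<^sup>+y. k (P y) \<partial>?M) (1 + t)"
    using t by (intro nn_integral_grid_lines) auto
  also have "(\<integral>\<^sup>+y. k (P y) \<partial>?M) = (\<integral>\<^sup>+x. k x \<partial>lborel)"
    unfolding P_def by (rule nn_integral_lborel_PiM[symmetric]) measurable
  finally show ?thesis using t by simp
qed

section \<open>From the exponent 1 to a general exponent: powers of the modulus\<close>

lemma abs_powr_has_real_derivative:
  fixes g t :: real
  assumes g: "1 < g"
  shows "((\<lambda>t. \<bar>t\<bar> powr g) has_real_derivative g * \<bar>t\<bar> powr (g - 1) * sgn t) (at t)"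
proof -
  consider "t > 0" | "t < 0" | "t = 0" by linarith
  then show ?thesis
  proof cases
    case 1
    have "((\<lambda>t. t powr g) has_real_derivative g * t powr (g - 1)) (at t)"
      using 1 by (auto intro!: derivative_eq_intros)
    then have "((\<lambda>t. \<bar>t\<bar> powr g) has_real_derivative g * t powr (g - 1)) (at t)"
      by (rule DERIV_cong_ev[THEN iffD1, rotated -1, OF _ refl _ refl])
         (use 1 in \<open>auto intro!: eventually_mono[OF eventually_nhds_in_open[of "{0<..}" t]]\<close>)
    then show ?thesis using 1 by simp
  next
    case 2
    have "((\<lambda>t. (- t) powr g) has_real_derivative - (g * (- t) powr (g - 1))) (at t)"
      using 2 by (auto intro!: derivative_eq_intros)
    then have "((\<lambda>t. \<bar>t\<bar> powr g) has_real_derivative - (g * (- t) powr (g - 1))) (at t)"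
      by (rule DERIV_cong_ev[THEN iffD1, rotated -1, OF _ refl _ refl])
         (use 2 in \<open>auto intro!: eventually_mono[OF eventually_nhds_in_open[of "{..<0}" t]]\<close>)
    then show ?thesis using 2 by simp
  next
    case 3
    have "((\<lambda>h. \<bar>h\<bar> powr g / h) \<longlongrightarrow> 0) (at (0::real))"
    proof (rule Lim_null_comparison)
      have "norm (\<bar>h\<bar> powr g / h) \<le> \<bar>h\<bar> powr (g - 1)" for h :: real
        by (cases "h = 0") (simp_all add: powr_diff)
      then show "\<forall>\<^sub>F h in at 0. norm (\<bar>h\<bar> powr g / h) \<le> \<bar>h\<bar> powr (g - 1)" by simp
      show "((\<lambda>h::real. \<bar>h\<bar> powr (g - 1)) \<longlongrightarrow> 0) (at 0)"
        using g by (auto intro!: tendsto_eq_intros)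
    qed
    then show ?thesis using 3 by (simp add: DERIV_def)
  qed
qed

text \<open>The fundamental theorem along the coordinate line through \<open>x\<close>, started
  outside the support. An arbitrary derivative \<open>D\<close> with a continuous majorant
  \<open>k\<close> is allowed, so that the derivative of \<open>\<bar>w x\<bar> powr c\<close>
  fits.\<close>

lemma line_bound_of_compact_support:
  fixes w :: "'a::euclidean_space \<Rightarrow> real"
  assumes der: "\<And>x. (w has_derivative D x) (at x)"
    and bound: "\<And>x h. \<bar>D x h\<bar> \<le> k x * norm h"
    and k: "continuous_on UNIV k" "\<And>x. 0 \<le> k x"
    and supp: "\<And>x. R \<le> norm x \<Longrightarrow> w x = 0"
    and b: "b \<in> Basis"
  shows "ennreal \<bar>w x\<bar> \<le> (\<integral>\<^sup>+s. ennreal (k (x + (s - x \<bullet> b) *\<^sub>R b)) \<partial>lborel)"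
proof -
  define \<gamma> where "\<gamma> = (\<lambda>s. x + (s - x \<bullet> b) *\<^sub>R b)"
  \<comment> \<open>Lies to the left of \<open>x \<bullet> b\<close> and has modulus at least
    \<open>R\<close>; since it is a coordinate of \<open>\<gamma> a\<close>, that point has norm at
    least \<open>R\<close>.\<close>
  define a where "a = - \<bar>R\<bar> - \<bar>x \<bullet> b\<bar>"
  have "\<bar>\<gamma> a \<bullet> b\<bar> \<le> norm (\<gamma> a)" using b by (rule Basis_le_norm)
  moreover have "\<gamma> a \<bullet> b = a" using b by (simp add: \<gamma>_def inner_left_distrib)
  ultimately have "\<bar>a\<bar> \<le> norm (\<gamma> a)" by simp
  moreover have "R \<le> \<bar>a\<bar>" by (simp add: a_def)
  ultimately have "w (\<gamma> a) = 0" by (intro supp) simp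
  then have "ennreal \<bar>w x\<bar> = ennreal \<bar>w (\<gamma> (x \<bullet> b)) - w (\<gamma> a)\<bar>"
    by (simp add: \<gamma>_def)
  also have "\<dots> \<le> (\<integral>\<^sup>+s\<in>{a..x \<bullet> b}. ennreal (k (\<gamma> s)) \<partial>lborel)"
  proof (rule nn_integral_segment_bound)
    fix s
    have "((\<lambda>s. w (\<gamma> s)) has_derivative (\<lambda>r. D (\<gamma> s) (r *\<^sub>R b))) (at s within {a..x \<bullet> b})"
      by (rule has_derivative_compose[OF _ der]) (auto simp: \<gamma>_def intro!: derivative_eq_intros)
    moreover have "D (\<gamma> s) (r *\<^sub>R b) = D (\<gamma> s) b * r" for r
      using has_derivative_linear[OF der] by (simp add: linear_cmul)
    ultimately show "((\<lambda>s. w (\<gamma> s)) has_real_derivative D (\<gamma> s) b) (at s within {a..x \<bullet> b})"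
      by (simp add: has_field_derivative_def)
    show "\<bar>D (\<gamma> s) b\<bar> \<le> k (\<gamma> s)" using bound[of "\<gamma> s" b] b by simp
    show "continuous_on {a..x \<bullet> b} (\<lambda>s. k (\<gamma> s))"
      unfolding \<gamma>_def by (intro continuous_intros continuous_on_compose2[OF k(1)]) auto
  qed (auto simp: a_def k)
  also have "\<dots> \<le> (\<integral>\<^sup>+s. ennreal (k (\<gamma> s)) \<partial>lborel)"
    by (intro nn_integral_mono) (auto split: split_indicator)
  finally show ?thesis by (simp add: \<gamma>_def)
qed

text \<open>For \<open>1 < p\<close> the case \<open>p = 1\<close> is applied to \<open>\<bar>w\<bar> powr (p (N - 1) / (N - p))\<close>.\<close>

lemma Gagliardo_Nirenberg_Sobolev:
  fixes w :: "'a::euclidean_space \<Rightarrow> real" and p q :: real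
  assumes w: "C1_grad w W" and supp: "\<And>x. R \<le> norm x \<Longrightarrow> w x = 0"
    and p: "1 \<le> p" "p < DIM('a)" and q: "q = real DIM('a) / (real DIM('a) - p)"
  shows "epowr (\<integral>\<^sup>+x. ennreal (\<bar>w x\<bar> powr (p * q)) \<partial>lborel) (1 / q)
    \<le> ennreal ((p * (real DIM('a) - 1) / (real DIM('a) - p)) powr p) * (\<integral>\<^sup>+x. ennreal (norm (W x) powr p) \<partial>lborel)"
proof -
  note [measurable] = C1_gradD(4,5)[OF w]
  define N where "N = real DIM('a)"
  have N: "1 < N" "2 \<le> DIM('a)" using p by (auto simp: N_def)
  \<comment> \<open>Solves \<open>c * N / (N - 1) = p * q\<close>. Then also
    \<open>c - 1 = p * q * (1 - 1 / p)\<close>, so Hoelder's inequality reproduces the integral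
    \<open>X\<close> on the right.\<close>
  define c where "c = p * (N - 1) / (N - p)"
  have bound: "\<bar>W x \<bullet> h\<bar> \<le> norm (W x) * norm h" for x h by (rule Cauchy_Schwarz_ineq2)
  show ?thesis
  proof (cases "p = 1")
    case True
    have "(\<integral>\<^sup>+x. epowr (ennreal \<bar>w x\<bar>) (N / (N - 1)) \<partial>lborel)
      \<le> epowr (\<integral>\<^sup>+x. ennreal (norm (W x)) \<partial>lborel) (N / (N - 1))"
      unfolding N_def using N(2)
      by (intro Gagliardo_Nirenberg_lines
            line_bound_of_compact_support[OF C1_gradD(2)[OF w] bound _ _ supp] continuous_intros C1_gradD(1)[OF w]) auto
    from epowr_mono[OF this, of "1 / q"] show ?thesis
      using True N p unfolding q by (simp add: N_def[symmetric] epowr_epowr epowr_ennreal)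
  next
    case False
    with p have p: "1 < p" "p < N" by (auto simp: N_def)
    have c: "1 < c" using p by (simp add: c_def field_simps)
    define X where "X = (\<integral>\<^sup>+x. ennreal (\<bar>w x\<bar> powr (p * q)) \<partial>lborel)"
    define Y where "Y = (\<integral>\<^sup>+x. ennreal (norm (W x) powr p) \<partial>lborel)"
    define k where "k = (\<lambda>x. c * \<bar>w x\<bar> powr (c - 1) * norm (W x))"
    have k_cont: "continuous_on UNIV k"
      unfolding k_def using c
      by (intro continuous_intros C1_gradD(1)[OF w] C1_gradD(3)[OF w] continuous_on_powr') auto
    have [measurable]: "k \<in> borel_measurable borel" unfolding k_def by measurable
    have q': "q = N / (N - p)" using q by (simp add: N_def)
    have der: "((\<lambda>x. \<bar>w x\<bar> powr c) has_derivative (\<lambda>h. c * \<bar>w x\<bar> powr (c - 1) * sgn (w x) * (W x \<bullet> h))) (at x)" for x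
      using has_derivative_compose[OF C1_gradD(2)[OF w]
          abs_powr_has_real_derivative[OF c, of "w x", unfolded has_field_derivative_def]] .
    have le: "\<bar>c * \<bar>w x\<bar> powr (c - 1) * sgn (w x) * (W x \<bullet> h)\<bar> \<le> k x * norm h" for x h
    proof -
      have "\<bar>c * \<bar>w x\<bar> powr (c - 1) * sgn (w x) * (W x \<bullet> h)\<bar>
          = c * \<bar>w x\<bar> powr (c - 1) * \<bar>sgn (w x)\<bar> * \<bar>W x \<bullet> h\<bar>"
        using c by (simp add: abs_mult)
      also have "\<dots> \<le> c * \<bar>w x\<bar> powr (c - 1) * 1 * (norm (W x) * norm h)"
        using c bound by (intro mult_mono) (auto simp: abs_sgn_eq)
      finally show ?thesis by (simp add: k_def mult_ac)
    qed
    have "(\<integral>\<^sup>+x. epowr (ennreal \<bar>\<bar>w x\<bar> powr c\<bar>) (N / (N - 1)) \<partial>lborel)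
      \<le> epowr (\<integral>\<^sup>+x. ennreal (k x) \<partial>lborel) (N / (N - 1))"
      unfolding N_def using N(2) supp c
      by (intro Gagliardo_Nirenberg_lines line_bound_of_compact_support[OF der le k_cont, where R = R])
         (auto simp: k_def)
    moreover have "epowr (ennreal \<bar>\<bar>w x\<bar> powr c\<bar>) (N / (N - 1)) = ennreal (\<bar>w x\<bar> powr (p * q))" for x
      using N p by (simp add: epowr_ennreal powr_powr c_def q')
    ultimately have XK: "X \<le> epowr (\<integral>\<^sup>+x. ennreal (k x) \<partial>lborel) (N / (N - 1))"
      by (simp add: X_def)
    have e: "(c - 1) = p * q * (1 - 1 / p)"
      using p by (simp add: c_def q' field_simps)
    have "(\<integral>\<^sup>+x. ennreal (k x) \<partial>lborel)
        = (\<integral>\<^sup>+x. ennreal c * (epowr (ennreal (\<bar>w x\<bar> powr (p * q))) (1 - 1 / p) * epowr (ennreal (norm (W x) powr p)) (1 / p)) \<partial>lborel)"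
      using c p by (simp add: k_def epowr_ennreal powr_powr e ennreal_mult[symmetric] mult.assoc)
    also have "\<dots> = ennreal c * (\<integral>\<^sup>+x. (epowr (ennreal (\<bar>w x\<bar> powr (p * q))) (1 - 1 / p) * epowr (ennreal (norm (W x) powr p)) (1 / p)) \<partial>lborel)"
      by (rule nn_integral_cmult) measurable
    also have "\<dots> \<le> ennreal c * (epowr X (1 - 1 / p) * epowr Y (1 / p))"
      unfolding X_def Y_def using p by (intro mult_left_mono nn_integral_Holder) auto
    finally have K: "(\<integral>\<^sup>+x. ennreal (k x) \<partial>lborel) \<le> ennreal c * (epowr X (1 - 1 / p) * epowr Y (1 / p))" .
    \<comment> \<open>The power of \<open>X\<close> on the right. It is below 1 because
      \<open>p < N\<close>, so it can be absorbed into the left side once \<open>X\<close> is known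
      to be finite.\<close>
    define \<alpha> where "\<alpha> = (1 - 1 / p) * (N / (N - 1))"
    have \<alpha>1: "1 - \<alpha> = (N - p) / (p * (N - 1))"
      using p N by (simp add: \<alpha>_def field_simps)
    have "X \<le> epowr (ennreal c * (epowr X (1 - 1 / p) * epowr Y (1 / p))) (N / (N - 1))"
      using N by (intro order_trans[OF XK] epowr_mono K) auto
    also have "\<dots> = epowr X \<alpha> * (epowr (ennreal c) (N / (N - 1)) * epowr Y (1 / p * (N / (N - 1))))"
      using N by (simp add: epowr_mult epowr_epowr \<alpha>_def mult_ac)
    finally have 1: "X \<le> epowr X \<alpha> * (epowr (ennreal c) (N / (N - 1)) * epowr Y (1 / p * (N / (N - 1))))" .
    have X_fin: "X \<noteq> top"
    proof -
      have "compact (w ` cball 0 R)"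
        by (intro compact_continuous_image continuous_on_subset[OF C1_gradD(3)[OF w]]) auto
      then obtain B where B: "\<forall>x\<in>cball 0 R. \<bar>w x\<bar> \<le> B"
        by (auto dest!: compact_imp_bounded simp: bounded_iff)
      have "ennreal (\<bar>w x\<bar> powr (p * q)) \<le> ennreal (B powr (p * q)) * indicator (cball 0 R) x" for x
        using supp[of x] bspec[OF B, of x] p by (cases "x \<in> cball 0 R") (auto intro!: ennreal_leI powr_mono2 simp: q')
      then have "X \<le> (\<integral>\<^sup>+x. ennreal (B powr (p * q)) * indicator (cball 0 R) (x::'a) \<partial>lborel)"
        unfolding X_def by (intro nn_integral_mono)
      also have "\<dots> < top"
        using emeasure_compact_finite[of "cball (0::'a) R"]
        by (simp add: nn_integral_cmult_indicator ennreal_mult_less_top)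
      finally show ?thesis by simp
    qed
    have "epowr X (1 - \<alpha>) \<le> epowr (ennreal c) (N / (N - 1)) * epowr Y (1 / p * (N / (N - 1)))"
    proof (cases "X = 0")
      case False
      have "epowr X \<alpha> * epowr X (1 - \<alpha>) = X"
        using epowr_add[of X \<alpha> "1 - \<alpha>"] by simp
      with 1 have "epowr X \<alpha> * epowr X (1 - \<alpha>) \<le> epowr X \<alpha> * (epowr (ennreal c) (N / (N - 1)) * epowr Y (1 / p * (N / (N - 1))))"
        by simp
      then show ?thesis
        using False X_fin by (simp add: ennreal_mult_le_mult_iff)
    qed simp
    \<comment> \<open>Chosen so that the power of \<open>Y\<close> becomes 1; the power of
      \<open>X\<close> is then \<open>1 / q\<close>.\<close>
    from epowr_mono[OF this, of "p * (N - 1) / N"]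
    have "epowr X ((1 - \<alpha>) * (p * (N - 1) / N))
      \<le> ennreal (c powr (N / (N - 1) * (p * (N - 1) / N))) * epowr Y (1 / p * (N / (N - 1)) * (p * (N - 1) / N))"
      using p N c by (simp add: epowr_mult epowr_epowr epowr_ennreal powr_powr)
    moreover have "N / (N - 1) * (p * (N - 1) / N) = p" "1 / p * (N / (N - 1)) * (p * (N - 1) / N) = 1"
      "(1 - \<alpha>) * (p * (N - 1) / N) = 1 / q"
      unfolding \<alpha>1 q' using N(1) p by (simp_all add: divide_simps)
    ultimately have "epowr X (1 / q) \<le> ennreal (c powr p) * Y"
      by (simp only: epowr_1)
    then show ?thesis
      by (simp only: X_def Y_def N_def c_def)
  qed
qed

text \<open>A cutoff of class C^1 is enough for the Sobolev inequality. The squared norm is smooth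
  at the origin, and squaring the positive part removes the kink where the norm equals 2.\<close>

definition cutoff :: "'a::euclidean_space \<Rightarrow> real" where
  "cutoff x = (max 0 (1 - (norm x)\<^sup>2 / 4))\<^sup>2"

lemma max0_square_has_real_derivative:
  "((\<lambda>t::real. (max 0 t)\<^sup>2) has_real_derivative 2 * max 0 t) (at t)"
proof -
  \<comment> \<open>The squared positive part is the sum of \<open>t * t / 2\<close> and
    \<open>t * \<bar>t\<bar> / 2\<close>; only the second term is not a polynomial.\<close>
  have "((\<lambda>t::real. t * \<bar>t\<bar> / 2) has_real_derivative \<bar>t\<bar>) (at t)"
  proof -
    consider "t > 0" | "t < 0" | "t = 0" by linarith
    then show ?thesis
    proof cases
      case 1
      have "((\<lambda>t::real. t * t / 2) has_real_derivative t) (at t)"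
        by (auto intro!: derivative_eq_intros)
      then have "((\<lambda>t::real. t * \<bar>t\<bar> / 2) has_real_derivative t) (at t)"
        by (rule DERIV_cong_ev[THEN iffD1, rotated -1, OF _ refl _ refl])
           (use 1 in \<open>auto intro!: eventually_mono[OF eventually_nhds_in_open[of "{0<..}" t]]\<close>)
      then show ?thesis using 1 by simp
    next
      case 2
      have "((\<lambda>t::real. t * (- t) / 2) has_real_derivative - t) (at t)"
        by (auto intro!: derivative_eq_intros)
      then have "((\<lambda>t::real. t * \<bar>t\<bar> / 2) has_real_derivative - t) (at t)"
        by (rule DERIV_cong_ev[THEN iffD1, rotated -1, OF _ refl _ refl])
           (use 2 in \<open>auto intro!: eventually_mono[OF eventually_nhds_in_open[of "{..<0}" t]]\<close>)
      then show ?thesis using 2 by simp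
    next
      case 3
      have "((\<lambda>h::real. \<bar>h\<bar> / 2) \<longlongrightarrow> 0) (at 0)" by (auto intro!: tendsto_eq_intros)
      then have "((\<lambda>h::real. h * \<bar>h\<bar> / 2 / h) \<longlongrightarrow> 0) (at 0)"
        by (rule Lim_transform_eventually) (auto simp: eventually_at_filter)
      then show ?thesis using 3 by (simp add: DERIV_def)
    qed
  qed
  moreover have "((\<lambda>t::real. t * t / 2) has_real_derivative t) (at t)"
    by (auto intro!: derivative_eq_intros)
  ultimately have "((\<lambda>t::real. t * t / 2 + t * \<bar>t\<bar> / 2) has_real_derivative t + \<bar>t\<bar>) (at t)"
    by (intro DERIV_add)
  moreover have "(\<lambda>t::real. t * t / 2 + t * \<bar>t\<bar> / 2) = (\<lambda>t. (max 0 t)\<^sup>2)"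
    by (auto simp: max_def power2_eq_square abs_if)
  ultimately show ?thesis by (simp add: max_def abs_if split: if_splits)
qed

lemma C1_grad_cutoff: "C1_grad cutoff (\<lambda>x. (- max 0 (1 - (norm x)\<^sup>2 / 4)) *\<^sub>R x)"
  unfolding C1_grad_def
proof (intro conjI allI)
  show "continuous_on UNIV (\<lambda>x::'a. (- max 0 (1 - (norm x)\<^sup>2 / 4)) *\<^sub>R x)"
    by (intro continuous_intros) auto
  fix x :: 'a
  have "((\<lambda>x::'a. 1 - (norm x)\<^sup>2 / 4) has_derivative (\<lambda>h. - (x \<bullet> h) / 2)) (at x)"
    unfolding power2_norm_eq_inner by (auto intro!: derivative_eq_intros simp: inner_commute)
  from has_derivative_compose[OF this max0_square_has_real_derivative[unfolded has_field_derivative_def]]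
  show "(cutoff has_derivative (\<lambda>h. (- max 0 (1 - (norm x)\<^sup>2 / 4)) *\<^sub>R x \<bullet> h)) (at x)"
    unfolding cutoff_def by (rule has_derivative_eq_rhs) (auto simp: max_def)
qed

lemma C1_grad_mult:
  assumes "C1_grad v G" "C1_grad v' G'"
  shows "C1_grad (\<lambda>h. v h * v' h) (\<lambda>h. v h *\<^sub>R G' h + v' h *\<^sub>R G h)"
  using assms C1_gradD(3)[OF assms(1)] C1_gradD(3)[OF assms(2)] unfolding C1_grad_def
  by (auto intro!: continuous_intros derivative_eq_intros simp: inner_add_left algebra_simps)

lemma cutoff_bounds:
  "0 \<le> cutoff x" "cutoff x \<le> 1" "2 \<le> norm x \<Longrightarrow> cutoff x = 0" "norm x \<le> 1 \<Longrightarrow> 1 / 2 \<le> cutoff x"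
proof -
  show "0 \<le> cutoff x" by (simp add: cutoff_def)
  have "(max 0 (1 - (norm x)\<^sup>2 / 4))\<^sup>2 \<le> 1\<^sup>2" by (intro power_mono) auto
  then show "cutoff x \<le> 1" by (simp add: cutoff_def)
  show "cutoff x = 0" if "2 \<le> norm x"
    using power_mono[OF that, of 2] by (simp add: cutoff_def)
  show "1 / 2 \<le> cutoff x" if "norm x \<le> 1"
  proof -
    have "(norm x)\<^sup>2 \<le> 1" using power_mono[OF that, of 2] by simp
    then have "(3 / 4)\<^sup>2 \<le> cutoff x" unfolding cutoff_def by (intro power_mono) auto
    then show ?thesis by (simp add: power2_eq_square)
  qed
qed

text \<open>Localisation for the Sobolev inequality: the product has compact support, at the price
  of a zero-order term whose factor 2 bounds the gradient of the cutoff.\<close>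

lemma C1_grad_cutoff_mult:
  assumes v: "C1_grad v G"
  obtains W where "C1_grad (\<lambda>x. cutoff x * v x) W"
    "\<And>x. norm (W x) \<le> indicator (ball 0 2) x * (norm (G x) + 2 * \<bar>v x\<bar>)"
proof
  let ?H = "\<lambda>x::'a. (- max 0 (1 - (norm x)\<^sup>2 / 4)) *\<^sub>R x"
  show "C1_grad (\<lambda>x. cutoff x * v x) (\<lambda>x. cutoff x *\<^sub>R G x + v x *\<^sub>R ?H x)"
    by (rule C1_grad_mult[OF C1_grad_cutoff v])
  show "norm (cutoff x *\<^sub>R G x + v x *\<^sub>R ?H x) \<le> indicator (ball 0 2) x * (norm (G x) + 2 * \<bar>v x\<bar>)" for x
  proof (cases "norm x < 2")
    case True
    have "norm (?H x) \<le> 1 * 2" unfolding norm_scaleR using True by (intro mult_mono) auto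
    then have "norm (v x *\<^sub>R ?H x) \<le> \<bar>v x\<bar> * 2" unfolding norm_scaleR[of "v x"] by (intro mult_left_mono) auto
    moreover have "norm (cutoff x *\<^sub>R G x) \<le> 1 * norm (G x)"
      unfolding norm_scaleR using cutoff_bounds[of x] by (intro mult_right_mono) auto
    ultimately show ?thesis using True norm_triangle_ineq[of "cutoff x *\<^sub>R G x" "v x *\<^sub>R ?H x"] by simp
  next
    case False
    then have "2\<^sup>2 \<le> (norm x)\<^sup>2" by (intro power_mono) auto
    then show ?thesis using False cutoff_bounds(3)[of x] by simp
  qed
qed

section \<open>Local Sobolev estimate and dyadic shells\<close>

lemma sets_borel_ball [measurable]: "ball c r \<in> sets borel"
  by simp

text \<open>Hoelder's inequality with the indicator of \<open>A\<close> as the second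
  factor.\<close>

lemma epowr_set_nn_integral_le:
  assumes [measurable]: "A \<in> sets M" "u \<in> borel_measurable M" and r: "1 < r"
  shows "epowr (\<integral>\<^sup>+x\<in>A. u x \<partial>M) r \<le> epowr (emeasure M A) (r - 1) * (\<integral>\<^sup>+x\<in>A. epowr (u x) r \<partial>M)"
proof -
  have "u x * indicator A x = epowr (epowr (u x) r * indicator A x) (1 / r) * epowr (indicator A x) (1 - 1 / r)" for x
    using r by (auto simp: epowr_epowr split: split_indicator)
  then have "(\<integral>\<^sup>+x\<in>A. u x \<partial>M) = (\<integral>\<^sup>+x. epowr (epowr (u x) r * indicator A x) (1 / r) * epowr (indicator A x) (1 - 1 / r) \<partial>M)"
    by metis
  also have "\<dots> \<le> epowr (\<integral>\<^sup>+x\<in>A. epowr (u x) r \<partial>M) (1 / r) * epowr (\<integral>\<^sup>+x. indicator A x \<partial>M) (1 - 1 / r)"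
    using r by (intro nn_integral_Holder) auto
  finally have "(\<integral>\<^sup>+x\<in>A. u x \<partial>M) \<le> epowr (\<integral>\<^sup>+x\<in>A. epowr (u x) r \<partial>M) (1 / r) * epowr (emeasure M A) (1 - 1 / r)"
    by simp
  from epowr_mono[OF this, of r] r show ?thesis
    by (simp add: epowr_mult epowr_epowr algebra_simps)
qed

text \<open>The factor \<open>4 powr p\<close> comes from the two-term inequality and from the
  coefficient 2 of \<open>\<bar>v x\<bar>\<close>, the factor \<open>2 powr p\<close> from
  \<open>1 / 2 \<le> cutoff x\<close> on the unit ball. Together they form the later
  \<open>8 powr p\<close>.\<close>

lemma cutoff_powr_bounds:
  fixes G W :: "'a::euclidean_space \<Rightarrow> 'a"
  assumes W: "norm (W x) \<le> indicator (ball 0 2) x * (norm (G x) + 2 * \<bar>v x\<bar>)" and p: "0 < p"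
  shows "norm (W x) powr p \<le> 4 powr p * (indicator (ball 0 2) x * (norm (G x) powr p + \<bar>v x\<bar> powr p))"
    and "norm x < 1 \<Longrightarrow> \<bar>v x\<bar> powr p \<le> 2 powr p * \<bar>cutoff x * v x\<bar> powr p"
proof -
  show "norm (W x) powr p \<le> 4 powr p * (indicator (ball 0 2) x * (norm (G x) powr p + \<bar>v x\<bar> powr p))"
  proof (cases "norm x < 2")
    case True
    have "norm (W x) powr p \<le> (norm (G x) + 2 * \<bar>v x\<bar>) powr p"
      using W True p by (intro powr_mono2) auto
    also have "\<dots> \<le> 2 powr p * (norm (G x) powr p + (2 * \<bar>v x\<bar>) powr p)"
      using p by (intro powr_add_le_two) auto
    also have "\<dots> \<le> 2 powr p * (2 powr p * (norm (G x) powr p + \<bar>v x\<bar> powr p))"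
    proof -
      have "1 \<le> (2::real) powr p" using p by (intro ge_one_powr_ge_zero) auto
      then have "1 * norm (G x) powr p \<le> 2 powr p * norm (G x) powr p" by (intro mult_right_mono) auto
      then show ?thesis by (intro mult_left_mono) (auto simp: powr_mult distrib_left)
    qed
    also have "\<dots> = 4 powr p * (norm (G x) powr p + \<bar>v x\<bar> powr p)"
      using powr_mult[of 2 2 p] by simp
    finally show ?thesis using True by simp
  qed (use W in auto)
  show "\<bar>v x\<bar> powr p \<le> 2 powr p * \<bar>cutoff x * v x\<bar> powr p" if "norm x < 1"
  proof -
    have "1 / 2 * \<bar>v x\<bar> \<le> cutoff x * \<bar>v x\<bar>"
      using cutoff_bounds(4)[of x] that by (intro mult_right_mono) auto
    then have "\<bar>v x\<bar> \<le> 2 * \<bar>cutoff x * v x\<bar>"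
      using cutoff_bounds(1)[of x] by (simp add: abs_mult)
    then have "\<bar>v x\<bar> powr p \<le> (2 * \<bar>cutoff x * v x\<bar>) powr p"
      using p by (intro powr_mono2) auto
    then show ?thesis by (simp add: powr_mult)
  qed
qed

text \<open>Reduces the local inequality to one for the compactly supported product with the cutoff.
  The constant \<open>C\<close> is left open because the subcritical case and the one-dimensional
  case supply different ones.\<close>

lemma local_Sobolev_from_cutoff:
  fixes v :: "'a::euclidean_space \<Rightarrow> real"
  assumes v: "C1_grad v G" and p: "0 < p" and q: "0 < q" and C: "0 \<le> C"
    and W: "C1_grad (\<lambda>x. cutoff x * v x) W"
      "\<And>x. norm (W x) \<le> indicator (ball 0 2) x * (norm (G x) + 2 * \<bar>v x\<bar>)"
    and sob: "epowr (\<integral>\<^sup>+x\<in>ball 0 1. ennreal (\<bar>cutoff x * v x\<bar> powr (p * q)) \<partial>lborel) (1 / q)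
      \<le> ennreal C * (\<integral>\<^sup>+x. ennreal (norm (W x) powr p) \<partial>lborel)"
  shows "epowr (\<integral>\<^sup>+x\<in>ball 0 1. ennreal (\<bar>v x\<bar> powr (p * q)) \<partial>lborel) (1 / q)
    \<le> ennreal (8 powr p * C) * (\<integral>\<^sup>+x\<in>ball 0 2. ennreal (norm (G x) powr p + \<bar>v x\<bar> powr p) \<partial>lborel)"
proof -
  note [measurable] = C1_gradD(4,5)[OF v] C1_gradD(4,5)[OF W(1)] C1_gradD(4)[OF C1_grad_cutoff]
  have pq: "0 < p * q" using p q by simp
  have bd: "norm (W x) powr p \<le> 4 powr p * (indicator (ball 0 2) x * (norm (G x) powr p + \<bar>v x\<bar> powr p))"
    "norm x < 1 \<Longrightarrow> \<bar>v x\<bar> powr (p * q) \<le> 2 powr (p * q) * \<bar>cutoff x * v x\<bar> powr (p * q)" for x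
    by (rule cutoff_powr_bounds(1)[where v=v, OF W(2) p], rule cutoff_powr_bounds(2)[where v=v, OF W(2) pq])
  have "(\<integral>\<^sup>+x\<in>ball 0 1. ennreal (\<bar>v x\<bar> powr (p * q)) \<partial>lborel)
      \<le> (\<integral>\<^sup>+x. ennreal (2 powr (p * q)) * (ennreal (\<bar>cutoff x * v x\<bar> powr (p * q)) * indicator (ball 0 1) x) \<partial>lborel)"
    using bd(2) by (intro nn_integral_mono)
      (auto simp: ennreal_mult[symmetric] intro!: ennreal_leI split: split_indicator)
  also have "\<dots> = ennreal (2 powr (p * q)) * (\<integral>\<^sup>+x\<in>ball 0 1. ennreal (\<bar>cutoff x * v x\<bar> powr (p * q)) \<partial>lborel)"
    by (rule nn_integral_cmult) measurable
  finally have "epowr (\<integral>\<^sup>+x\<in>ball 0 1. ennreal (\<bar>v x\<bar> powr (p * q)) \<partial>lborel) (1 / q)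
      \<le> epowr (ennreal (2 powr (p * q)) * (\<integral>\<^sup>+x\<in>ball 0 1. ennreal (\<bar>cutoff x * v x\<bar> powr (p * q)) \<partial>lborel)) (1 / q)"
    using q by (intro epowr_mono) auto
  also have "\<dots> = ennreal (2 powr p) * epowr (\<integral>\<^sup>+x\<in>ball 0 1. ennreal (\<bar>cutoff x * v x\<bar> powr (p * q)) \<partial>lborel) (1 / q)"
    using q by (simp add: epowr_mult epowr_ennreal powr_powr)
  also have "\<dots> \<le> ennreal (2 powr p) * (ennreal C * (\<integral>\<^sup>+x. ennreal (norm (W x) powr p) \<partial>lborel))"
    by (intro mult_left_mono sob) auto
  also have "\<dots> \<le> ennreal (2 powr p) * (ennreal C * (\<integral>\<^sup>+x. ennreal (4 powr p) *
      (ennreal (norm (G x) powr p + \<bar>v x\<bar> powr p) * indicator (ball 0 2) x) \<partial>lborel))"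
  proof (intro mult_left_mono nn_integral_mono)
    show "ennreal (norm (W x) powr p) \<le> ennreal (4 powr p) * (ennreal (norm (G x) powr p + \<bar>v x\<bar> powr p) * indicator (ball 0 2) x)" for x
      using bd(1)[of x] by (auto simp: ennreal_mult[symmetric] intro!: ennreal_leI split: split_indicator simp del: ennreal_plus)
  qed auto
  also have "(\<integral>\<^sup>+x. ennreal (4 powr p) * (ennreal (norm (G x) powr p + \<bar>v x\<bar> powr p) * indicator (ball 0 2) x) \<partial>lborel)
      = ennreal (4 powr p) * (\<integral>\<^sup>+x\<in>ball 0 2. ennreal (norm (G x) powr p + \<bar>v x\<bar> powr p) \<partial>lborel)"
    by (rule nn_integral_cmult) measurable
  also have "ennreal (2 powr p) * (ennreal C * (ennreal (4 powr p) * y)) = ennreal (8 powr p * C) * y" for y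
    using C powr_mult[of 2 4 p] by (simp add: ennreal_mult mult_ac)
  finally show ?thesis .
qed

lemma nn_integral_lborel_DIM_1:
  fixes u :: "'a::euclidean_space \<Rightarrow> ennreal"
  assumes [measurable]: "u \<in> borel_measurable borel" and b: "Basis = {b}"
  shows "(\<integral>\<^sup>+x. u x \<partial>lborel) = (\<integral>\<^sup>+s. u (s *\<^sub>R b) \<partial>lborel)"
proof -
  interpret product_sigma_finite "\<lambda>_::'a. lborel :: real measure" ..
  have "(\<integral>\<^sup>+x. u x \<partial>lborel) = (\<integral>\<^sup>+y. u (y b *\<^sub>R b) \<partial>Pi\<^sub>M {b} (\<lambda>_. lborel))"
    using nn_integral_lborel_PiM[of u] unfolding b by simp
  also have "\<dots> = (\<integral>\<^sup>+s. u (s *\<^sub>R b) \<partial>lborel)"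
    by (rule product_nn_integral_singleton) measurable
  finally show ?thesis .
qed

text \<open>For \<open>p = N \<ge> 2\<close> the exponent \<open>s = N q / (q + 1) < N\<close> has the Sobolev conjugate \<open>N q\<close>.\<close>

lemma local_Sobolev:
  assumes p: "1 \<le> p" and q: "1 \<le> q"
    and pq: "p < real DIM('a) \<and> q = real DIM('a) / (real DIM('a) - p) \<or> p = real DIM('a)"
  shows "\<exists>C\<ge>0. \<forall>(v :: 'a::euclidean_space \<Rightarrow> real) G. C1_grad v G \<longrightarrow>
    epowr (\<integral>\<^sup>+x\<in>ball 0 1. ennreal (\<bar>v x\<bar> powr (p * q)) \<partial>lborel) (1 / q)
    \<le> ennreal C * (\<integral>\<^sup>+x\<in>ball 0 2. ennreal (norm (G x) powr p + \<bar>v x\<bar> powr p) \<partial>lborel)"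
proof -
  define N where "N = real DIM('a)"
  have sub: "\<exists>C\<ge>0. \<forall>(v :: 'a \<Rightarrow> real) G. C1_grad v G \<longrightarrow>
    epowr (\<integral>\<^sup>+x\<in>ball 0 1. ennreal (\<bar>v x\<bar> powr (p * q)) \<partial>lborel) (1 / q)
    \<le> ennreal C * (\<integral>\<^sup>+x\<in>ball 0 2. ennreal (norm (G x) powr p + \<bar>v x\<bar> powr p) \<partial>lborel)"
    if p: "1 \<le> p" "p < N" and q: "q = N / (N - p)" for p q
  proof -
    define C where "C = (p * (N - 1) / (N - p)) powr p"
    have q0: "0 < q" using p q by simp
    have "epowr (\<integral>\<^sup>+x\<in>ball 0 1. ennreal (\<bar>v x\<bar> powr (p * q)) \<partial>lborel) (1 / q)
        \<le> ennreal (8 powr p * C) * (\<integral>\<^sup>+x\<in>ball 0 2. ennreal (norm (G x) powr p + \<bar>v x\<bar> powr p) \<partial>lborel)"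
      if v: "C1_grad v G" for v :: "'a \<Rightarrow> real" and G
    proof -
      obtain W where W: "C1_grad (\<lambda>x. cutoff x * v x) W"
        "\<And>x. norm (W x) \<le> indicator (ball 0 2) x * (norm (G x) + 2 * \<bar>v x\<bar>)"
        using C1_grad_cutoff_mult[OF v] by blast
      have "epowr (\<integral>\<^sup>+x\<in>ball 0 1. ennreal (\<bar>cutoff x * v x\<bar> powr (p * q)) \<partial>lborel) (1 / q)
        \<le> epowr (\<integral>\<^sup>+x. ennreal (\<bar>cutoff x * v x\<bar> powr (p * q)) \<partial>lborel) (1 / q)"
        using q0 by (intro epowr_mono nn_integral_mono) (auto split: split_indicator)
      also have "\<dots> \<le> ennreal C * (\<integral>\<^sup>+x. ennreal (norm (W x) powr p) \<partial>lborel)"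
        unfolding C_def N_def using p q
        by (intro Gagliardo_Nirenberg_Sobolev[OF W(1), of 2]) (auto simp: N_def cutoff_bounds)
      finally show ?thesis
        using p q0 by (intro local_Sobolev_from_cutoff[OF v _ _ _ W]) (auto simp: C_def)
    qed
    then show ?thesis by (intro exI[of _ "8 powr p * C"]) (auto simp: C_def)
  qed
  consider "p < N" "q = N / (N - p)" | "p = N" "2 \<le> N" | "p = 1" "N = 1"
  proof -
    have "DIM('a) = 1 \<or> 2 \<le> DIM('a)" using DIM_positive[where 'a='a] by arith
    then have "N = 1 \<or> 2 \<le> N" by (auto simp: N_def)
    then show ?thesis using pq that by (auto simp: N_def)
  qed
  then show ?thesis
  proof cases
    case 1
    then show ?thesis using sub p by blast
  next
    case 2
    define s where "s = N * q / (q + 1)"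
    \<comment> \<open>Undoes the change of exponents: \<open>s * r = p\<close> for the integrands
      and \<open>1 / (q + 1) * r = 1 / q\<close> for the outer root. Hoelder's inequality on the
      ball of radius 2 costs the factor \<open>B powr (r - 1)\<close>.\<close>
    define r where "r = (q + 1) / q"
    have "q \<noteq> 0" "q + 1 \<noteq> 0" using q by auto
    then have r: "1 < r" "s * r = p" using q 2 by (auto simp: r_def s_def divide_simps)
    have s: "1 \<le> s" "s < N" "q + 1 = N / (N - s)" "s * (q + 1) = p * q"
    proof -
      have "2 * q \<le> N * q" using q 2 by (intro mult_right_mono) auto
      then have "q + 1 \<le> N * q" using q by linarith
      then show "1 \<le> s" using q by (simp add: s_def)
      show "s < N" using q 2 by (simp add: s_def field_simps)
      have "N - s = N / (q + 1)" using q by (simp add: s_def field_simps)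
      then show "q + 1 = N / (N - s)" using 2 q by simp
      show "s * (q + 1) = p * q" using q 2 by (simp add: s_def)
    qed
    obtain C where C: "0 \<le> C" and le: "\<And>(v :: 'a \<Rightarrow> real) G. C1_grad v G \<Longrightarrow>
      epowr (\<integral>\<^sup>+x\<in>ball 0 1. ennreal (\<bar>v x\<bar> powr (s * (q + 1))) \<partial>lborel) (1 / (q + 1))
      \<le> ennreal C * (\<integral>\<^sup>+x\<in>ball 0 2. ennreal (norm (G x) powr s + \<bar>v x\<bar> powr s) \<partial>lborel)"
      using sub[OF s(1-3)] by blast
    define B where "B = measure lborel (ball (0::'a) 2)"
    have B: "emeasure lborel (ball (0::'a) 2) = ennreal B"
      unfolding B_def by (rule emeasure_eq_ennreal_measure) (simp add: emeasure_lborel_ball_pos)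
    define K where "K = C powr r * (B powr (r - 1) * 2 powr r)"
    have "epowr (\<integral>\<^sup>+x\<in>ball 0 1. ennreal (\<bar>v x\<bar> powr (p * q)) \<partial>lborel) (1 / q)
      \<le> ennreal K * (\<integral>\<^sup>+x\<in>ball 0 2. ennreal (norm (G x) powr p + \<bar>v x\<bar> powr p) \<partial>lborel)"
      if v: "C1_grad v G" for v :: "'a \<Rightarrow> real" and G
    proof -
      note [measurable] = C1_gradD(4,5)[OF v]
      have "epowr (\<integral>\<^sup>+x\<in>ball 0 1. ennreal (\<bar>v x\<bar> powr (p * q)) \<partial>lborel) (1 / q)
        = epowr (epowr (\<integral>\<^sup>+x\<in>ball 0 1. ennreal (\<bar>v x\<bar> powr (p * q)) \<partial>lborel) (1 / (q + 1))) r"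
        using q by (simp add: epowr_epowr r_def)
      also have "\<dots> \<le> epowr (ennreal C * (\<integral>\<^sup>+x\<in>ball 0 2. ennreal (norm (G x) powr s + \<bar>v x\<bar> powr s) \<partial>lborel)) r"
        using le[OF v] r unfolding s(4) by (intro epowr_mono) auto
      also have "\<dots> = ennreal (C powr r) * epowr (\<integral>\<^sup>+x\<in>ball 0 2. ennreal (norm (G x) powr s + \<bar>v x\<bar> powr s) \<partial>lborel) r"
        using r C by (simp add: epowr_mult epowr_ennreal)
      also have "\<dots> \<le> ennreal (C powr r) * (epowr (emeasure lborel (ball (0::'a) 2)) (r - 1)
          * (\<integral>\<^sup>+x\<in>ball 0 2. epowr (ennreal (norm (G x) powr s + \<bar>v x\<bar> powr s)) r \<partial>lborel))"
        using r by (intro mult_left_mono epowr_set_nn_integral_le) auto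
      also have "\<dots> \<le> ennreal (C powr r) * (ennreal (B powr (r - 1))
          * (\<integral>\<^sup>+x. ennreal (2 powr r) * (ennreal (norm (G x) powr p + \<bar>v x\<bar> powr p) * indicator (ball 0 2) x) \<partial>lborel))"
      proof (rule mult_left_mono[OF mult_mono[OF _ nn_integral_mono]])
        show "epowr (emeasure lborel (ball (0::'a) 2)) (r - 1) \<le> ennreal (B powr (r - 1))"
          by (simp add: B epowr_ennreal B_def)
        show "epowr (ennreal (norm (G x) powr s + \<bar>v x\<bar> powr s)) r * indicator (ball 0 2) x
          \<le> ennreal (2 powr r) * (ennreal (norm (G x) powr p + \<bar>v x\<bar> powr p) * indicator (ball 0 2) x)" for x
          using powr_add_le_two[of "norm (G x) powr s" "\<bar>v x\<bar> powr s" r] r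
          by (auto simp: epowr_ennreal powr_powr ennreal_mult[symmetric] intro!: ennreal_leI split: split_indicator
                   simp del: ennreal_plus)
      qed auto
      also have "(\<integral>\<^sup>+x. ennreal (2 powr r) * (ennreal (norm (G x) powr p + \<bar>v x\<bar> powr p) * indicator (ball 0 2) x) \<partial>lborel)
        = ennreal (2 powr r) * (\<integral>\<^sup>+x\<in>ball 0 2. ennreal (norm (G x) powr p + \<bar>v x\<bar> powr p) \<partial>lborel)"
        by (rule nn_integral_cmult) measurable
      finally show ?thesis
        by (simp add: K_def ennreal_mult mult_ac)
    qed
    then show ?thesis by (intro exI[of _ K]) (auto simp: K_def)
  next
    case 3
    then obtain b :: 'a where b: "Basis = {b}"
      using card_1_singletonE[of "Basis :: 'a set"] by (auto simp: N_def)
    define B where "B = measure lborel (ball (0::'a) 1)"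
    have B: "emeasure lborel (ball (0::'a) 1) = ennreal B"
      unfolding B_def by (rule emeasure_eq_ennreal_measure) (simp add: emeasure_lborel_ball_pos)
    define C where "C = B powr (1 / q)"
    have "epowr (\<integral>\<^sup>+x\<in>ball 0 1. ennreal (\<bar>v x\<bar> powr (p * q)) \<partial>lborel) (1 / q)
      \<le> ennreal (8 powr p * C) * (\<integral>\<^sup>+x\<in>ball 0 2. ennreal (norm (G x) powr p + \<bar>v x\<bar> powr p) \<partial>lborel)"
      if v: "C1_grad v G" for v :: "'a \<Rightarrow> real" and G
    proof -
      obtain W where W: "C1_grad (\<lambda>x. cutoff x * v x) W"
        "\<And>x. norm (W x) \<le> indicator (ball 0 2) x * (norm (G x) + 2 * \<bar>v x\<bar>)"
        using C1_grad_cutoff_mult[OF v] by blast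
      note [measurable] = C1_gradD(4,5)[OF W(1)]
      define A where "A = (\<integral>\<^sup>+x. ennreal (norm (W x)) \<partial>lborel)"
      \<comment> \<open>In dimension 1 the line through \<open>x\<close> is the whole space, so the
        function is bounded by the full integral of its derivative. Any \<open>q\<close> then costs
        only a power of the volume of the unit ball.\<close>
      have sup: "ennreal \<bar>cutoff x * v x\<bar> \<le> A" for x
      proof -
        have "x + (s - x \<bullet> b) *\<^sub>R b = s *\<^sub>R b" for s
          using euclidean_representation[of x] unfolding b by (simp add: algebra_simps)
        then have "A = (\<integral>\<^sup>+s. ennreal (norm (W (x + (s - x \<bullet> b) *\<^sub>R b))) \<partial>lborel)"
          unfolding A_def by (subst nn_integral_lborel_DIM_1[OF _ b]) auto
        then show ?thesis
          using line_bound_of_compact_support[OF C1_gradD(2)[OF W(1)] Cauchy_Schwarz_ineq2, of 2 b x] b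
          by (auto simp: cutoff_bounds intro!: continuous_intros C1_gradD(1)[OF W(1)])
      qed
      have "(\<integral>\<^sup>+x\<in>ball 0 1. ennreal (\<bar>cutoff x * v x\<bar> powr (p * q)) \<partial>lborel)
        \<le> (\<integral>\<^sup>+x. epowr A q * indicator (ball 0 1) (x::'a) \<partial>lborel)"
        using epowr_mono[OF sup, of q] 3 q
        by (intro nn_integral_mono mult_right_mono) (auto simp: epowr_ennreal)
      also have "\<dots> = epowr A q * ennreal B"
        by (simp add: nn_integral_cmult_indicator B)
      finally have "epowr (\<integral>\<^sup>+x\<in>ball 0 1. ennreal (\<bar>cutoff x * v x\<bar> powr (p * q)) \<partial>lborel) (1 / q)
        \<le> epowr (epowr A q * ennreal B) (1 / q)"
        using q by (intro epowr_mono) auto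
      also have "\<dots> = ennreal C * A"
        using q by (simp add: epowr_mult epowr_epowr epowr_ennreal B_def C_def mult.commute)
      finally have "epowr (\<integral>\<^sup>+x\<in>ball 0 1. ennreal (\<bar>cutoff x * v x\<bar> powr (p * q)) \<partial>lborel) (1 / q)
        \<le> ennreal C * (\<integral>\<^sup>+x. ennreal (norm (W x) powr p) \<partial>lborel)"
        using 3 by (simp add: A_def)
      then show ?thesis
        using p q by (intro local_Sobolev_from_cutoff[OF v _ _ _ W]) (auto simp: C_def)
    qed
    then show ?thesis by (intro exI[of _ "8 powr p * C"]) (auto simp: C_def)
  qed
qed

section \<open>Rescaling and summation over dyadic balls\<close>

lemma nn_integral_ball_scale:
  fixes u :: "'a::euclidean_space \<Rightarrow> ennreal"
  assumes [measurable]: "u \<in> borel_measurable borel" and r: "0 < r"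
  shows "(\<integral>\<^sup>+x\<in>ball 0 (c * r). u x \<partial>lborel)
    = ennreal (r ^ DIM('a)) * (\<integral>\<^sup>+x\<in>ball 0 c. u (r *\<^sub>R x) \<partial>lborel)"
proof -
  have "indicator (ball 0 (c * r)) (r *\<^sub>R x) = (indicator (ball 0 c) x :: ennreal)" for x :: 'a
    using r by (auto split: split_indicator simp: mult.commute)
  then show ?thesis
    using r by (subst nn_integral_lborel_affine[of _ r 0]) auto
qed

text \<open>Dilation of the unit ball estimate, with \<open>N\<close> the dimension: the root of the
  volume factor gives \<open>r powr (N / q)\<close>, returning to the ball of radius
  \<open>2 * r\<close> gives \<open>r powr (- N)\<close>, and the gradient picks up a factor
  \<open>r\<close>.\<close>

lemma local_Sobolev_scaled:
  assumes p: "1 \<le> p" and q: "1 \<le> q"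
    and pq: "p < real DIM('a) \<and> q = real DIM('a) / (real DIM('a) - p) \<or> p = real DIM('a)"
  shows "\<exists>C\<ge>0. \<forall>(v :: 'a::euclidean_space \<Rightarrow> real) G r. C1_grad v G \<longrightarrow> 0 < r \<longrightarrow>
    epowr (\<integral>\<^sup>+x\<in>ball 0 r. ennreal (\<bar>v x\<bar> powr (p * q)) \<partial>lborel) (1 / q)
    \<le> ennreal (C * r powr (DIM('a) / q - DIM('a)))
       * (\<integral>\<^sup>+x\<in>ball 0 (2 * r). ennreal (r powr p * norm (G x) powr p + \<bar>v x\<bar> powr p) \<partial>lborel)"
proof -
  define N where "N = real DIM('a)"
  obtain C where C: "C \<ge> 0" and le: "\<And>(v :: 'a::euclidean_space \<Rightarrow> real) G. C1_grad v G \<Longrightarrow>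
    epowr (\<integral>\<^sup>+x\<in>ball 0 1. ennreal (\<bar>v x\<bar> powr (p * q)) \<partial>lborel) (1 / q)
    \<le> ennreal C * (\<integral>\<^sup>+x\<in>ball 0 2. ennreal (norm (G x) powr p + \<bar>v x\<bar> powr p) \<partial>lborel)"
    using local_Sobolev[OF assms] by blast
  show ?thesis
  proof (intro exI[of _ C] conjI allI impI C)
    fix v :: "'a \<Rightarrow> real" and G and r :: real
    assume v: "C1_grad v G" and r: "0 < r"
    note [measurable] = C1_gradD(4,5)[OF v]
    let ?U = "\<lambda>x. ennreal (r powr p * norm (G x) powr p + \<bar>v x\<bar> powr p)"
    have rN: "r ^ DIM('a) = r powr N" using r by (simp add: N_def powr_realpow)
    have "(\<integral>\<^sup>+x\<in>ball 0 r. ennreal (\<bar>v x\<bar> powr (p * q)) \<partial>lborel)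
        = ennreal (r powr N) * (\<integral>\<^sup>+x\<in>ball 0 1. ennreal (\<bar>v (r *\<^sub>R x)\<bar> powr (p * q)) \<partial>lborel)"
      using nn_integral_ball_scale[of "\<lambda>x. ennreal (\<bar>v x\<bar> powr (p * q))" r 1] r by (simp add: rN)
    then have "epowr (\<integral>\<^sup>+x\<in>ball 0 r. ennreal (\<bar>v x\<bar> powr (p * q)) \<partial>lborel) (1 / q)
        = ennreal (r powr (N / q)) * epowr (\<integral>\<^sup>+x\<in>ball 0 1. ennreal (\<bar>v (r *\<^sub>R x)\<bar> powr (p * q)) \<partial>lborel) (1 / q)"
      using q by (simp add: epowr_mult epowr_ennreal powr_powr)
    also have "\<dots> \<le> ennreal (r powr (N / q)) * (ennreal C *
        (\<integral>\<^sup>+x\<in>ball 0 2. ennreal (norm (r *\<^sub>R G (r *\<^sub>R x)) powr p + \<bar>v (r *\<^sub>R x)\<bar> powr p) \<partial>lborel))"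
      by (intro mult_left_mono le[OF C1_grad_scale[OF v]]) auto
    also have "(\<integral>\<^sup>+x\<in>ball 0 2. ennreal (norm (r *\<^sub>R G (r *\<^sub>R x)) powr p + \<bar>v (r *\<^sub>R x)\<bar> powr p) \<partial>lborel)
        = (\<integral>\<^sup>+x\<in>ball 0 2. ?U (r *\<^sub>R x) \<partial>lborel)"
      using r by (simp add: powr_mult)
    also have "\<dots> = ennreal (r powr (- N)) * (ennreal (r powr N) * (\<integral>\<^sup>+x\<in>ball 0 2. ?U (r *\<^sub>R x) \<partial>lborel))"
      using r by (simp add: mult.assoc[symmetric] ennreal_mult[symmetric] powr_add[symmetric])
    also have "ennreal (r powr N) * (\<integral>\<^sup>+x\<in>ball 0 2. ?U (r *\<^sub>R x) \<partial>lborel) = (\<integral>\<^sup>+x\<in>ball 0 (2 * r). ?U x \<partial>lborel)"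
      using nn_integral_ball_scale[of ?U r 2] r by (simp add: rN)
    also have "ennreal (r powr (N / q)) * (ennreal C * (ennreal (r powr (- N)) * y))
        = ennreal (C * r powr (N / q - N)) * y" for y
      using C by (simp add: ennreal_mult mult_ac diff_conv_add_uminus powr_add del: add_uminus_conv_diff)
    finally show "epowr (\<integral>\<^sup>+x\<in>ball 0 r. ennreal (\<bar>v x\<bar> powr (p * q)) \<partial>lborel) (1 / q)
        \<le> ennreal (C * r powr (DIM('a) / q - DIM('a))) * (\<integral>\<^sup>+x\<in>ball 0 (2 * r). ?U x \<partial>lborel)"
      by (simp add: N_def)
  qed
qed

text \<open>The gradient argument is 0 because only difference quotients are estimated. The majorant
  \<open>m\<close> supplies the measurability in \<open>x\<close> that Fatou's lemma requires;
  \<open>\<epsilon> \<le> 1\<close> fits the bounded radii of the maximal function; the type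
  argument records the dimension on which \<open>C\<close> depends.\<close>

definition taylor_mean_dominated :: "'a::euclidean_space itself \<Rightarrow> real \<Rightarrow> ereal \<Rightarrow> bool" where
  "taylor_mean_dominated _ p q \<longleftrightarrow> (\<exists>C\<ge>0. \<forall>\<epsilon> (v :: 'a \<Rightarrow> real) G. 0 < \<epsilon> \<longrightarrow> \<epsilon> \<le> 1 \<longrightarrow> C1_grad v G \<longrightarrow>
     (\<exists>m\<in>borel_measurable borel. (\<forall>x. taylor_mean p q v (\<lambda>_. 0) \<epsilon> x \<le> m x) \<and>
       (\<integral>\<^sup>+x. m x \<partial>lborel) \<le> ennreal C * (\<integral>\<^sup>+x. ennreal (norm (G x) powr p) \<partial>lborel)))"

text \<open>Full balls instead of annuli suffice for an upper bound: the smallest dyadic ball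
  containing \<open>h\<close> has radius at most \<open>2 * norm h\<close>, so its term alone
  dominates the left side.\<close>

lemma shell_decomposition:
  fixes h :: "'a::euclidean_space" and \<epsilon> s a :: real
  assumes "0 < \<epsilon>" "0 < s" "h = 0 \<Longrightarrow> a = 0"
  shows "ennreal (\<bar>a\<bar> powr s / norm h powr s) * indicator (ball 0 \<epsilon>) h
    \<le> (\<Sum>k. ennreal ((2 / (\<epsilon> / 2 ^ k)) powr s) * (ennreal (\<bar>a\<bar> powr s) * indicator (ball 0 (\<epsilon> / 2 ^ k)) h))"
    (is "?l \<le> (\<Sum>k. ?r k)")
proof (cases "h \<noteq> 0 \<and> norm h < \<epsilon>")
  case True
  then have h: "0 < norm h" "norm h < \<epsilon>" by auto
  obtain n where n: "\<epsilon> / 2 ^ n \<le> norm h"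
  proof -
    obtain n where "\<epsilon> / norm h < 2 ^ n" using real_arch_pow[of 2 "\<epsilon> / norm h"] by auto
    then show ?thesis using h that[of n] by (simp add: field_simps)
  qed
  \<comment> \<open>The first radius not exceeding \<open>norm h\<close>. It is not the zeroth, as
    \<open>norm h < \<epsilon>\<close>, so its predecessor \<open>k\<close> gives the ball
    sought.\<close>
  define m where "m = (LEAST n. \<epsilon> / 2 ^ n \<le> norm h)"
  have m: "\<epsilon> / 2 ^ m \<le> norm h" unfolding m_def using n by (rule LeastI)
  with h have "m \<noteq> 0" by (intro notI) simp
  then obtain k where k: "m = Suc k" by (cases m) auto
  have "norm h < \<epsilon> / 2 ^ k"
    using not_less_Least[of k "\<lambda>n. \<epsilon> / 2 ^ n \<le> norm h"] k unfolding m_def[symmetric] by simp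
  moreover have "\<epsilon> / 2 ^ k / 2 \<le> norm h" using m k by (simp add: field_simps)
  ultimately have k: "norm h < \<epsilon> / 2 ^ k" "1 / norm h \<le> 2 / (\<epsilon> / 2 ^ k)"
    using h assms(1) by (auto simp: field_simps)
  have "\<bar>a\<bar> powr s / norm h powr s = (1 / norm h) powr s * \<bar>a\<bar> powr s"
    by (simp add: powr_divide)
  also have "\<dots> \<le> (2 / (\<epsilon> / 2 ^ k)) powr s * \<bar>a\<bar> powr s"
    using assms k h by (intro mult_right_mono powr_mono2) auto
  finally have "?l \<le> ?r k"
    using h k by (simp add: ennreal_mult[symmetric] ennreal_leI)
  also have "\<dots> = (\<Sum>i\<in>{k}. ?r i)" by simp
  also have "\<dots> \<le> (\<Sum>k. ?r k)" by (rule sum_le_suminf) auto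
  finally show ?thesis .
next
  case False
  then have "?l = 0" using assms by (auto split: split_indicator)
  then show ?thesis by (simp only: zero_le)
qed

text \<open>Tonelli's theorem puts the integration over \<open>x\<close> inside. The translation
  estimate with \<open>norm h < 2 * r\<close> then gives the zero-order term the same order
  \<open>r powr p\<close> as the gradient term.\<close>

lemma nn_integral_ball_translates:
  fixes v :: "'a::euclidean_space \<Rightarrow> real"
  assumes v: "C1_grad v G" and p: "1 \<le> p" and r: "0 < r"
  shows "(\<integral>\<^sup>+x. (\<integral>\<^sup>+h\<in>ball 0 (2 * r). ennreal (r powr p * norm (G (x + h)) powr p + \<bar>v (x + h) - v x\<bar> powr p) \<partial>lborel) \<partial>lborel)
    \<le> ennreal (measure lborel (ball (0::'a) 1) * (2 * r) ^ DIM('a) * ((1 + 2 powr p) * r powr p))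
       * (\<integral>\<^sup>+x. ennreal (norm (G x) powr p) \<partial>lborel)"
proof -
  note [measurable] = C1_gradD(4,5)[OF v]
  define \<Gamma> where "\<Gamma> = (\<integral>\<^sup>+x. ennreal (norm (G x) powr p) \<partial>lborel)"
  have "(\<integral>\<^sup>+x. (\<integral>\<^sup>+h\<in>ball 0 (2 * r). ennreal (r powr p * norm (G (x + h)) powr p + \<bar>v (x + h) - v x\<bar> powr p) \<partial>lborel) \<partial>lborel)
     = (\<integral>\<^sup>+h. (\<integral>\<^sup>+x. ennreal (r powr p * norm (G (x + h)) powr p + \<bar>v (x + h) - v x\<bar> powr p) * indicator (ball 0 (2 * r)) h \<partial>lborel) \<partial>lborel)"
    by (rule lborel_pair.Fubini') measurable
  also have "\<dots> = (\<integral>\<^sup>+h. (\<integral>\<^sup>+x. ennreal (r powr p * norm (G (x + h)) powr p + \<bar>v (x + h) - v x\<bar> powr p) \<partial>lborel) * indicator (ball 0 (2 * r)) h \<partial>lborel)"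
    by (intro nn_integral_cong nn_integral_multc) measurable
  also have "\<dots> \<le> (\<integral>\<^sup>+h. ennreal ((1 + 2 powr p) * r powr p) * \<Gamma> * indicator (ball (0::'a) (2 * r)) h \<partial>lborel)"
  proof (rule nn_integral_mono)
    fix h :: 'a
    show "(\<integral>\<^sup>+x. ennreal (r powr p * norm (G (x + h)) powr p + \<bar>v (x + h) - v x\<bar> powr p) \<partial>lborel) * indicator (ball 0 (2 * r)) h
      \<le> ennreal ((1 + 2 powr p) * r powr p) * \<Gamma> * indicator (ball (0::'a) (2 * r)) h"
    proof (cases "norm h < 2 * r")
      case True
      have "(\<integral>\<^sup>+x. ennreal (r powr p * norm (G (x + h)) powr p + \<bar>v (x + h) - v x\<bar> powr p) \<partial>lborel)
        = (\<integral>\<^sup>+x. ennreal (r powr p) * ennreal (norm (G (x + h)) powr p) + ennreal (\<bar>v (x + h) - v x\<bar> powr p) \<partial>lborel)"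
        by (simp add: ennreal_mult)
      also have "\<dots> = ennreal (r powr p) * \<Gamma> + (\<integral>\<^sup>+x. ennreal (\<bar>v (x + h) - v x\<bar> powr p) \<partial>lborel)"
        unfolding \<Gamma>_def nn_integral_lborel_translate[of "\<lambda>x. ennreal (norm (G x) powr p)" h, symmetric, simplified]
        by (subst nn_integral_add) (simp_all add: nn_integral_cmult
             nn_integral_lborel_translate[of "\<lambda>x. ennreal (norm (G x) powr p)" h])
      also have "\<dots> \<le> ennreal (r powr p) * \<Gamma> + ennreal (norm h powr p) * \<Gamma>"
        unfolding \<Gamma>_def by (intro add_left_mono C1_grad_translation_Lp v p)
      also have "\<dots> \<le> ennreal (r powr p) * \<Gamma> + ennreal ((2 * r) powr p) * \<Gamma>"
        using True p by (intro add_left_mono mult_right_mono ennreal_leI powr_mono2) auto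
      also have "\<dots> = ennreal ((1 + 2 powr p) * r powr p) * \<Gamma>"
        using r by (simp add: powr_mult distrib_left distrib_right mult_ac)
      finally show ?thesis using True by simp
    qed simp
  qed
  also have "\<dots> = ennreal ((1 + 2 powr p) * r powr p) * \<Gamma> * emeasure lborel (ball (0::'a) (2 * r))"
    by (rule nn_integral_cmult_indicator) simp
  also have "emeasure lborel (ball (0::'a) (2 * r)) = ennreal ((2 * r) ^ DIM('a)) * ennreal (measure lborel (ball (0::'a) 1))"
    using emeasure_lborel_ball_scale[of 1 "2 * r" "0::'a" "0::'a"] r
    by (simp add: emeasure_eq_ennreal_measure emeasure_lborel_ball_pos)
  finally show ?thesis
    using r by (simp add: \<Gamma>_def ennreal_mult mult_ac)
qed

lemma taylor_mean_lborel:
  fixes v :: "'a::euclidean_space \<Rightarrow> real"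
  assumes "q \<noteq> \<infinity>"
  shows "taylor_mean p q v g \<epsilon> x = epowr ((\<integral>\<^sup>+h\<in>ball 0 \<epsilon>. ennreal (\<bar>v (x + h) - v x - g x \<bullet> h\<bar> powr (p * real_of_ereal q)
       / norm h powr (p * real_of_ereal q)) \<partial>lborel) / emeasure lborel (ball (0::'a) \<epsilon>)) (1 / real_of_ereal q)"
  using assms by (simp add: taylor_mean_def nn_integral_completion)

lemma taylor_mean_dominated_finite:
  assumes p: "1 \<le> p" and q: "1 \<le> q"
    and pq: "p < real DIM('a) \<and> q = real DIM('a) / (real DIM('a) - p) \<or> p = real DIM('a)"
  shows "taylor_mean_dominated TYPE('a::euclidean_space) p (ereal q)"
proof -
  define N where "N = real DIM('a)"
  have N: "0 < N" by (simp add: N_def)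
  define \<beta> where "\<beta> = measure lborel (ball (0::'a) 1)"
  have \<beta>: "0 < \<beta>" "emeasure lborel (ball (0::'a) 1) = ennreal \<beta>"
    unfolding \<beta>_def using emeasure_lborel_ball_pos[of 1 "0::'a"]
    by (auto simp: emeasure_eq_ennreal_measure zero_less_measure_iff)
  obtain C where C: "C \<ge> 0" and sob: "\<And>(v :: 'a::euclidean_space \<Rightarrow> real) G r. C1_grad v G \<Longrightarrow> 0 < r \<Longrightarrow>
    epowr (\<integral>\<^sup>+x\<in>ball 0 r. ennreal (\<bar>v x\<bar> powr (p * q)) \<partial>lborel) (1 / q)
    \<le> ennreal (C * r powr (DIM('a) / q - DIM('a)))
       * (\<integral>\<^sup>+x\<in>ball 0 (2 * r). ennreal (r powr p * norm (G x) powr p + \<bar>v x\<bar> powr p) \<partial>lborel)"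
    using local_Sobolev_scaled[OF assms] by blast
  \<comment> \<open>Ratio of the geometric series, below 1 because \<open>q\<close> is
    finite.\<close>
  define \<rho> where "\<rho> = 2 powr (- N / q)"
  have \<rho>: "0 < \<rho>" "\<rho> < 1" using N q by (auto simp: \<rho>_def powr_less_one)
  define K where "K = C * \<beta> powr (1 - 1 / q) * 2 powr p * 2 powr N * (1 + 2 powr p)"
  show ?thesis unfolding taylor_mean_dominated_def
  proof (intro exI[of _ "K / (1 - \<rho>)"] conjI allI impI)
    show "0 \<le> K / (1 - \<rho>)" using C \<rho> by (simp add: K_def)
    fix \<epsilon> :: real and v :: "'a \<Rightarrow> real" and G
    assume \<epsilon>: "0 < \<epsilon>" and v: "C1_grad v G"
    note [measurable] = C1_gradD(4,5)[OF v]
    define r where "r = (\<lambda>k::nat. \<epsilon> / 2 ^ k)"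
    have r: "0 < r k" for k using \<epsilon> by (simp add: r_def)
    define E where "E = emeasure lborel (ball (0::'a) \<epsilon>)"
    have E: "E = ennreal (\<beta> * \<epsilon> powr N)"
      using emeasure_lborel_ball_scale[of 1 \<epsilon> "0::'a" "0::'a"] \<epsilon>
      by (simp add: E_def \<beta> ennreal_mult[symmetric] N_def powr_realpow less_imp_le mult.commute)
    define J where "J = (\<lambda>k x. \<integral>\<^sup>+h\<in>ball 0 (2 * r k). ennreal (r k powr p * norm (G (x + h)) powr p + \<bar>v (x + h) - v x\<bar> powr p) \<partial>lborel)"
    have [measurable]: "J k \<in> borel_measurable borel" for k
      unfolding J_def by measurable
    define a where "a = (\<lambda>k. (2 / r k) powr p * (\<beta> * \<epsilon> powr N) powr (- 1 / q) * (C * r k powr (N / q - N)))"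
    have a: "0 \<le> a k" for k using C by (simp add: a_def)
    show "\<exists>m\<in>borel_measurable borel. (\<forall>x. taylor_mean p (ereal q) v (\<lambda>_. 0) \<epsilon> x \<le> m x) \<and>
       (\<integral>\<^sup>+x. m x \<partial>lborel) \<le> ennreal (K / (1 - \<rho>)) * (\<integral>\<^sup>+x. ennreal (norm (G x) powr p) \<partial>lborel)"
    proof (intro bexI[of _ "\<lambda>x. \<Sum>k. ennreal (a k) * J k x"] conjI allI)
      fix x
      let ?u = "\<lambda>h. v (x + h) - v x"
      have "(\<integral>\<^sup>+h\<in>ball 0 \<epsilon>. ennreal (\<bar>?u h\<bar> powr (p * q) / norm h powr (p * q)) \<partial>lborel)
        \<le> (\<integral>\<^sup>+h. (\<Sum>k. ennreal ((2 / r k) powr (p * q)) * (ennreal (\<bar>?u h\<bar> powr (p * q)) * indicator (ball 0 (r k)) h)) \<partial>lborel)"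
        unfolding r_def using \<epsilon> p q by (intro nn_integral_mono shell_decomposition) auto
      also have "\<dots> = (\<Sum>k. ennreal ((2 / r k) powr (p * q)) * (\<integral>\<^sup>+h\<in>ball 0 (r k). ennreal (\<bar>?u h\<bar> powr (p * q)) \<partial>lborel))"
        by (subst nn_integral_suminf) (auto simp: nn_integral_cmult)
      finally have 1: "(\<integral>\<^sup>+h\<in>ball 0 \<epsilon>. ennreal (\<bar>?u h\<bar> powr (p * q) / norm h powr (p * q)) \<partial>lborel) / E
         \<le> (\<Sum>k. ennreal ((2 / r k) powr (p * q)) * (\<integral>\<^sup>+h\<in>ball 0 (r k). ennreal (\<bar>?u h\<bar> powr (p * q)) \<partial>lborel)) * inverse E"
        by (simp add: divide_ennreal_def mult_right_mono)
      have "taylor_mean p (ereal q) v (\<lambda>_. 0) \<epsilon> x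
         = epowr ((\<integral>\<^sup>+h\<in>ball 0 \<epsilon>. ennreal (\<bar>?u h\<bar> powr (p * q) / norm h powr (p * q)) \<partial>lborel) / E) (1 / q)"
        by (simp add: taylor_mean_lborel E_def)
      also have "\<dots> \<le> epowr (\<Sum>k. ennreal ((2 / r k) powr (p * q)) * (\<integral>\<^sup>+h\<in>ball 0 (r k). ennreal (\<bar>?u h\<bar> powr (p * q)) \<partial>lborel) * inverse E) (1 / q)"
        using q 1 by (intro epowr_mono) auto
      \<comment> \<open>The exponent \<open>1 / q\<close> is at most 1, so the root of the sum is at
        most the sum of the roots.\<close>
      also have "\<dots> \<le> (\<Sum>k. epowr (ennreal ((2 / r k) powr (p * q)) * (\<integral>\<^sup>+h\<in>ball 0 (r k). ennreal (\<bar>?u h\<bar> powr (p * q)) \<partial>lborel) * inverse E) (1 / q))"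
        using q by (intro epowr_suminf_le) auto
      also have "\<dots> \<le> (\<Sum>k. ennreal (a k) * J k x)"
      proof (intro suminf_le summableI)
        fix k
        have iE: "epowr (inverse E) (1 / q) = ennreal ((\<beta> * \<epsilon> powr N) powr (- 1 / q))"
        proof -
          have "inverse E = ennreal ((\<beta> * \<epsilon> powr N) powr (- 1))"
            using \<beta> \<epsilon> by (simp add: E inverse_ennreal powr_minus)
          then have "epowr (inverse E) (1 / q) = ennreal ((\<beta> * \<epsilon> powr N) powr ((- 1) * (1 / q)))"
            by (simp only: epowr_ennreal[OF powr_ge_zero] powr_powr)
          then show ?thesis by simp
        qed
        have "epowr (ennreal ((2 / r k) powr (p * q)) * (\<integral>\<^sup>+h\<in>ball 0 (r k). ennreal (\<bar>?u h\<bar> powr (p * q)) \<partial>lborel) * inverse E) (1 / q)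
          = ennreal ((2 / r k) powr p) * epowr (\<integral>\<^sup>+h\<in>ball 0 (r k). ennreal (\<bar>?u h\<bar> powr (p * q)) \<partial>lborel) (1 / q) * ennreal ((\<beta> * \<epsilon> powr N) powr (- 1 / q))"
          using q r[of k] by (simp add: epowr_mult iE epowr_ennreal powr_powr)
        \<comment> \<open>For fixed \<open>x\<close> the local estimate is applied in the variable
          \<open>h\<close> to \<open>v (x + h) - v x\<close>, whose gradient is
          \<open>G (x + h)\<close>.\<close>
        also have "\<dots> \<le> ennreal ((2 / r k) powr p) * (ennreal (C * r k powr (N / q - N)) * J k x) * ennreal ((\<beta> * \<epsilon> powr N) powr (- 1 / q))"
          unfolding J_def N_def by (intro mult_right_mono mult_left_mono sob[OF C1_grad_translate[OF v] r]) auto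
        also have "\<dots> = ennreal (a k) * J k x"
          unfolding a_def using C by (simp add: ennreal_mult mult_ac)
        finally show "epowr (ennreal ((2 / r k) powr (p * q)) * (\<integral>\<^sup>+h\<in>ball 0 (r k). ennreal (\<bar>?u h\<bar> powr (p * q)) \<partial>lborel) * inverse E) (1 / q)
          \<le> ennreal (a k) * J k x" .
      qed
      finally show "taylor_mean p (ereal q) v (\<lambda>_. 0) \<epsilon> x \<le> (\<Sum>k. ennreal (a k) * J k x)" .
    next
      define \<Gamma> where "\<Gamma> = (\<integral>\<^sup>+x. ennreal (norm (G x) powr p) \<partial>lborel)"
      have "(\<integral>\<^sup>+x. (\<Sum>k. ennreal (a k) * J k x) \<partial>lborel) = (\<Sum>k. ennreal (a k) * (\<integral>\<^sup>+x. J k x \<partial>lborel))"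
        by (subst nn_integral_suminf) (auto simp: nn_integral_cmult)
      also have "\<dots> \<le> (\<Sum>k. ennreal (K * \<rho> ^ k) * \<Gamma>)"
      proof (intro suminf_le summableI)
        fix k
        have pow: "r k = \<epsilon> * 2 powr (- real k)"
          by (simp add: r_def powr_minus powr_realpow divide_inverse)
        \<comment> \<open>Scale invariance: the powers of \<open>r k\<close> combine to
          \<open>r k powr (N / q)\<close>, which against \<open>\<epsilon> powr (- N / q)\<close>
          from the normalisation leaves \<open>\<rho> ^ k\<close>. The bound is therefore uniform in
          \<open>\<epsilon>\<close>.\<close>
        have eq: "a k * (\<beta> * (2 * r k) ^ DIM('a) * ((1 + 2 powr p) * r k powr p)) = K * \<rho> ^ k"
        proof -
          have e1: "(2 / r k) powr p * r k powr p = 2 powr p"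
            using r[of k] by (simp add: powr_mult[symmetric])
          have e2: "(2 * r k) ^ DIM('a) = 2 powr N * r k powr N"
            using r[of k] by (simp add: powr_realpow[symmetric] N_def powr_mult)
          have e3: "r k powr (N / q - N) * r k powr N = r k powr (N / q)"
            by (simp add: powr_add[symmetric])
          have e4: "(\<beta> * \<epsilon> powr N) powr (- 1 / q) * \<beta> = \<beta> powr (1 - 1 / q) * \<epsilon> powr (- N / q)"
          proof -
            have "\<beta> powr (1 - 1 / q) = \<beta> powr (- 1 / q) * \<beta>"
              using powr_add[of \<beta> "- 1 / q" 1] \<beta>(1) by simp
            then show ?thesis using \<beta>(1) \<epsilon> by (simp add: powr_mult powr_powr)
          qed
          have e5: "r k powr (N / q) * \<epsilon> powr (- N / q) = \<rho> ^ k"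
          proof -
            have "r k powr (N / q) * \<epsilon> powr (- N / q) = 2 powr (- real k * (N / q)) * (\<epsilon> powr (N / q) * \<epsilon> powr (- N / q))"
              unfolding pow using \<epsilon> by (simp add: powr_mult powr_powr)
            also have "\<epsilon> powr (N / q) * \<epsilon> powr (- N / q) = 1"
              using \<epsilon> by (simp add: powr_add[symmetric])
            also have "2 powr (- real k * (N / q)) = \<rho> ^ k"
              by (simp add: \<rho>_def powr_realpow[symmetric] powr_powr mult.commute)
            finally show ?thesis by simp
          qed
          have "a k * (\<beta> * (2 * r k) ^ DIM('a) * ((1 + 2 powr p) * r k powr p))
            = C * ((2 / r k) powr p * r k powr p) * ((\<beta> * \<epsilon> powr N) powr (- 1 / q) * \<beta>) * 2 powr N * (r k powr (N / q - N) * r k powr N) * (1 + 2 powr p)"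
            unfolding a_def e2 by (simp only: mult_ac)
          also have "\<dots> = C * \<beta> powr (1 - 1 / q) * 2 powr p * 2 powr N * (1 + 2 powr p) * (r k powr (N / q) * \<epsilon> powr (- N / q))"
            unfolding e1 e3 e4 by (simp only: mult_ac)
          finally show ?thesis by (simp only: e5 K_def)
        qed
        have "ennreal (a k) * (\<integral>\<^sup>+x. J k x \<partial>lborel)
          \<le> ennreal (a k) * (ennreal (\<beta> * (2 * r k) ^ DIM('a) * ((1 + 2 powr p) * r k powr p)) * \<Gamma>)"
          unfolding J_def \<beta>_def \<Gamma>_def by (intro mult_left_mono nn_integral_ball_translates v p r) auto
        also have "\<dots> = ennreal (a k * (\<beta> * (2 * r k) ^ DIM('a) * ((1 + 2 powr p) * r k powr p))) * \<Gamma>"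
          using a[of k] \<beta> r[of k] by (subst ennreal_mult) (auto simp: mult_ac intro!: mult_nonneg_nonneg)
        finally show "ennreal (a k) * (\<integral>\<^sup>+x. J k x \<partial>lborel) \<le> ennreal (K * \<rho> ^ k) * \<Gamma>"
          by (simp only: eq)
      qed
      also have "\<dots> = (\<Sum>k. ennreal (K * \<rho> ^ k)) * \<Gamma>"
        by (rule ennreal_suminf_multc)
      also have "(\<Sum>k. ennreal (K * \<rho> ^ k)) = ennreal (K / (1 - \<rho>))"
      proof (rule suminf_ennreal_eq)
        show "(\<lambda>k. K * \<rho> ^ k) sums (K / (1 - \<rho>))"
          using sums_mult[OF geometric_sums[of \<rho>], of K] \<rho> by simp
        show "0 \<le> K * \<rho> ^ k" for k using C \<rho> by (simp add: K_def)
      qed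
      finally show "(\<integral>\<^sup>+x. (\<Sum>k. ennreal (a k) * J k x) \<partial>lborel) \<le> ennreal (K / (1 - \<rho>)) * (\<integral>\<^sup>+x. ennreal (norm (G x) powr p) \<partial>lborel)"
        by (simp add: \<Gamma>_def)
    qed measurable
  qed
qed

section \<open>The maximal function\<close>

definition ball_mean :: "('a::euclidean_space \<Rightarrow> ennreal) \<Rightarrow> 'a \<Rightarrow> real \<Rightarrow> ennreal" where
  "ball_mean u x r = (\<integral>\<^sup>+y\<in>ball x r. u y \<partial>lborel) / emeasure lborel (ball x r)"

text \<open>Rational radii make measurability immediate; bounded radii allow Vitali's covering lemma
  without integrability.\<close>

definition maximal_function :: "('a::euclidean_space \<Rightarrow> ennreal) \<Rightarrow> 'a \<Rightarrow> ennreal" where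
  "maximal_function u x = (SUP r\<in>{r\<in>\<rat>. 0 < r \<and> r < 2}. ball_mean u x r)"

lemma borel_measurable_ball_mean [measurable]:
  fixes u :: "'a::euclidean_space \<Rightarrow> ennreal"
  assumes [measurable]: "u \<in> borel_measurable borel"
  shows "(\<lambda>x. ball_mean u x r) \<in> borel_measurable borel"
proof (cases "0 < r")
  case True
  \<comment> \<open>Written with \<open>dist x y < r\<close> the integrand is jointly measurable,
    and the volume does not depend on the centre.\<close>
  have "(\<lambda>x. ball_mean u x r) = (\<lambda>x. (\<integral>\<^sup>+y. u y * (if dist x y < r then 1 else 0) \<partial>lborel) / emeasure lborel (ball (0::'a) r))"
    using True by (auto simp: fun_eq_iff ball_mean_def emeasure_ball
        intro!: arg_cong2[where f="(/)"] nn_integral_cong split: split_indicator)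
  then show ?thesis by simp
next
  case False
  then show ?thesis by (simp add: ball_mean_def ball_empty)
qed

lemma borel_measurable_maximal_function [measurable]:
  assumes [measurable]: "u \<in> borel_measurable borel"
  shows "maximal_function u \<in> borel_measurable borel"
proof -
  have "countable {r\<in>\<rat>. 0 < r \<and> r < (2::real)}"
    by (rule countable_subset[OF _ countable_rat]) auto
  then have "(\<lambda>x. SUP r\<in>{r\<in>\<rat>. 0 < r \<and> r < (2::real)}. ball_mean u x r) \<in> borel_measurable borel"
    by (rule borel_measurable_SUP) measurable
  then show ?thesis by (simp add: maximal_function_def[abs_def])
qed

text \<open>Every point of the level set is the centre of a ball of radius below 2 on which the mean
  of \<open>u\<close> exceeds \<open>l\<close>. Vitali's lemma selects disjoint ones whose fivefold
  dilations still cover the set, hence the power of 5.\<close>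

lemma maximal_function_weak_type:
  fixes u :: "'a::euclidean_space \<Rightarrow> ennreal"
  assumes [measurable]: "u \<in> borel_measurable borel" and l: "0 < l"
  shows "emeasure lborel {x. ennreal l < maximal_function u x} \<le> ennreal (5 ^ DIM('a) / l) * (\<integral>\<^sup>+x. u x \<partial>lborel)"
proof -
  define E where "E = {x. ennreal l < maximal_function u x}"
  define K where "K = {(x, r). 0 < r \<and> r < 2 \<and> ennreal l < ball_mean u x r}"
  have E_sub: "E \<subseteq> (\<Union>i\<in>K. ball (fst i) (snd i))"
    by (force simp: E_def K_def maximal_function_def less_SUP_iff)
  obtain C where C: "countable C" "C \<subseteq> K"
     "pairwise (\<lambda>i j. disjnt (ball (fst i) (snd i)) (ball (fst j) (snd j))) C"
     "E \<subseteq> (\<Union>i\<in>C. ball (fst i) (5 * snd i))"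
    using Vitali_covering_lemma_balls[OF E_sub, of 2] by (force simp: K_def)
  have r: "0 < snd i" if "i \<in> C" for i using C that by (auto simp: K_def)
  have [measurable]: "E \<in> sets borel" unfolding E_def by measurable
  have disj: "disjoint_family_on (\<lambda>i. ball (fst i) (snd i)) C"
    using C(3) by (auto simp: disjoint_family_on_def pairwise_def disjnt_def)
  have "emeasure lborel E = (\<integral>\<^sup>+x. indicator E x \<partial>lborel)" by simp
  also have "\<dots> \<le> (\<integral>\<^sup>+x. (\<integral>\<^sup>+i. indicator (ball (fst i) (5 * snd i)) x \<partial>count_space C) \<partial>lborel)"
  proof (rule nn_integral_mono)
    fix x
    show "indicator E x \<le> (\<integral>\<^sup>+i. (indicator (ball (fst i) (5 * snd i)) x :: ennreal) \<partial>count_space C)"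
    proof (cases "x \<in> E")
      case True
      then obtain i where i: "i \<in> C" "x \<in> ball (fst i) (5 * snd i)" using C(4) by auto
      have "(indicator (ball (fst i) (5 * snd i)) x :: ennreal)
          \<le> (\<integral>\<^sup>+i. indicator (ball (fst i) (5 * snd i)) x \<partial>count_space C)"
        using i(1) by (rule nn_integral_ge_point)
      then show ?thesis using True i by simp
    qed simp
  qed
  also have "\<dots> = (\<integral>\<^sup>+i. (\<integral>\<^sup>+x. indicator (ball (fst i) (5 * snd i)) x \<partial>lborel) \<partial>count_space C)"
    using C(1) by (rule nn_integral_count_space_nn_integral) simp
  also have "\<dots> \<le> (\<integral>\<^sup>+i. ennreal (5 ^ DIM('a) / l) * (\<integral>\<^sup>+x\<in>ball (fst i) (snd i). u x \<partial>lborel) \<partial>count_space C)"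
  proof (rule nn_integral_mono)
    fix i assume "i \<in> space (count_space C)"
    then have i: "i \<in> C" by simp
    define V where "V = emeasure lborel (ball (fst i) (snd i))"
    have V: "V \<noteq> 0" "V \<noteq> top" using emeasure_lborel_ball_pos[OF r[OF i]] by (auto simp: V_def)
    define I where "I = (\<integral>\<^sup>+x\<in>ball (fst i) (snd i). u x \<partial>lborel)"
    have "ennreal l \<le> I / V" using C(2) i by (auto simp: K_def ball_mean_def V_def I_def)
    then have "ennreal l * V \<le> I / V * V" by (intro mult_right_mono) auto
    also have "\<dots> = I"
      using V ennreal_divide_self[of V] by (simp add: ennreal_divide_times less_top)
    finally have "ennreal (1 / l) * (ennreal l * V) \<le> ennreal (1 / l) * I" by (intro mult_left_mono) auto
    then have "V \<le> ennreal (1 / l) * I"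
      using l by (simp add: mult.assoc[symmetric] ennreal_mult[symmetric])
    then have "ennreal (5 ^ DIM('a)) * V \<le> ennreal (5 ^ DIM('a)) * (ennreal (1 / l) * I)" by (intro mult_left_mono) auto
    then show "(\<integral>\<^sup>+x. indicator (ball (fst i) (5 * snd i)) x \<partial>lborel) \<le> ennreal (5 ^ DIM('a) / l) * I"
      using l emeasure_lborel_ball_scale[of "snd i" 5 "fst i" "fst i"] r[OF i]
      by (simp add: V_def mult.assoc[symmetric] ennreal_mult[symmetric])
  qed
  also have "\<dots> = ennreal (5 ^ DIM('a) / l) * (\<integral>\<^sup>+i. (\<integral>\<^sup>+x\<in>ball (fst i) (snd i). u x \<partial>lborel) \<partial>count_space C)"
    by (rule nn_integral_cmult) simp
  also have "(\<integral>\<^sup>+i. (\<integral>\<^sup>+x\<in>ball (fst i) (snd i). u x \<partial>lborel) \<partial>count_space C)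
      = (\<integral>\<^sup>+i. emeasure (density lborel u) (ball (fst i) (snd i)) \<partial>count_space C)"
    by (simp add: emeasure_density)
  \<comment> \<open>Disjointness of the selected balls is used here, through countable additivity of
    the measure with density \<open>u\<close>.\<close>
  also have "\<dots> = emeasure (density lborel u) (\<Union>i\<in>C. ball (fst i) (snd i))"
    using C(1) disj by (intro emeasure_UN_countable[symmetric]) auto
  also have "\<dots> \<le> emeasure (density lborel u) UNIV"
    by (intro emeasure_mono) auto
  also have "\<dots> = (\<integral>\<^sup>+x. u x \<partial>lborel)" by (simp add: emeasure_density)
  finally show ?thesis unfolding E_def by (simp add: mult_left_mono)
qed

text \<open>The layer-cake formula for a single value \<open>y\<close>, infinite values included:
  \<open>l\<close> runs over the levels below \<open>y\<close>.\<close>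

lemma nn_integral_powr_below:
  fixes t :: real and y :: ennreal
  assumes t: "0 < t"
  shows "(\<integral>\<^sup>+l. ennreal (l powr (t - 1)) * (if 0 < l \<and> ennreal l < y then 1 else 0) \<partial>lborel) = epowr y t * ennreal (1 / t)"
proof -
  have fin: "(\<integral>\<^sup>+l. ennreal (l powr (t - 1)) * (if 0 < l \<and> ennreal l < ennreal c then 1 else 0) \<partial>lborel) = ennreal (c powr t / t)"
    if c: "0 \<le> c" for c
  proof -
    have "AE l in lborel. l \<noteq> 0 \<and> l \<noteq> c"
      using AE_lborel_singleton[of "0::real"] AE_lborel_singleton[of c] by eventually_elim auto
    then have "(\<integral>\<^sup>+l. ennreal (l powr (t - 1)) * (if 0 < l \<and> ennreal l < ennreal c then 1 else 0) \<partial>lborel)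
        = (\<integral>\<^sup>+l. ennreal (l powr (t - 1)) * indicator {0..c} l \<partial>lborel)"
      by (intro nn_integral_cong_AE, elim eventually_mono) (auto split: split_indicator simp: ennreal_less_iff)
    also have "\<dots> = ennreal (c powr t / t)"
      using has_integral_powr_from_0[of "t - 1" c] t c
      by (intro nn_integral_has_integral_lebesgue') auto
    finally show ?thesis .
  qed
  show ?thesis
  proof (cases y)
    case (real c)
    then show ?thesis using fin[of c] t by (simp add: epowr_ennreal ennreal_mult[symmetric])
  next
    case top
    have le: "ennreal c \<le> (\<integral>\<^sup>+l. ennreal (l powr (t - 1)) * (if 0 < l \<and> ennreal l < y then 1 else 0) \<partial>lborel)" if "0 \<le> c" for c
    proof -
      \<comment> \<open>The level \<open>(c * t) powr (1 / t)\<close> is the one at which the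
        truncated integral equals \<open>c\<close>. As \<open>c\<close> is arbitrary, the integral
        for \<open>y = top\<close> exceeds every finite value.\<close>
      have "c = ((c * t) powr (1 / t)) powr t / t" using that t by (simp add: powr_powr)
      then have "ennreal c = (\<integral>\<^sup>+l. ennreal (l powr (t - 1)) * (if 0 < l \<and> ennreal l < ennreal ((c * t) powr (1 / t)) then 1 else 0) \<partial>lborel)"
        using fin[of "(c * t) powr (1 / t)"] by simp
      also have "\<dots> \<le> (\<integral>\<^sup>+l. ennreal (l powr (t - 1)) * (if 0 < l \<and> ennreal l < y then 1 else 0) \<partial>lborel)"
        using top by (intro nn_integral_mono mult_left_mono) auto
      finally show ?thesis .
    qed
    have "(\<integral>\<^sup>+l. ennreal (l powr (t - 1)) * (if 0 < l \<and> ennreal l < y then 1 else 0) \<partial>lborel) = top"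
    proof (rule ccontr)
      assume "(\<integral>\<^sup>+l. ennreal (l powr (t - 1)) * (if 0 < l \<and> ennreal l < y then 1 else 0) \<partial>lborel) \<noteq> top"
      then obtain c where c: "0 \<le> c"
        "(\<integral>\<^sup>+l. ennreal (l powr (t - 1)) * (if 0 < l \<and> ennreal l < y then 1 else 0) \<partial>lborel) = ennreal c"
        by (auto simp: less_top[symmetric] elim!: ennreal_cases)
      then show False
        using le[of "c + 1"] by simp
    qed
    then show ?thesis using top t by (simp add: ennreal_top_mult)
  qed
qed

text \<open>Marcinkiewicz interpolation between the weak type estimate and the trivial bound for
  bounded functions: at level \<open>l\<close> only the part of \<open>u\<close> above
  \<open>l / 2\<close> matters, and the levels are integrated by the layer-cake formula and
  Tonelli's theorem.\<close>

lemma maximal_function_strong_type: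
  assumes t: "1 < t"
  shows "\<exists>C\<ge>0. \<forall>u :: 'a::euclidean_space \<Rightarrow> ennreal. u \<in> borel_measurable borel \<longrightarrow>
    (\<integral>\<^sup>+x. epowr (maximal_function u x) t \<partial>lborel) \<le> ennreal C * (\<integral>\<^sup>+x. epowr (u x) t \<partial>lborel)"
proof -
  define A where "A = (2 * 5 ^ DIM('a) :: real)"
  define C where "C = t * A * 2 powr (t - 1) / (t - 1)"
  have A: "0 < A" by (simp add: A_def)
  have "(\<integral>\<^sup>+x. epowr (maximal_function u x) t \<partial>lborel) \<le> ennreal C * (\<integral>\<^sup>+x. epowr (u x) t \<partial>lborel)"
    if [measurable]: "u \<in> borel_measurable borel" for u :: "'a \<Rightarrow> ennreal"
  proof -
    define B where "B = (\<lambda>l x. if 0 < l \<and> ennreal l < maximal_function u x then 1 else 0 :: ennreal)"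
    define D where "D = (\<lambda>l x. if 0 < l \<and> ennreal l < 2 * u x then 1 else 0 :: ennreal)"
    have weak: "(\<integral>\<^sup>+x. B l x \<partial>lborel) \<le> ennreal (A / l) * (\<integral>\<^sup>+x. u x * D l x \<partial>lborel)" for l
    proof (cases "0 < l")
      case l: True
      \<comment> \<open>The part of \<open>u\<close> above \<open>l / 2\<close>. What is discarded
        adds at most \<open>l / 2\<close> to every ball mean, so the maximal function of
        \<open>w\<close> still exceeds \<open>l / 2\<close>.\<close>
      define w where "w = (\<lambda>x. u x * D l x)"
      have [measurable]: "w \<in> borel_measurable borel" unfolding w_def D_def by measurable
      have uw: "u x \<le> w x + ennreal (l / 2)" for x
      proof (cases "ennreal l < 2 * u x")
        case False
        then have "2 * u x \<le> 2 * ennreal (l / 2)" using l by (simp add: ennreal_mult[symmetric] ennreal_numeral[symmetric] not_less del: ennreal_numeral)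
        then have "u x \<le> ennreal (l / 2)" by (subst (asm) ennreal_mult_le_mult_iff) auto
        then show ?thesis by (simp add: add_increasing)
      qed (simp add: w_def D_def l)
      have sub: "ennreal (l / 2) < maximal_function w x" if "ennreal l < maximal_function u x" for x
      proof -
        obtain r where r: "r \<in> \<rat>" "0 < r" "r < 2" "ennreal l < ball_mean u x r"
          using \<open>ennreal l < maximal_function u x\<close> by (auto simp: maximal_function_def less_SUP_iff)
        define V where "V = emeasure lborel (ball x r)"
        have V: "V \<noteq> 0" "V \<noteq> top" using emeasure_lborel_ball_pos[OF r(2)] by (auto simp: V_def)
        have "(\<integral>\<^sup>+y\<in>ball x r. u y \<partial>lborel) \<le> (\<integral>\<^sup>+y. w y * indicator (ball x r) y + ennreal (l / 2) * indicator (ball x r) y \<partial>lborel)"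
          using uw by (intro nn_integral_mono) (auto split: split_indicator)
        also have "\<dots> = (\<integral>\<^sup>+y\<in>ball x r. w y \<partial>lborel) + ennreal (l / 2) * V"
          by (subst nn_integral_add) (auto simp: V_def nn_integral_cmult_indicator)
        finally have "ball_mean u x r \<le> ((\<integral>\<^sup>+y\<in>ball x r. w y \<partial>lborel) + ennreal (l / 2) * V) / V"
          unfolding ball_mean_def V_def by (rule divide_right_mono_ennreal)
        also have "\<dots> = ball_mean w x r + ennreal (l / 2)"
          using V by (simp add: add_divide_distrib_ennreal ball_mean_def V_def mult_divide_eq_ennreal)
        finally have "ennreal (l / 2) + ennreal (l / 2) < ball_mean w x r + ennreal (l / 2)"
          using r(4) l by (simp add: ennreal_plus[symmetric] del: ennreal_plus)
        then have "ennreal (l / 2) < ball_mean w x r"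
          by (meson add_right_mono not_le)
        then show ?thesis using r unfolding maximal_function_def by (auto simp: less_SUP_iff)
      qed
      have "(\<integral>\<^sup>+x. B l x \<partial>lborel) \<le> (\<integral>\<^sup>+x. indicator {x. ennreal (l / 2) < maximal_function w x} x \<partial>lborel)"
        using sub by (intro nn_integral_mono) (auto simp: B_def)
      also have "\<dots> = emeasure lborel {x. ennreal (l / 2) < maximal_function w x}"
        by (rule nn_integral_indicator) measurable
      also have "\<dots> \<le> ennreal (5 ^ DIM('a) / (l / 2)) * (\<integral>\<^sup>+x. w x \<partial>lborel)"
        using l by (intro maximal_function_weak_type) auto
      finally show ?thesis by (simp add: A_def w_def mult.commute)
    qed (simp add: B_def)
    have [measurable]: "(\<lambda>(x, l). B l x) \<in> borel_measurable (lborel \<Otimes>\<^sub>M lborel)"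
      "(\<lambda>(x, l). D l x) \<in> borel_measurable (lborel \<Otimes>\<^sub>M lborel)"
      unfolding B_def D_def by measurable
    have "(\<integral>\<^sup>+x. epowr (maximal_function u x) t \<partial>lborel)
      = (\<integral>\<^sup>+x. ennreal t * (\<integral>\<^sup>+l. ennreal (l powr (t - 1)) * B l x \<partial>lborel) \<partial>lborel)"
    proof (rule nn_integral_cong)
      fix x
      have "ennreal t * (e * ennreal (1 / t)) = e" for e
        using t by (simp add: mult.left_commute[of "ennreal t"] ennreal_mult[symmetric])
      then show "epowr (maximal_function u x) t = ennreal t * (\<integral>\<^sup>+l. ennreal (l powr (t - 1)) * B l x \<partial>lborel)"
        using t nn_integral_powr_below[of t] unfolding B_def by simp
    qed
    also have "\<dots> = ennreal t * (\<integral>\<^sup>+x. (\<integral>\<^sup>+l. ennreal (l powr (t - 1)) * B l x \<partial>lborel) \<partial>lborel)"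
      by (rule nn_integral_cmult) measurable
    also have "(\<integral>\<^sup>+x. (\<integral>\<^sup>+l. ennreal (l powr (t - 1)) * B l x \<partial>lborel) \<partial>lborel)
        = (\<integral>\<^sup>+l. (\<integral>\<^sup>+x. ennreal (l powr (t - 1)) * B l x \<partial>lborel) \<partial>lborel)"
      by (rule lborel_pair.Fubini'[symmetric]) measurable
    also have "\<dots> = (\<integral>\<^sup>+l. ennreal (l powr (t - 1)) * (\<integral>\<^sup>+x. B l x \<partial>lborel) \<partial>lborel)"
      by (intro nn_integral_cong nn_integral_cmult) measurable
    also have "\<dots> \<le> (\<integral>\<^sup>+l. ennreal A * (\<integral>\<^sup>+x. ennreal (l powr (t - 2)) * (u x * D l x) \<partial>lborel) \<partial>lborel)"
    proof (rule nn_integral_mono)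
      fix l
      show "ennreal (l powr (t - 1)) * (\<integral>\<^sup>+x. B l x \<partial>lborel) \<le> ennreal A * (\<integral>\<^sup>+x. ennreal (l powr (t - 2)) * (u x * D l x) \<partial>lborel)"
      proof (cases "0 < l")
        case True
        have "ennreal (l powr (t - 1)) * (\<integral>\<^sup>+x. B l x \<partial>lborel) \<le> ennreal (l powr (t - 1)) * (ennreal (A / l) * (\<integral>\<^sup>+x. u x * D l x \<partial>lborel))"
          by (intro mult_left_mono weak) auto
        also have "\<dots> = ennreal A * (ennreal (l powr (t - 2)) * (\<integral>\<^sup>+x. u x * D l x \<partial>lborel))"
        proof -
          have "l powr (t - 1) * (A / l) = A * l powr (t - 2)"
            using True powr_diff[of l "t - 1" 1] by simp
          then show ?thesis using True A by (simp add: mult.assoc[symmetric] ennreal_mult[symmetric])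
        qed
        also have "ennreal (l powr (t - 2)) * (\<integral>\<^sup>+x. u x * D l x \<partial>lborel) = (\<integral>\<^sup>+x. ennreal (l powr (t - 2)) * (u x * D l x) \<partial>lborel)"
          by (rule nn_integral_cmult[symmetric]) measurable
        finally show ?thesis .
      qed (simp add: B_def)
    qed
    also have "\<dots> = ennreal A * (\<integral>\<^sup>+l. (\<integral>\<^sup>+x. ennreal (l powr (t - 2)) * (u x * D l x) \<partial>lborel) \<partial>lborel)"
      by (rule nn_integral_cmult) measurable
    also have "(\<integral>\<^sup>+l. (\<integral>\<^sup>+x. ennreal (l powr (t - 2)) * (u x * D l x) \<partial>lborel) \<partial>lborel)
      = (\<integral>\<^sup>+x. (\<integral>\<^sup>+l. ennreal (l powr (t - 2)) * (u x * D l x) \<partial>lborel) \<partial>lborel)"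
      by (rule lborel_pair.Fubini') measurable
    also have "\<dots> = (\<integral>\<^sup>+x. ennreal (2 powr (t - 1) / (t - 1)) * epowr (u x) t \<partial>lborel)"
    proof (rule nn_integral_cong)
      fix x :: 'a
      have "(\<integral>\<^sup>+l. ennreal (l powr (t - 2)) * (u x * D l x) \<partial>lborel) = (\<integral>\<^sup>+l. u x * (ennreal (l powr (t - 2)) * D l x) \<partial>lborel)"
        by (simp add: mult_ac)
      also have "\<dots> = u x * (\<integral>\<^sup>+l. ennreal (l powr (t - 2)) * D l x \<partial>lborel)"
        by (rule nn_integral_cmult) measurable
      \<comment> \<open>The weak type estimate has lowered the exponent of \<open>l\<close> by 1;
        because \<open>1 < t\<close>, the integral still converges at \<open>l = 0\<close>.\<close>
      also have "(\<integral>\<^sup>+l. ennreal (l powr (t - 2)) * D l x \<partial>lborel) = epowr (2 * u x) (t - 1) * ennreal (1 / (t - 1))"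
        using nn_integral_powr_below[of "t - 1" "2 * u x"] t by (simp add: D_def)
      also have "u x * (epowr (2 * u x) (t - 1) * ennreal (1 / (t - 1))) = ennreal (2 powr (t - 1) / (t - 1)) * (epowr (u x) 1 * epowr (u x) (t - 1))"
      proof -
        have "epowr 2 (t - 1) = ennreal (2 powr (t - 1))"
          using epowr_ennreal[of 2 "t - 1"] by simp
        moreover have "ennreal (2 powr (t - 1) / (t - 1)) = ennreal (2 powr (t - 1)) * ennreal (1 / (t - 1))"
          using t by (simp add: ennreal_mult[symmetric])
        ultimately show ?thesis using t by (simp add: epowr_mult mult_ac)
      qed
      finally show "(\<integral>\<^sup>+l. ennreal (l powr (t - 2)) * (u x * D l x) \<partial>lborel) = ennreal (2 powr (t - 1) / (t - 1)) * epowr (u x) t"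
        by (simp only: epowr_add[symmetric]) simp
    qed
    also have "\<dots> = ennreal (2 powr (t - 1) / (t - 1)) * (\<integral>\<^sup>+x. epowr (u x) t \<partial>lborel)"
      by (rule nn_integral_cmult) measurable
    finally show ?thesis
      using t A by (simp add: C_def ennreal_mult mult.assoc mult_left_mono divide_inverse)
  qed
  then show ?thesis using t A by (intro exI[of _ C]) (auto simp: C_def)
qed

section \<open>Morrey's inequality\<close>

lemma epowr_ball_mean_le:
  fixes u :: "'a::euclidean_space \<Rightarrow> ennreal"
  assumes [measurable]: "u \<in> borel_measurable borel" and r: "0 < r" and s: "1 \<le> s"
  shows "ball_mean u x r \<le> epowr (ball_mean (\<lambda>y. epowr (u y) s) x r) (1 / s)"
proof -
  define V where "V = emeasure lborel (ball x r)"
  have V: "V \<noteq> 0" "V < top" using emeasure_lborel_ball_pos[OF r] by (auto simp: V_def less_top)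
  have eq: "ball_mean w x r = (\<integral>\<^sup>+y. (indicator (ball x r) y / V) * w y \<partial>lborel)"
    if [measurable]: "w \<in> borel_measurable borel" for w
    unfolding ball_mean_def V_def[symmetric] divide_ennreal_def
    by (subst nn_integral_multc[symmetric]) (auto simp: mult_ac)
  have "epowr (ball_mean u x r) s \<le> ball_mean (\<lambda>y. epowr (u y) s) x r"
    using s V by (simp add: eq, intro epowr_nn_integral_le) (auto simp: divide_ennreal_def nn_integral_multc V_def[symmetric],
        simp add: divide_ennreal_def[symmetric])
  then show ?thesis using s by (subst (asm) epowr_le_iff) auto
qed

text \<open>The dilation by \<open>t\<close> about \<open>y\<close> maps the ball into itself and costs a factor \<open>t powr (- N / s)\<close>,
  which is integrable because \<open>s > N\<close>.\<close>

lemma Morrey_mean: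
  fixes v :: "'a::euclidean_space \<Rightarrow> real"
  assumes v: "C1_grad v G" and s: "real DIM('a) < s" and y: "y \<in> ball x r" and r: "0 < r"
  shows "ball_mean (\<lambda>z. ennreal \<bar>v z - v y\<bar>) x r
    \<le> ennreal (2 * r / (1 - DIM('a) / s)) * epowr (ball_mean (\<lambda>z. ennreal (norm (G z) powr s)) x r) (1 / s)"
proof -
  note [measurable] = C1_gradD(4,5)[OF v]
  define N where "N = real DIM('a)"
  have N: "1 \<le> N" "N < s" using s DIM_positive[where 'a='a] by (auto simp: N_def Suc_le_eq)
  define V where "V = emeasure lborel (ball x r)"
  have V: "V \<noteq> 0" "V < top" using emeasure_lborel_ball_pos[OF r] by (auto simp: V_def less_top)
  define A where "A = ball_mean (\<lambda>z. ennreal (norm (G z) powr s)) x r"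
  let ?g = "\<lambda>t z. ennreal (norm (G (y + t *\<^sub>R (z - y))))"
  have dil: "ball_mean (?g t) x r \<le> ennreal (t powr (- N / s)) * epowr A (1 / s)" if t: "0 < t" "t \<le> 1" for t
  proof -
    let ?U = "\<lambda>z. ennreal (norm (G z) powr s) * indicator (ball x r) z"
    have "(\<integral>\<^sup>+z\<in>ball x r. epowr (?g t z) s \<partial>lborel) \<le> (\<integral>\<^sup>+z. ?U ((1 - t) *\<^sub>R y + t *\<^sub>R z) \<partial>lborel)"
    proof (rule nn_integral_mono)
      fix z
      have "(1 - t) *\<^sub>R y + t *\<^sub>R z \<in> ball x r" if "z \<in> ball x r"
        using convexD[OF convex_ball y that, of "1 - t" t] t by auto
      moreover have "y + t *\<^sub>R (z - y) = (1 - t) *\<^sub>R y + t *\<^sub>R z" by (simp add: algebra_simps)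
      ultimately show "epowr (?g t z) s * indicator (ball x r) z \<le> ?U ((1 - t) *\<^sub>R y + t *\<^sub>R z)"
        by (simp add: epowr_ennreal split: split_indicator)
    qed
    also have "\<dots> = ennreal (t powr (- N)) * (ennreal (t ^ DIM('a)) * (\<integral>\<^sup>+z. ?U ((1 - t) *\<^sub>R y + t *\<^sub>R z) \<partial>lborel))"
      using t by (simp add: mult.assoc[symmetric] ennreal_mult[symmetric] powr_minus powr_realpow N_def)
    \<comment> \<open>Change of variables by the dilation; by convexity of the ball its image has
      already been placed inside.\<close>
    also have "ennreal (t ^ DIM('a)) * (\<integral>\<^sup>+z. ?U ((1 - t) *\<^sub>R y + t *\<^sub>R z) \<partial>lborel) = (\<integral>\<^sup>+z. ?U z \<partial>lborel)"
      using nn_integral_lborel_affine[of ?U t "(1 - t) *\<^sub>R y"] t by simp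
    finally have "ball_mean (\<lambda>z. epowr (?g t z) s) x r \<le> ennreal (t powr (- N)) * (\<integral>\<^sup>+z. ?U z \<partial>lborel) / V"
      unfolding ball_mean_def V_def by (rule divide_right_mono_ennreal)
    also have "\<dots> = ennreal (t powr (- N)) * A"
      by (simp add: A_def ball_mean_def V_def ennreal_times_divide)
    finally have "epowr (ball_mean (\<lambda>z. epowr (?g t z) s) x r) (1 / s) \<le> epowr (ennreal (t powr (- N)) * A) (1 / s)"
      using N by (intro epowr_mono) auto
    also have "\<dots> = ennreal (t powr (- N / s)) * epowr A (1 / s)"
      using N by (simp add: epowr_mult epowr_ennreal powr_powr)
    finally show ?thesis
      using epowr_ball_mean_le[of "?g t" r s x] r N by (simp add: order_trans)
  qed
  have "(\<integral>\<^sup>+z\<in>ball x r. ennreal \<bar>v z - v y\<bar> \<partial>lborel)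
      \<le> (\<integral>\<^sup>+z. ennreal (2 * r) * (\<integral>\<^sup>+t. ?g t z * indicator (ball x r) z * indicator {0..1} t \<partial>lborel) \<partial>lborel)"
  proof (rule nn_integral_mono)
    fix z
    show "ennreal \<bar>v z - v y\<bar> * indicator (ball x r) z
      \<le> ennreal (2 * r) * (\<integral>\<^sup>+t. ?g t z * indicator (ball x r) z * indicator {0..1::real} t \<partial>lborel)"
    proof (cases "z \<in> ball x r")
      case True
      have "ennreal \<bar>v (y + (z - y)) - v y\<bar> \<le> ennreal (norm (z - y)) * (\<integral>\<^sup>+t\<in>{0..1::real}. ?g t z \<partial>lborel)"
        by (rule C1_grad_diff_le[OF v])
      also have "norm (z - y) \<le> 2 * r"
        using True y dist_triangle_half_r[of x z "2 * r" y] by (simp add: dist_norm norm_minus_commute dist_commute)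
      then have "ennreal (norm (z - y)) * (\<integral>\<^sup>+t\<in>{0..1::real}. ?g t z \<partial>lborel) \<le> ennreal (2 * r) * (\<integral>\<^sup>+t\<in>{0..1::real}. ?g t z \<partial>lborel)"
        by (intro mult_right_mono ennreal_leI) auto
      finally show ?thesis using True by simp
    qed simp
  qed
  also have "\<dots> = ennreal (2 * r) * (\<integral>\<^sup>+z. (\<integral>\<^sup>+t. ?g t z * indicator (ball x r) z * indicator {0..1} t \<partial>lborel) \<partial>lborel)"
    by (rule nn_integral_cmult) measurable
  also have "(\<integral>\<^sup>+z. (\<integral>\<^sup>+t. ?g t z * indicator (ball x r) z * indicator {0..1} t \<partial>lborel) \<partial>lborel)
      = (\<integral>\<^sup>+t. (\<integral>\<^sup>+z. ?g t z * indicator (ball x r) z * indicator {0..1} t \<partial>lborel) \<partial>lborel)"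
    by (rule lborel_pair.Fubini'[symmetric]) measurable
  finally have "ball_mean (\<lambda>z. ennreal \<bar>v z - v y\<bar>) x r
      \<le> ennreal (2 * r) * (\<integral>\<^sup>+t. (\<integral>\<^sup>+z. ?g t z * indicator (ball x r) z * indicator {0..1} t \<partial>lborel) \<partial>lborel) / V"
    unfolding ball_mean_def V_def by (rule divide_right_mono_ennreal)
  also have "\<dots> = ennreal (2 * r) * (\<integral>\<^sup>+t. (\<integral>\<^sup>+z. ?g t z * indicator (ball x r) z * indicator {0..1} t \<partial>lborel) / V \<partial>lborel)"
    unfolding divide_ennreal_def by (subst nn_integral_multc) (auto simp: mult.assoc)
  also have "\<dots> \<le> ennreal (2 * r) * (\<integral>\<^sup>+t. (ennreal (t powr (- N / s)) * indicator {0..1} t) * epowr A (1 / s) \<partial>lborel)"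
  proof (rule mult_left_mono[OF nn_integral_mono_AE])
    \<comment> \<open>At \<open>t = 0\<close> the convention that powers of 0 are 0 breaks the
      bound, but a single point is negligible.\<close>
    have "AE t in lborel. t \<noteq> (0::real)" by (rule AE_lborel_singleton)
    then show "AE t in lborel. (\<integral>\<^sup>+z. ?g t z * indicator (ball x r) z * indicator {0..1} t \<partial>lborel) / V
       \<le> (ennreal (t powr (- N / s)) * indicator {0..1} t) * epowr A (1 / s)"
    proof (eventually_elim)
      case (elim t)
      show ?case using dil[of t] elim by (auto simp: ball_mean_def V_def split: split_indicator)
    qed
  qed simp
  also have "\<dots> = ennreal (2 * r) * ((\<integral>\<^sup>+t. ennreal (t powr (- N / s)) * indicator {0..1} t \<partial>lborel) * epowr A (1 / s))"
    by (subst nn_integral_multc) auto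
  also have "(\<integral>\<^sup>+t. ennreal (t powr (- N / s)) * indicator {0..1} t \<partial>lborel) = ennreal (1 / (1 - N / s))"
    using has_integral_powr_from_0[of "- N / s" 1] N
    by (intro nn_integral_has_integral_lebesgue') (auto simp: field_simps)
  also have "ennreal (2 * r) * (ennreal (1 / (1 - N / s)) * epowr A (1 / s)) = ennreal (2 * r / (1 - N / s)) * epowr A (1 / s)"
    using r N by (simp add: mult.assoc[symmetric] ennreal_mult[symmetric])
  finally show ?thesis by (simp add: A_def N_def)
qed

text \<open>Both \<open>v y\<close> and \<open>v x\<close> are compared with \<open>v z\<close>,
  averaged over \<open>z\<close> in the ball. The mean estimate holds around any point of the ball,
  so it serves \<open>y\<close> and the centre alike, and the two constants 2 add up to 4.\<close>

lemma Morrey: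
  fixes v :: "'a::euclidean_space \<Rightarrow> real"
  assumes v: "C1_grad v G" and s: "real DIM('a) < s" and y: "y \<in> ball x r"
  shows "ennreal \<bar>v y - v x\<bar>
    \<le> ennreal (4 * r / (1 - DIM('a) / s)) * epowr (ball_mean (\<lambda>z. ennreal (norm (G z) powr s)) x r) (1 / s)"
proof -
  note [measurable] = C1_gradD(4,5)[OF v]
  have r: "0 < r" using y by (metis mem_ball zero_le_dist order_le_less_trans)
  have s1: "0 < 1 - DIM('a) / s" using s by (simp add: field_simps)
  define V where "V = emeasure lborel (ball x r)"
  have V: "V \<noteq> 0" "V < top" using emeasure_lborel_ball_pos[OF r] by (auto simp: V_def less_top)
  define A where "A = epowr (ball_mean (\<lambda>z. ennreal (norm (G z) powr s)) x r) (1 / s)"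
  have "ennreal \<bar>v y - v x\<bar> = (\<integral>\<^sup>+z\<in>ball x r. ennreal \<bar>v y - v x\<bar> \<partial>lborel) / V"
    using V by (simp add: nn_integral_cmult_indicator V_def[symmetric] mult_divide_eq_ennreal)
  also have "\<dots> \<le> (\<integral>\<^sup>+z. ennreal \<bar>v z - v y\<bar> * indicator (ball x r) z + ennreal \<bar>v z - v x\<bar> * indicator (ball x r) z \<partial>lborel) / V"
  proof (intro divide_right_mono_ennreal nn_integral_mono)
    show "ennreal \<bar>v y - v x\<bar> * indicator (ball x r) z
      \<le> ennreal \<bar>v z - v y\<bar> * indicator (ball x r) z + ennreal \<bar>v z - v x\<bar> * indicator (ball x r) z" for z
      by (auto simp: ennreal_plus[symmetric] simp del: ennreal_plus intro!: ennreal_leI split: split_indicator)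
  qed
  also have "\<dots> = ball_mean (\<lambda>z. ennreal \<bar>v z - v y\<bar>) x r + ball_mean (\<lambda>z. ennreal \<bar>v z - v x\<bar>) x r"
    unfolding ball_mean_def V_def by (subst nn_integral_add) (auto simp: add_divide_distrib_ennreal)
  also have "\<dots> \<le> ennreal (2 * r / (1 - DIM('a) / s)) * A + ennreal (2 * r / (1 - DIM('a) / s)) * A"
    unfolding A_def using r by (intro add_mono Morrey_mean v s y) auto
  also have "\<dots> = ennreal (4 * r / (1 - DIM('a) / s)) * A"
    using r s1 by (simp add: distrib_right[symmetric] ennreal_plus[symmetric] del: ennreal_plus)
  finally show ?thesis by (simp add: A_def)
qed

lemma taylor_mean_dominated_infinity:
  assumes p: "real DIM('a) < p"
  shows "taylor_mean_dominated TYPE('a::euclidean_space) p \<infinity>"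
proof -
  define N where "N = real DIM('a)"
  \<comment> \<open>Any exponent strictly between would do: \<open>N < s\<close> for Morrey's
    inequality, and \<open>s < p\<close> to have \<open>p / s > 1\<close> in the maximal
    estimate.\<close>
  define s where "s = (p + N) / 2"
  have s: "N < s" "s < p" "0 < N" using p by (auto simp: s_def N_def)
  \<comment> \<open>The 4 of Morrey's inequality, doubled because the radius chosen below is less
    than \<open>2 * norm h\<close>.\<close>
  define c where "c = 8 / (1 - N / s)"
  have c: "0 < c" using s by (simp add: c_def)
  have "1 < p / s" using s by simp
  then obtain C where C: "0 \<le> C" and maxi: "\<And>u :: 'a \<Rightarrow> ennreal. u \<in> borel_measurable borel \<Longrightarrow>
    (\<integral>\<^sup>+x. epowr (maximal_function u x) (p / s) \<partial>lborel) \<le> ennreal C * (\<integral>\<^sup>+x. epowr (u x) (p / s) \<partial>lborel)"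
    using maximal_function_strong_type[of "p / s"] by blast
  show ?thesis unfolding taylor_mean_dominated_def
  proof (intro exI[of _ "c powr p * C"] conjI allI impI)
    show "0 \<le> c powr p * C" using C by simp
    fix \<epsilon> :: real and v :: "'a \<Rightarrow> real" and G
    assume \<epsilon>: "0 < \<epsilon>" "\<epsilon> \<le> 1" and v: "C1_grad v G"
    note [measurable] = C1_gradD(4,5)[OF v]
    define u where "u = (\<lambda>z. ennreal (norm (G z) powr s))"
    have [measurable]: "u \<in> borel_measurable borel" unfolding u_def by measurable
    define m where "m = (\<lambda>x. ennreal (c powr p) * epowr (maximal_function u x) (p / s))"
    show "\<exists>m\<in>borel_measurable borel. (\<forall>x. taylor_mean p \<infinity> v (\<lambda>_. 0) \<epsilon> x \<le> m x) \<and>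
       (\<integral>\<^sup>+x. m x \<partial>lborel) \<le> ennreal (c powr p * C) * (\<integral>\<^sup>+x. ennreal (norm (G x) powr p) \<partial>lborel)"
    proof (intro bexI[of _ m] conjI allI)
      show [measurable]: "m \<in> borel_measurable borel" unfolding m_def by measurable
      fix x
      define M where "M = epowr (maximal_function u x) (1 / s)"
      have quot: "ennreal (\<bar>v (x + h) - v x\<bar> / norm h) \<le> ennreal c * M" if h: "norm h < \<epsilon>" for h
      proof (cases "h = 0")
        case False
        \<comment> \<open>A rational radius, as the maximal function admits only these;
          \<open>norm h < \<epsilon> \<le> 1\<close> keeps it below 2.\<close>
        obtain r where r: "r \<in> \<rat>" "norm h < r" "r < 2 * norm h"
          using Rats_dense_in_real[of "norm h" "2 * norm h"] False by auto
        have r0: "0 < r" "r < 2" using r h \<epsilon> False by (auto intro: order_le_less_trans[OF norm_ge_zero])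
        have "ennreal (\<bar>v (x + h) - v x\<bar> / norm h) = ennreal (1 / norm h) * ennreal \<bar>v (x + h) - v x\<bar>"
          by (simp add: ennreal_mult[symmetric])
        also have "\<dots> \<le> ennreal (1 / norm h) * (ennreal (4 * r / (1 - N / s)) * epowr (ball_mean u x r) (1 / s))"
          unfolding u_def N_def using r s by (intro mult_left_mono Morrey v) (auto simp: dist_norm N_def)
        also have "\<dots> = ennreal (1 / norm h * (4 * r / (1 - N / s))) * epowr (ball_mean u x r) (1 / s)"
          using r0 s by (subst ennreal_mult) (auto simp: mult.assoc simp del: times_divide_eq_left times_divide_eq_right)
        also have "\<dots> \<le> ennreal c * M"
        proof (intro mult_mono ennreal_leI)
          have "r / norm h \<le> 2" using r False by (simp add: pos_divide_le_eq)
          then have "4 / (1 - N / s) * (r / norm h) \<le> 4 / (1 - N / s) * 2"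
            using s by (intro mult_left_mono) auto
          then show "1 / norm h * (4 * r / (1 - N / s)) \<le> c" by (simp add: c_def mult_ac)
          show "epowr (ball_mean u x r) (1 / s) \<le> M"
            unfolding M_def maximal_function_def using r r0 s by (intro epowr_mono SUP_upper) auto
        qed auto
        finally show ?thesis .
      qed simp
      have "taylor_mean p \<infinity> v (\<lambda>_. 0) \<epsilon> x \<le> epowr (ennreal c * M) p"
        unfolding taylor_mean_def if_P[OF refl]
      proof (intro epowr_mono esssup_I)
        show "(\<lambda>h. ennreal (\<bar>v (x + h) - v x - 0 \<bullet> h\<bar> / norm h)) \<in> borel_measurable (lebesgue_on (ball 0 \<epsilon>))"
          by (intro measurable_restrict_space1 measurable_completion) measurable
        show "AE h in lebesgue_on (ball 0 \<epsilon>). ennreal (\<bar>v (x + h) - v x - 0 \<bullet> h\<bar> / norm h) \<le> ennreal c * M"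
          using quot by (intro AE_I2) (simp add: space_restrict_space)
        show "0 \<le> p" using s by simp
      qed
      also have "\<dots> = m x"
        using s c by (simp add: m_def M_def epowr_mult epowr_epowr epowr_ennreal)
      finally show "taylor_mean p \<infinity> v (\<lambda>_. 0) \<epsilon> x \<le> m x" .
    next
      have "(\<integral>\<^sup>+x. m x \<partial>lborel) = ennreal (c powr p) * (\<integral>\<^sup>+x. epowr (maximal_function u x) (p / s) \<partial>lborel)"
        unfolding m_def by (rule nn_integral_cmult) measurable
      also have "\<dots> \<le> ennreal (c powr p) * (ennreal C * (\<integral>\<^sup>+x. epowr (u x) (p / s) \<partial>lborel))"
        by (intro mult_left_mono maxi) auto
      also have "\<dots> = ennreal (c powr p * C) * (\<integral>\<^sup>+x. ennreal (norm (G x) powr p) \<partial>lborel)"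
        using C s by (simp add: u_def epowr_ennreal powr_powr ennreal_mult mult.assoc)
      finally show "(\<integral>\<^sup>+x. m x \<partial>lborel) \<le> ennreal (c powr p * C) * (\<integral>\<^sup>+x. ennreal (norm (G x) powr p) \<partial>lborel)" .
    qed
  qed
qed

section \<open>Bump functions\<close>

lemma Ck_Suc_imp: "Ck (Suc k) f \<Longrightarrow> Ck k f"
proof (induction k arbitrary: f)
  case 0
  then show ?case
    by (auto simp: continuous_on_eq_continuous_within differentiable_imp_continuous_within)
next
  case (Suc k)
  have "Ck k (partial_deriv b f)" if "b \<in> Basis" for b
    using Suc.prems that by (intro Suc.IH) simp
  with Suc.prems show ?case by simp
qed

lemma Ck_const [simp]: "Ck k (\<lambda>_. c)"
  by (induction k arbitrary: c) (auto simp: frechet_derivative_const)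

lemma Ck_inner [simp]: "Ck k (\<lambda>x. (x - a) \<bullet> b)"
proof (cases k)
  case (Suc n)
  have "((\<lambda>x. (x - a) \<bullet> b) has_derivative (\<lambda>h. h \<bullet> b)) (at x)" for x
    by (auto intro!: derivative_eq_intros)
  then have d: "(\<lambda>x. (x - a) \<bullet> b) differentiable at x" "frechet_derivative (\<lambda>x. (x - a) \<bullet> b) (at x) = (\<lambda>h. h \<bullet> b)" for x
    by (auto simp: differentiable_def frechet_derivative_at[symmetric])
  show ?thesis using d by (simp add: Suc)
qed (auto intro!: continuous_intros)

lemma Ck_add: "Ck k f \<Longrightarrow> Ck k g \<Longrightarrow> Ck k (\<lambda>x. f x + g x)"
proof (induction k arbitrary: f g)
  case 0
  then show ?case by (auto intro: continuous_intros)
next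
  case (Suc k)
  have d: "((\<lambda>x. f x + g x) has_derivative (\<lambda>h. frechet_derivative f (at x) h + frechet_derivative g (at x) h)) (at x)" for x
    using Suc.prems by (intro has_derivative_add) (auto simp: frechet_derivative_works[symmetric])
  then have "partial_deriv b (\<lambda>x. f x + g x) = (\<lambda>x. partial_deriv b f x + partial_deriv b g x)" for b
    by (auto simp: fun_eq_iff frechet_derivative_at[OF d, symmetric])
  with d Suc show ?case by (auto simp: differentiable_def)
qed

lemma Ck_mult: "Ck k f \<Longrightarrow> Ck k g \<Longrightarrow> Ck k (\<lambda>x. f x * g x)"
proof (induction k arbitrary: f g)
  case 0
  then show ?case by (auto intro: continuous_intros)
next
  case (Suc k)
  have d: "((\<lambda>x. f x * g x) has_derivative (\<lambda>h. f x * frechet_derivative g (at x) h + frechet_derivative f (at x) h * g x)) (at x)" for x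
    using Suc.prems by (intro has_derivative_mult) (auto simp: frechet_derivative_works[symmetric])
  have "partial_deriv b (\<lambda>x. f x * g x) = (\<lambda>x. f x * partial_deriv b g x + partial_deriv b f x * g x)" for b
    by (auto simp: fun_eq_iff frechet_derivative_at[OF d, symmetric])
  moreover have "Ck k f" "Ck k g" using Suc.prems Ck_Suc_imp by auto
  ultimately show ?case using d Suc by (auto simp: differentiable_def intro!: Ck_add)
qed

text \<open>The functions \<open>exp (- 1 / t) / t ^ m\<close>, extended by \<open>0\<close>, are closed under differentiation
  up to linear combinations, which gives the smoothness of the bump function.\<close>

definition flat_exp :: "nat \<Rightarrow> real \<Rightarrow> real" where
  "flat_exp m t = (if 0 < t then exp (- 1 / t) / t ^ m else 0)"

lemma flat_exp_nonneg: "0 \<le> flat_exp m t"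
  by (simp add: flat_exp_def)

text \<open>With \<open>s = 1 / t\<close> this is \<open>s ^ m / fact m \<le> exp s\<close>, one
  term of the exponential series.\<close>

lemma flat_exp_bound: "flat_exp m t \<le> fact m"
proof (cases "0 < t")
  case True
  define s where "s = 1 / t"
  have s: "0 < s" using True by (simp add: s_def)
  have "(\<Sum>n\<in>{m}. inverse (fact n) * s ^ n) \<le> (\<Sum>n. inverse (fact n) * s ^ n)"
    using s summable_exp[of s] by (intro sum_le_suminf) (auto simp: field_simps)
  then have "s ^ m / fact m \<le> exp s" by (simp add: exp_def field_simps)
  then have "s ^ m * exp (- s) \<le> fact m" by (simp add: exp_minus field_simps)
  then show ?thesis using True by (simp add: flat_exp_def s_def power_one_over divide_inverse mult.commute power_inverse)
qed (simp add: flat_exp_def)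

lemma abs_flat_exp_bound: "\<bar>flat_exp m t\<bar> \<le> fact m"
  using flat_exp_bound flat_exp_nonneg by simp

lemma flat_exp_has_real_derivative:
  "(flat_exp m has_real_derivative flat_exp (m + 2) t - m * flat_exp (m + 1) t) (at t)"
proof -
  consider "t > 0" | "t < 0" | "t = 0" by linarith
  then show ?thesis
  proof cases
    case 1
    have "((\<lambda>t. exp (- 1 / t) / t ^ m) has_real_derivative flat_exp (m + 2) t - m * flat_exp (m + 1) t) (at t)"
    proof -
      have "((\<lambda>t. exp (- 1 / t) * inverse t ^ m) has_real_derivative
          exp (- 1 / t) * (1 / (t * t)) * inverse t ^ m
          + exp (- 1 / t) * (real m * inverse t ^ (m - Suc 0) * - (inverse t * inverse t))) (at t)"
        using 1 by (auto intro!: derivative_eq_intros simp: power2_eq_square)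
      \<comment> \<open>For \<open>m = 0\<close> the truncated subtraction \<open>m - Suc 0\<close>
        is harmless, since the coefficient vanishes.\<close>
      moreover have "real m * inverse t ^ (m - Suc 0) * - (inverse t * inverse t) = - real m * inverse t ^ (m + 1)"
        by (cases m) (auto simp: algebra_simps)
      ultimately have "((\<lambda>t. exp (- 1 / t) * inverse t ^ m) has_real_derivative
          exp (- 1 / t) * (1 / (t * t)) * inverse t ^ m + exp (- 1 / t) * (- real m * inverse t ^ (m + 1))) (at t)"
        by (simp only:)
      then show ?thesis
        using 1 by (simp add: flat_exp_def power_add divide_inverse power_inverse algebra_simps)
    qed
    then show ?thesis
      by (rule DERIV_cong_ev[THEN iffD1, rotated -1, OF _ refl _ refl])
         (use 1 in \<open>auto simp: flat_exp_def intro!: eventually_mono[OF eventually_nhds_in_open[of "{0<..}" t]]\<close>)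
  next
    case 2
    have "((\<lambda>t. 0) has_real_derivative flat_exp (m + 2) t - m * flat_exp (m + 1) t) (at t)"
      using 2 by (simp add: flat_exp_def)
    then show ?thesis
      by (rule DERIV_cong_ev[THEN iffD1, rotated -1, OF _ refl _ refl])
         (use 2 in \<open>auto simp: flat_exp_def intro!: eventually_mono[OF eventually_nhds_in_open[of "{..<0}" t]]\<close>)
  next
    case 3
    have "((\<lambda>h. flat_exp m h / h) \<longlongrightarrow> 0) (at 0)"
    proof (rule Lim_null_comparison)
      have "norm (flat_exp m h / h) \<le> \<bar>h\<bar> * fact (m + 2)" for h
      proof -
        \<comment> \<open>Division by \<open>h\<close> is traded for two more powers of
          \<open>h\<close> in the denominator, which the exponential absorbs.\<close>
        have "flat_exp m h / h = h * flat_exp (m + 2) h"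
          by (auto simp: flat_exp_def power_add power2_eq_square)
        then show ?thesis using mult_left_mono[OF abs_flat_exp_bound, of "\<bar>h\<bar>" "m + 2" h] by (simp only: real_norm_def abs_mult)
      qed
      then show "\<forall>\<^sub>F h in at 0. norm (flat_exp m h / h) \<le> \<bar>h\<bar> * fact (m + 2)" by simp
      show "((\<lambda>h::real. \<bar>h\<bar> * fact (m + 2)) \<longlongrightarrow> 0) (at 0)" by (auto intro!: tendsto_eq_intros)
    qed
    then show ?thesis using 3 by (simp add: DERIV_def flat_exp_def)
  qed
qed

lemma flat_exp_comp_has_derivative:
  fixes a x :: "'a::euclidean_space"
  shows "((\<lambda>x. flat_exp m (1 - c\<^sup>2 * (norm (x - a))\<^sup>2)) has_derivative
     (\<lambda>h. (flat_exp (m + 2) (1 - c\<^sup>2 * (norm (x - a))\<^sup>2) - m * flat_exp (m + 1) (1 - c\<^sup>2 * (norm (x - a))\<^sup>2))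
        * (- 2 * c\<^sup>2 * ((x - a) \<bullet> h)))) (at x)"
proof -
  have "((\<lambda>x. 1 - c\<^sup>2 * (norm (x - a))\<^sup>2) has_derivative (\<lambda>h. - 2 * c\<^sup>2 * ((x - a) \<bullet> h))) (at x)"
    unfolding power2_norm_eq_inner
    by (auto intro!: derivative_eq_intros simp: inner_commute algebra_simps)
  from has_derivative_compose[OF this flat_exp_has_real_derivative[unfolded has_field_derivative_def]]
  show ?thesis by simp
qed

text \<open>Not normalised, and concentrated in the ball of radius \<open>1 / c\<close> about
  \<open>a\<close>; the squared norm keeps it smooth at the centre.\<close>

definition bump :: "real \<Rightarrow> 'a::euclidean_space \<Rightarrow> 'a \<Rightarrow> real" where
  "bump c a x = flat_exp 0 (1 - c\<^sup>2 * (norm (x - a))\<^sup>2)"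

text \<open>Induction on \<open>k\<close> with \<open>m\<close> free: a derivative leads to the
  indices \<open>m + 1\<close> and \<open>m + 2\<close>, times an affine function.\<close>

lemma Ck_flat_exp_comp: "Ck k (\<lambda>x. flat_exp m (1 - c\<^sup>2 * (norm (x - a))\<^sup>2))"
proof (induction k arbitrary: m)
  case 0
  show ?case
    using has_derivative_continuous[OF flat_exp_comp_has_derivative[of m c a]]
    by (simp add: continuous_on_eq_continuous_within)
next
  case (Suc k)
  have "partial_deriv b (\<lambda>x. flat_exp m (1 - c\<^sup>2 * (norm (x - a))\<^sup>2)) =
     (\<lambda>x. (flat_exp (m + 2) (1 - c\<^sup>2 * (norm (x - a))\<^sup>2) + (- real m) * flat_exp (m + 1) (1 - c\<^sup>2 * (norm (x - a))\<^sup>2))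
        * (- 2 * c\<^sup>2 * ((x - a) \<bullet> b)))" for b
    by (simp only: fun_eq_iff frechet_derivative_at[OF flat_exp_comp_has_derivative, symmetric]) simp
  then show ?case
    using flat_exp_comp_has_derivative[of m c a]
    by (auto simp only: Ck.simps differentiable_def intro!: Ck_mult Ck_add Suc Ck_const Ck_inner)
qed

lemma bump_eq_0: "0 < c \<Longrightarrow> 1 / c \<le> norm (x - a) \<Longrightarrow> bump c a x = 0"
proof -
  assume c: "0 < c" and "1 / c \<le> norm (x - a)"
  then have "1 \<le> c * norm (x - a)" by (simp add: field_simps)
  then have "1\<^sup>2 \<le> (c * norm (x - a))\<^sup>2" by (intro power_mono) auto
  then show "bump c a x = 0" by (simp add: bump_def flat_exp_def power_mult_distrib)
qed

lemma test_function_bump: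
  assumes c: "0 < c"
  shows "test_function (bump c a)"
  unfolding test_function_def
proof
  show "\<forall>k. Ck k (bump c a)" unfolding bump_def[abs_def] using Ck_flat_exp_comp by blast
  have "{x. bump c a x \<noteq> 0} \<subseteq> cball a (1 / c)"
  proof
    fix x assume "x \<in> {x. bump c a x \<noteq> 0}"
    then have "\<not> 1 / c \<le> norm (x - a)" using bump_eq_0[OF c, of x a] by auto
    then show "x \<in> cball a (1 / c)" by (simp add: dist_norm norm_minus_commute)
  qed
  then have "closure {x. bump c a x \<noteq> 0} \<subseteq> cball a (1 / c)" by (rule closure_minimal) auto
  then show "compact (closure {x. bump c a x \<noteq> 0})"
    by (simp add: compact_eq_bounded_closed bounded_subset[OF bounded_cball])
qed

lemma bump_partial_deriv:
  "partial_deriv b (bump c a) x = flat_exp 2 (1 - c\<^sup>2 * (norm (x - a))\<^sup>2) * (- 2 * c\<^sup>2 * ((x - a) \<bullet> b))"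
  unfolding bump_def[abs_def] by (simp only: frechet_derivative_at[OF flat_exp_comp_has_derivative, symmetric]) (simp add: numeral_2_eq_2)

lemma flat_exp_lipschitz: "\<bar>flat_exp 0 s - flat_exp 0 t\<bar> \<le> 2 * \<bar>s - t\<bar>"
proof -
  have "norm (flat_exp 0 s - flat_exp 0 t) \<le> 2 * norm (s - t)"
  proof (rule field_differentiable_bound[of UNIV "flat_exp 0" "\<lambda>t. flat_exp 2 t"])
    show "(flat_exp 0 has_real_derivative flat_exp 2 z) (at z within UNIV)" for z
      using flat_exp_has_real_derivative[of 0 z] by (simp add: numeral_2_eq_2)
    show "norm (flat_exp 2 z) \<le> 2" for z
      using abs_flat_exp_bound[of 2 z] by (simp add: fact_numeral)
  qed auto
  then show ?thesis by simp
qed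

text \<open>The number 36 is \<open>fact 4 + 2 * fact 3\<close>, a bound for the derivative of
  \<open>flat_exp 2\<close>. Subtracting the linear part and applying the mean value estimate on the
  segment gives the quadratic remainder.\<close>

lemma flat_exp_Taylor: "\<bar>flat_exp 0 s - flat_exp 0 t - flat_exp 2 t * (s - t)\<bar> \<le> 36 * (s - t)\<^sup>2"
proof -
  have lip: "\<bar>flat_exp 2 z - flat_exp 2 t\<bar> \<le> 36 * \<bar>z - t\<bar>" for z
  proof -
    have "norm (flat_exp 2 z - flat_exp 2 t) \<le> 36 * norm (z - t)"
    proof (rule field_differentiable_bound[of UNIV "flat_exp 2" "\<lambda>t. flat_exp 4 t - 2 * flat_exp 3 t"])
      show "(flat_exp 2 has_real_derivative flat_exp 4 z - 2 * flat_exp 3 z) (at z within UNIV)" for z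
        using flat_exp_has_real_derivative[of 2 z] by simp
      show "norm (flat_exp 4 z - 2 * flat_exp 3 z) \<le> 36" for z
        using abs_flat_exp_bound[of 4 z] abs_flat_exp_bound[of 3 z] by (simp add: fact_numeral)
    qed auto
    then show ?thesis by simp
  qed
  have "norm ((flat_exp 0 s - flat_exp 2 t * s) - (flat_exp 0 t - flat_exp 2 t * t)) \<le> (36 * \<bar>s - t\<bar>) * norm (s - t)"
  proof (rule field_differentiable_bound[of "closed_segment s t" "\<lambda>z. flat_exp 0 z - flat_exp 2 t * z" "\<lambda>z. flat_exp 2 z - flat_exp 2 t"])
    show "((\<lambda>z. flat_exp 0 z - flat_exp 2 t * z) has_real_derivative flat_exp 2 z - flat_exp 2 t) (at z within closed_segment s t)" for z
    proof -
      have "(flat_exp 0 has_real_derivative flat_exp 2 z) (at z)"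
        using flat_exp_has_real_derivative[of 0 z] by (simp add: numeral_2_eq_2)
      then have "((\<lambda>z. flat_exp 0 z - flat_exp 2 t * z) has_real_derivative flat_exp 2 z - flat_exp 2 t * 1) (at z)"
        by (intro DERIV_diff DERIV_cmult DERIV_ident)
      then show ?thesis by (simp add: has_field_derivative_at_within)
    qed
    show "norm (flat_exp 2 z - flat_exp 2 t) \<le> 36 * \<bar>s - t\<bar>" if "z \<in> closed_segment s t" for z
    proof -
      have "\<bar>z - t\<bar> \<le> \<bar>s - t\<bar>" using that by (auto simp: closed_segment_eq_real_ivl split: if_splits)
      then show ?thesis using lip[of z] by simp
    qed
  qed auto
  moreover have "(36 * \<bar>s - t\<bar>) * norm (s - t) = 36 * (s - t)\<^sup>2"
    by (simp add: power2_eq_square)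
  moreover have "(flat_exp 0 s - flat_exp 2 t * s) - (flat_exp 0 t - flat_exp 2 t * t)
      = flat_exp 0 s - flat_exp 0 t - flat_exp 2 t * (s - t)"
    by (simp add: algebra_simps)
  ultimately show ?thesis by (simp only: real_norm_def)
qed

text \<open>Expansion of the kernel in its centre, uniform in \<open>z\<close>. As \<open>R\<close>
  exceeds \<open>1 / c + 1\<close>, shifts with \<open>norm h \<le> 1\<close> keep both supports
  inside the ball of radius \<open>R\<close>.\<close>

lemma bump_diff_bounds:
  fixes h z :: "'a::euclidean_space"
  assumes c: "0 < c" and h: "norm h \<le> 1"
  defines "R \<equiv> 1 / c + 2"
  shows "R \<le> norm z \<Longrightarrow> bump c h z = 0 \<and> bump c 0 z = 0 \<and> flat_exp 2 (1 - c\<^sup>2 * (norm z)\<^sup>2) = 0"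
    and "\<bar>bump c h z - bump c 0 z\<bar> \<le> 2 * (c\<^sup>2 * (2 * R + 1)) * norm h"
    and "\<bar>bump c h z - bump c 0 z - flat_exp 2 (1 - c\<^sup>2 * (norm z)\<^sup>2) * (2 * c\<^sup>2 * (z \<bullet> h))\<bar>
       \<le> (36 * (c\<^sup>2 * (2 * R + 1))\<^sup>2 + 2 * c\<^sup>2) * (norm h)\<^sup>2"
proof -
  have R: "0 < R" using c by (simp add: R_def add_pos_pos)
  show far: "bump c h z = 0 \<and> bump c 0 z = 0 \<and> flat_exp 2 (1 - c\<^sup>2 * (norm z)\<^sup>2) = 0" if "R \<le> norm z"
  proof -
    have "1 / c \<le> norm z" "1 / c \<le> norm (z - h)"
      using that h norm_triangle_ineq2[of z h] by (auto simp: R_def)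
    then have "bump c h z = 0" "bump c 0 z = 0"
      using bump_eq_0[OF c, of z h] bump_eq_0[OF c, of z 0] by auto
    then show ?thesis
      by (simp add: bump_def flat_exp_def split: if_splits)
  qed
  define t where "t = 1 - c\<^sup>2 * (norm z)\<^sup>2"
  define s where "s = 1 - c\<^sup>2 * (norm (z - h))\<^sup>2"
  \<comment> \<open>Linear in \<open>h\<close> up to a quadratic term. Replacing this increment by
    its linear part costs the extra \<open>2 * c\<^sup>2\<close>, where 2 bounds
    \<open>flat_exp 2\<close>.\<close>
  have st: "s - t = c\<^sup>2 * (2 * (z \<bullet> h) - (norm h)\<^sup>2)"
    by (simp add: s_def t_def power2_norm_eq_inner algebra_simps inner_commute)
  have b: "bump c h z = flat_exp 0 s" "bump c 0 z = flat_exp 0 t" by (simp_all add: bump_def s_def t_def)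
  have hh: "(norm h)\<^sup>2 \<le> norm h" using h by (simp add: power2_eq_square mult_left_le_one_le)
  have st_le: "\<bar>s - t\<bar> \<le> c\<^sup>2 * (2 * R + 1) * norm h" if "norm z \<le> R"
  proof -
    have "\<bar>z \<bullet> h\<bar> \<le> R * norm h"
      using Cauchy_Schwarz_ineq2[of z h] mult_right_mono[OF that, of "norm h"] by simp
    have "\<bar>2 * (z \<bullet> h) - (norm h)\<^sup>2\<bar> \<le> (2 * R + 1) * norm h"
    proof -
      have e: "(2 * R + 1) * norm h = 2 * (R * norm h) + norm h" by (simp add: algebra_simps)
      show ?thesis
        using \<open>\<bar>z \<bullet> h\<bar> \<le> R * norm h\<close> hh zero_le_power2[of "norm h"] norm_ge_zero[of h]
        unfolding e abs_le_iff by linarith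
    qed
    from mult_left_mono[OF this, of "c\<^sup>2"] show ?thesis by (simp add: st abs_mult mult_ac)
  qed
  show "\<bar>bump c h z - bump c 0 z\<bar> \<le> 2 * (c\<^sup>2 * (2 * R + 1)) * norm h"
  proof (cases "norm z \<le> R")
    case True
    show ?thesis using flat_exp_lipschitz[of s t] st_le[OF True] unfolding b by simp
  next
    case False
    then show ?thesis using far R by simp
  qed
  show "\<bar>bump c h z - bump c 0 z - flat_exp 2 (1 - c\<^sup>2 * (norm z)\<^sup>2) * (2 * c\<^sup>2 * (z \<bullet> h))\<bar>
       \<le> (36 * (c\<^sup>2 * (2 * R + 1))\<^sup>2 + 2 * c\<^sup>2) * (norm h)\<^sup>2"
  proof (cases "norm z \<le> R")
    case True
    have "\<bar>s - t\<bar>\<^sup>2 \<le> (c\<^sup>2 * (2 * R + 1) * norm h)\<^sup>2" using st_le[OF True] by (intro power_mono) auto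
    then have 1: "\<bar>flat_exp 0 s - flat_exp 0 t - flat_exp 2 t * (s - t)\<bar> \<le> 36 * (c\<^sup>2 * (2 * R + 1) * norm h)\<^sup>2"
      using flat_exp_Taylor[of s t] by simp
    have "flat_exp 2 t * (s - t) = flat_exp 2 t * (2 * c\<^sup>2 * (z \<bullet> h)) - flat_exp 2 t * (c\<^sup>2 * (norm h)\<^sup>2)"
      unfolding st by (simp add: algebra_simps)
    moreover have "\<bar>flat_exp 2 t * (c\<^sup>2 * (norm h)\<^sup>2)\<bar> \<le> 2 * (c\<^sup>2 * (norm h)\<^sup>2)"
      using abs_flat_exp_bound[of 2 t] unfolding abs_mult by (intro mult_mono) (auto simp: fact_numeral)
    ultimately have "\<bar>flat_exp 0 s - flat_exp 0 t - flat_exp 2 t * (2 * c\<^sup>2 * (z \<bullet> h))\<bar>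
        \<le> 36 * (c\<^sup>2 * (2 * R + 1) * norm h)\<^sup>2 + 2 * (c\<^sup>2 * (norm h)\<^sup>2)"
      using 1 by linarith
    also have "\<dots> = (36 * (c\<^sup>2 * (2 * R + 1))\<^sup>2 + 2 * c\<^sup>2) * (norm h)\<^sup>2"
      unfolding power_mult_distrib[of "c\<^sup>2 * (2 * R + 1)" "norm h"]
      by (simp only: distrib_right[of "36 * (c\<^sup>2 * (2 * R + 1))\<^sup>2"] mult.assoc)
    finally show ?thesis unfolding b t_def[symmetric] .
  next
    case False
    then show ?thesis using far R by simp
  qed
qed

section \<open>Mollification\<close>

text \<open>The Borel counterpart of \<open>locally_integrable\<close>, tested on balls by integrals
  in [0, \<infinity>]. The analysis is carried out for Borel representatives, to which Tonelli's
  theorem and translations apply directly.\<close>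

definition loc_integrable :: "('a::euclidean_space \<Rightarrow> 'b::euclidean_space) \<Rightarrow> bool" where
  "loc_integrable u \<longleftrightarrow> u \<in> borel_measurable borel \<and>
     (\<forall>R. (\<integral>\<^sup>+y\<in>ball 0 R. ennreal (norm (u y)) \<partial>lborel) < top)"

lemma loc_integrableD:
  assumes "loc_integrable u"
  shows "u \<in> borel_measurable borel" "(\<integral>\<^sup>+y\<in>ball x R. ennreal (norm (u y)) \<partial>lborel) < top"
proof -
  show "u \<in> borel_measurable borel" using assms by (simp add: loc_integrable_def)
  have "ball x R \<subseteq> ball 0 (norm x + R)"
  proof
    fix y assume "y \<in> ball x R"
    then show "y \<in> ball 0 (norm x + R)"
      using norm_triangle_sub[of y x] by (simp add: dist_norm norm_minus_commute)
  qed
  then have "(\<integral>\<^sup>+y\<in>ball x R. ennreal (norm (u y)) \<partial>lborel) \<le> (\<integral>\<^sup>+y\<in>ball 0 (norm x + R). ennreal (norm (u y)) \<partial>lborel)"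
    by (intro nn_integral_mono) (auto split: split_indicator)
  also have "\<dots> < top" using assms by (simp add: loc_integrable_def)
  finally show "(\<integral>\<^sup>+y\<in>ball x R. ennreal (norm (u y)) \<partial>lborel) < top" .
qed

text \<open>Used with \<open>w\<close> an increment or a Taylor remainder of a bump, so that the
  smallness of \<open>B\<close> in the shift passes to the mollification.\<close>

lemma loc_integrable_bounded_mult:
  fixes u :: "'a::euclidean_space \<Rightarrow> 'b::euclidean_space"
  assumes u: "loc_integrable u" and w[measurable]: "w \<in> borel_measurable borel"
    and bd: "\<And>y. \<bar>w y\<bar> \<le> B" and supp: "\<And>y. y \<notin> ball x R \<Longrightarrow> w y = 0"
  shows "integrable lborel (\<lambda>y. w y *\<^sub>R u y)"
    and "ennreal (norm (\<integral>y. w y *\<^sub>R u y \<partial>lborel)) \<le> ennreal B * (\<integral>\<^sup>+y\<in>ball x R. ennreal (norm (u y)) \<partial>lborel)"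
proof -
  note [measurable] = loc_integrableD(1)[OF u]
  have B: "0 \<le> B" using bd[of x] by linarith
  have "(\<integral>\<^sup>+y. ennreal (norm (w y *\<^sub>R u y)) \<partial>lborel) \<le> (\<integral>\<^sup>+y. ennreal B * (ennreal (norm (u y)) * indicator (ball x R) y) \<partial>lborel)"
  proof (rule nn_integral_mono)
    fix y
    show "ennreal (norm (w y *\<^sub>R u y)) \<le> ennreal B * (ennreal (norm (u y)) * indicator (ball x R) y)"
    proof (cases "y \<in> ball x R")
      case True
      then show ?thesis using bd[of y] B
        by (simp add: ennreal_mult[symmetric] mult_right_mono ennreal_leI)
    next
      case False
      then show ?thesis using supp by simp
    qed
  qed
  also have "\<dots> = ennreal B * (\<integral>\<^sup>+y\<in>ball x R. ennreal (norm (u y)) \<partial>lborel)"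
    by (rule nn_integral_cmult) measurable
  finally have le: "(\<integral>\<^sup>+y. ennreal (norm (w y *\<^sub>R u y)) \<partial>lborel) \<le> ennreal B * (\<integral>\<^sup>+y\<in>ball x R. ennreal (norm (u y)) \<partial>lborel)" .
  also have "\<dots> < top" using loc_integrableD(2)[OF u] by (simp add: ennreal_mult_less_top)
  finally show int: "integrable lborel (\<lambda>y. w y *\<^sub>R u y)" by (intro integrableI_bounded) auto
  have "ennreal (norm (\<integral>y. w y *\<^sub>R u y \<partial>lborel)) \<le> (\<integral>\<^sup>+y. ennreal (norm (w y *\<^sub>R u y)) \<partial>lborel)"
    by (rule integral_norm_bound_ennreal[OF int])
  then show "ennreal (norm (\<integral>y. w y *\<^sub>R u y \<partial>lborel)) \<le> ennreal B * (\<integral>\<^sup>+y\<in>ball x R. ennreal (norm (u y)) \<partial>lborel)"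
    using le by (rule order_trans)
qed

section \<open>The mollification operator and its differentiability\<close>

lemma borel_measurable_bump [measurable]: "bump c a \<in> borel_measurable borel"
proof -
  have "Ck 0 (bump c a)" unfolding bump_def[abs_def] by (rule Ck_flat_exp_comp)
  then show ?thesis by (auto intro: borel_measurable_continuous_onI)
qed

lemma borel_measurable_flat_exp [measurable]: "flat_exp m \<in> borel_measurable borel"
proof -
  have "continuous_on UNIV (flat_exp m)"
    using DERIV_isCont[OF flat_exp_has_real_derivative[of m]] by (simp add: continuous_on_eq_continuous_within)
  then show ?thesis by (rule borel_measurable_continuous_onI)
qed

lemma bump_nonneg: "0 \<le> bump c a x" and bump_le_1: "bump c a x \<le> 1"
  using flat_exp_nonneg[of 0] flat_exp_bound[of 0] by (auto simp: bump_def)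

lemma bump_shift: "bump c (x + h) y = bump c h (y - x)"
  by (simp add: bump_def algebra_simps)

lemma loc_integrable_1: "loc_integrable (\<lambda>_::'a::euclidean_space. 1 :: real)"
proof -
  have "emeasure lborel (ball (0::'a) R) < top" for R
    using emeasure_lborel_ball_pos(2)[of R "0::'a"] by (cases "0 < R") (auto simp: less_top ball_empty)
  then show ?thesis by (simp add: loc_integrable_def)
qed

definition bump_mass :: "'a::euclidean_space itself \<Rightarrow> real \<Rightarrow> real" where
  "bump_mass _ c = (\<integral>z. bump c (0::'a) z \<partial>lborel)"

lemma integrable_bump:
  assumes "0 < c"
  shows "integrable lborel (bump c (a::'a::euclidean_space))"
proof -
  have "bump c a y = 0" if "y \<notin> ball a (1 / c)" for y
    using that bump_eq_0[OF assms, of y a] by (simp add: dist_norm norm_minus_commute)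
  then have "integrable lborel (\<lambda>y. bump c a y *\<^sub>R (1::real))"
    using bump_le_1[of c a] bump_nonneg[of c a]
    by (intro loc_integrable_bounded_mult(1)[OF loc_integrable_1, where B=1 and x=a and R="1/c"]) auto
  then show ?thesis by simp
qed

lemma bump_mass_pos:
  assumes "0 < c"
  shows "0 < bump_mass TYPE('a::euclidean_space) c"
proof -
  have "bump_mass TYPE('a) c \<noteq> 0"
  proof
    assume "bump_mass TYPE('a) c = 0"
    then have "AE z in lborel. bump c (0::'a) z = 0"
      unfolding bump_mass_def using integrable_bump[OF assms, of "0::'a"]
      by (subst (asm) integral_nonneg_eq_0_iff_AE) (auto simp: bump_nonneg)
    then have "AE z in lborel. z \<notin> ball (0::'a) (1 / c)"
    proof eventually_elim
      case (elim z)
      show ?case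
      proof
        assume "z \<in> ball 0 (1 / c)"
        then have "c * norm z < 1" using assms by (simp add: field_simps)
        then have "(c * norm z)\<^sup>2 < 1\<^sup>2" using assms by (intro power_strict_mono) auto
        then have "0 < 1 - c\<^sup>2 * (norm (z - 0))\<^sup>2" by (simp add: power_mult_distrib)
        then show False using elim by (simp add: bump_def flat_exp_def)
      qed
    qed
    then have "emeasure lborel (ball (0::'a) (1 / c)) = 0"
      by (subst (asm) AE_iff_measurable[of "ball 0 (1 / c)"]) auto
    then show False using emeasure_lborel_ball_pos(1)[of "1 / c" "0::'a"] assms by simp
  qed
  moreover have "0 \<le> bump_mass TYPE('a) c" unfolding bump_mass_def by (simp add: bump_nonneg)
  ultimately show ?thesis by simp
qed

text \<open>The mollification radius is \<open>1 / c\<close>, so the approximation improves as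
  \<open>c\<close> grows. The kernel is centred at \<open>x\<close>, hence differences in
  \<open>x\<close> fall on the kernel.\<close>

definition mollify :: "real \<Rightarrow> ('a::euclidean_space \<Rightarrow> 'b::euclidean_space) \<Rightarrow> 'a \<Rightarrow> 'b" where
  "mollify c u x = (\<integral>y. (bump c x y / bump_mass TYPE('a) c) *\<^sub>R u y \<partial>lborel)"

lemma integrable_bump_mult:
  assumes u: "loc_integrable u" and c: "0 < c"
  shows "integrable lborel (\<lambda>y. bump c x y *\<^sub>R u y)"
proof -
  have "bump c x y = 0" if "y \<notin> ball x (1 / c)" for y
    using that bump_eq_0[OF c, of y x] by (simp add: dist_norm norm_minus_commute)
  then show ?thesis
    using bump_le_1[of c x] bump_nonneg[of c x]
    by (intro loc_integrable_bounded_mult(1)[OF u, where B=1 and x=x and R="1/c"]) auto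
qed

lemma mollify_eq: "mollify c u x = (\<integral>y. bump c x y *\<^sub>R u y \<partial>lborel) /\<^sub>R bump_mass TYPE('a) c"
  for x :: "'a::euclidean_space"
  unfolding mollify_def by (subst integral_scaleR_right[symmetric]) (simp add: divide_inverse mult.commute)

text \<open>Only the bump functions are needed as test functions.\<close>

definition bump_weak_gradient :: "('a::euclidean_space \<Rightarrow> real) \<Rightarrow> ('a \<Rightarrow> 'a) \<Rightarrow> bool" where
  "bump_weak_gradient f g \<longleftrightarrow> loc_integrable f \<and> loc_integrable g \<and>
     (\<forall>c>0. \<forall>a. \<forall>b\<in>Basis. (\<integral>y. f y * partial_deriv b (bump c a) y \<partial>lborel) = - (\<integral>y. (g y \<bullet> b) * bump c a y \<partial>lborel))"

text \<open>The Lipschitz bound of the kernel in its centre; it yields the continuity of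
  \<open>mollify c g\<close>.\<close>

lemma mollify_diff_bound:
  assumes u: "loc_integrable u" and c: "0 < c"
  shows "\<exists>L R. 0 \<le> L \<and> (\<forall>x h. norm h \<le> 1 \<longrightarrow>
    ennreal (norm (mollify c u (x + h) - mollify c u x)) \<le> ennreal (L * norm h) * (\<integral>\<^sup>+y\<in>ball x R. ennreal (norm (u y)) \<partial>lborel))"
proof -
  note [measurable] = loc_integrableD(1)[OF u]
  define R where "R = 1 / c + 2"
  define Z where "Z = bump_mass TYPE('a) c"
  have Z: "0 < Z" using bump_mass_pos[OF c] by (simp add: Z_def)
  have R: "0 < R" using c by (simp add: R_def add_pos_pos)
  define K where "K = 2 * (c\<^sup>2 * (2 * R + 1))"
  have K: "0 \<le> K" using R by (simp add: K_def)
  show ?thesis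
  proof (rule exI[of _ "K / Z"], rule exI[of _ R], intro conjI allI impI)
    show "0 \<le> K / Z" using K Z by simp
    fix x h :: 'a
    assume h: "norm h \<le> 1"
    define w where "w = (\<lambda>y. bump c (x + h) y - bump c x y)"
    have w: "w y = bump c h (y - x) - bump c 0 (y - x)" for y
      using bump_shift[of c x h y] bump_shift[of c x 0 y] by (simp add: w_def)
    have [measurable]: "w \<in> borel_measurable borel" unfolding w_def by measurable
    have bd: "\<bar>w y\<bar> \<le> K * norm h" for y
      unfolding w K_def R_def by (rule bump_diff_bounds(2)[OF c h])
    have supp: "w y = 0" if "y \<notin> ball x R" for y
      using that bump_diff_bounds(1)[OF c h, of "y - x"] by (simp add: w R_def dist_norm norm_minus_commute)
    have "mollify c u (x + h) - mollify c u x = (\<integral>y. w y *\<^sub>R u y \<partial>lborel) /\<^sub>R Z"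
      unfolding mollify_eq Z_def w_def scaleR_left_diff_distrib
      by (subst Bochner_Integration.integral_diff) (auto simp: integrable_bump_mult u c scaleR_right_diff_distrib)
    then have "ennreal (norm (mollify c u (x + h) - mollify c u x)) = ennreal (1 / Z) * ennreal (norm (\<integral>y. w y *\<^sub>R u y \<partial>lborel))"
      using Z by (simp add: ennreal_mult[symmetric] divide_inverse)
    also have "\<dots> \<le> ennreal (1 / Z) * (ennreal (K * norm h) * (\<integral>\<^sup>+y\<in>ball x R. ennreal (norm (u y)) \<partial>lborel))"
      by (intro mult_left_mono loc_integrable_bounded_mult(2)[OF u _ bd supp]) auto
    also have "\<dots> = ennreal (K / Z * norm h) * (\<integral>\<^sup>+y\<in>ball x R. ennreal (norm (u y)) \<partial>lborel)"
      using Z K by (simp add: mult.assoc[symmetric] ennreal_mult[symmetric])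
    finally show "ennreal (norm (mollify c u (x + h) - mollify c u x)) \<le> \<dots>" .
  qed
qed

text \<open>The derivative of the kernel in its centre is minus its derivative in \<open>y\<close>,
  and the weak gradient identity transfers the latter to \<open>g\<close>. What remains is the
  quadratic remainder of the kernel integrated against \<open>f\<close>, so that the bound involves
  a local integral of \<open>\<bar>f y\<bar>\<close> only.\<close>

lemma mollify_Taylor:
  fixes f :: "'a::euclidean_space \<Rightarrow> real"
  assumes fg: "bump_weak_gradient f g" and c: "0 < c"
  shows "\<exists>L R. 0 \<le> L \<and> 0 < R \<and> (\<forall>x h. norm h \<le> 1 \<longrightarrow>
    ennreal \<bar>mollify c f (x + h) - mollify c f x - mollify c g x \<bullet> h\<bar>
      \<le> ennreal (L * (norm h)\<^sup>2) * (\<integral>\<^sup>+y\<in>ball x R. ennreal \<bar>f y\<bar> \<partial>lborel))"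
proof -
  have f: "loc_integrable f" and g: "loc_integrable g" using fg by (auto simp: bump_weak_gradient_def)
  note [measurable] = loc_integrableD(1)[OF f] loc_integrableD(1)[OF g]
  define R where "R = 1 / c + 2"
  define Z where "Z = bump_mass TYPE('a) c"
  have Z: "0 < Z" using bump_mass_pos[OF c] by (simp add: Z_def)
  have R: "0 < R" using c by (simp add: R_def add_pos_pos)
  define K where "K = 36 * (c\<^sup>2 * (2 * R + 1))\<^sup>2 + 2 * c\<^sup>2"
  have K: "0 \<le> K" by (simp add: K_def)
  show ?thesis
  proof (rule exI[of _ "K / Z"], rule exI[of _ R], intro conjI R allI impI)
    show "0 \<le> K / Z" using K Z by simp
    fix x h :: 'a
    assume h: "norm h \<le> 1"
    \<comment> \<open>The derivative of \<open>bump c x\<close> at \<open>y\<close> in direction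
      \<open>k\<close>.\<close>
    define D where "D = (\<lambda>y k. flat_exp 2 (1 - c\<^sup>2 * (norm (y - x))\<^sup>2) * (- 2 * c\<^sup>2 * ((y - x) \<bullet> k)))"
    have [measurable]: "(\<lambda>y. D y k) \<in> borel_measurable borel" for k unfolding D_def by measurable
    have D_supp: "D y k = 0" if "y \<notin> ball x R" for y k
      using that bump_diff_bounds(1)[OF c h, of "y - x"] by (simp add: D_def R_def dist_norm norm_minus_commute)
    have D_bd: "\<bar>D y k\<bar> \<le> 2 * (2 * c\<^sup>2 * (R * norm k))" for y k
    proof (cases "y \<in> ball x R")
      case True
      then have "\<bar>(y - x) \<bullet> k\<bar> \<le> R * norm k"
        using Cauchy_Schwarz_ineq2[of "y - x" k] mult_right_mono[of "norm (y - x)" R "norm k"]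
        by (simp add: dist_norm norm_minus_commute)
      then show ?thesis unfolding D_def abs_mult
        using abs_flat_exp_bound[of 2 "1 - c\<^sup>2 * (norm (y - x))\<^sup>2"]
        by (intro mult_mono) (auto simp: fact_numeral)
    next
      case False
      then show ?thesis using R by (simp add: D_supp)
    qed
    have D_int: "integrable lborel (\<lambda>y. D y k *\<^sub>R f y)" for k
      by (rule loc_integrable_bounded_mult(1)[OF f _ D_bd D_supp]) measurable
    have gb_int: "integrable lborel (\<lambda>y. bump c x y *\<^sub>R g y)" by (rule integrable_bump_mult[OF g c])
    have basis: "(\<integral>y. D y b *\<^sub>R f y \<partial>lborel) = - ((\<integral>y. bump c x y *\<^sub>R g y \<partial>lborel) \<bullet> b)" if b: "b \<in> Basis" for b
    proof -
      have "(\<integral>y. f y * partial_deriv b (bump c x) y \<partial>lborel) = - (\<integral>y. (g y \<bullet> b) * bump c x y \<partial>lborel)"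
        using fg b c by (auto simp: bump_weak_gradient_def)
      moreover have "(\<integral>y. (g y \<bullet> b) * bump c x y \<partial>lborel) = (\<integral>y. bump c x y *\<^sub>R g y \<partial>lborel) \<bullet> b"
        using integral_inner_left[of b lborel "\<lambda>y. bump c x y *\<^sub>R g y"] gb_int by (simp add: mult.commute)
      ultimately show ?thesis by (simp add: bump_partial_deriv D_def mult.commute)
    qed
    \<comment> \<open>The weak gradient is tested in basis directions only, so a general direction
      \<open>h\<close> is expanded.\<close>
    have D_sum: "D y h = (\<Sum>b\<in>Basis. (h \<bullet> b) * D y b)" for y
    proof -
      have "(y - x) \<bullet> h = (\<Sum>b\<in>Basis. ((y - x) \<bullet> b) * (h \<bullet> b))" by (rule euclidean_inner)
      then show ?thesis
        unfolding D_def by (simp only: sum_distrib_left) (intro sum.cong refl, simp only: mult_ac)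
    qed
    have "(\<integral>y. D y h *\<^sub>R f y \<partial>lborel) = (\<integral>y. (\<Sum>b\<in>Basis. (h \<bullet> b) * (D y b *\<^sub>R f y)) \<partial>lborel)"
      by (simp add: D_sum sum_distrib_right mult.assoc)
    also have "\<dots> = (\<Sum>b\<in>Basis. (h \<bullet> b) * (\<integral>y. D y b *\<^sub>R f y \<partial>lborel))"
      using D_int by (subst Bochner_Integration.integral_sum) auto
    also have "\<dots> = - (\<Sum>b\<in>Basis. ((\<integral>y. bump c x y *\<^sub>R g y \<partial>lborel) \<bullet> b) * (h \<bullet> b))"
      unfolding sum_negf[symmetric] by (intro sum.cong refl) (simp only: basis, simp)
    also have "\<dots> = - ((\<integral>y. bump c x y *\<^sub>R g y \<partial>lborel) \<bullet> h)"
      using euclidean_inner[of "\<integral>y. bump c x y *\<^sub>R g y \<partial>lborel" h] by simp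
    finally have D_eq: "(\<integral>y. D y h *\<^sub>R f y \<partial>lborel) = - ((\<integral>y. bump c x y *\<^sub>R g y \<partial>lborel) \<bullet> h)" .
    \<comment> \<open>\<open>D\<close> enters with a plus sign because moving the centre by
      \<open>h\<close> moves the argument by \<open>- h\<close>.\<close>
    define w where "w = (\<lambda>y. bump c (x + h) y - bump c x y + D y h)"
    have w: "w y = bump c h (y - x) - bump c 0 (y - x) - flat_exp 2 (1 - c\<^sup>2 * (norm (y - x))\<^sup>2) * (2 * c\<^sup>2 * ((y - x) \<bullet> h))" for y
      using bump_shift[of c x h y] bump_shift[of c x 0 y] by (simp add: w_def D_def)
    have [measurable]: "w \<in> borel_measurable borel" unfolding w_def by measurable
    have bd: "\<bar>w y\<bar> \<le> K * (norm h)\<^sup>2" for y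
      unfolding w K_def R_def by (rule bump_diff_bounds(3)[OF c h])
    have supp: "w y = 0" if "y \<notin> ball x R" for y
      using that bump_diff_bounds(1)[OF c h, of "y - x"] by (simp add: w R_def dist_norm norm_minus_commute)
    have "(\<integral>y. w y *\<^sub>R f y \<partial>lborel)
        = (\<integral>y. bump c (x + h) y *\<^sub>R f y \<partial>lborel) - (\<integral>y. bump c x y *\<^sub>R f y \<partial>lborel) + (\<integral>y. D y h *\<^sub>R f y \<partial>lborel)"
      unfolding w_def scaleR_left_diff_distrib scaleR_left_distrib
      using integrable_bump_mult[OF f c] D_int
      by (subst Bochner_Integration.integral_add Bochner_Integration.integral_diff;
          auto intro!: Bochner_Integration.integrable_diff)+
    then have "mollify c f (x + h) - mollify c f x - mollify c g x \<bullet> h = (\<integral>y. w y *\<^sub>R f y \<partial>lborel) / Z"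
      unfolding D_eq mollify_eq Z_def[symmetric]
      by (simp only: real_scaleR_def inner_scaleR_left divide_inverse) (simp add: left_diff_distrib right_diff_distrib mult.commute)
    then have "ennreal \<bar>mollify c f (x + h) - mollify c f x - mollify c g x \<bullet> h\<bar>
        = ennreal (1 / Z) * ennreal (norm (\<integral>y. w y *\<^sub>R f y \<partial>lborel))"
      using Z by (simp add: ennreal_mult[symmetric])
    also have "\<dots> \<le> ennreal (1 / Z) * (ennreal (K * (norm h)\<^sup>2) * (\<integral>\<^sup>+y\<in>ball x R. ennreal (norm (f y)) \<partial>lborel))"
      by (intro mult_left_mono loc_integrable_bounded_mult(2)[OF f _ bd supp]) auto
    also have "\<dots> = ennreal (K / Z * (norm h)\<^sup>2) * (\<integral>\<^sup>+y\<in>ball x R. ennreal \<bar>f y\<bar> \<partial>lborel)"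
      using Z K by (simp add: mult.assoc[symmetric] ennreal_mult[symmetric])
    finally show "ennreal \<bar>mollify c f (x + h) - mollify c f x - mollify c g x \<bullet> h\<bar> \<le> \<dots>" .
  qed
qed

text \<open>The derivative is read off from the Taylor bound, whose constant at \<open>x\<close> is
  a finite local integral; continuity of the gradient comes from the Lipschitz bound.\<close>

lemma C1_grad_mollify:
  assumes fg: "bump_weak_gradient f g" and c: "0 < c"
  shows "C1_grad (mollify c f) (mollify c g)"
  unfolding C1_grad_def
proof (intro conjI allI)
  have f: "loc_integrable f" and g: "loc_integrable g" using fg by (auto simp: bump_weak_gradient_def)
  have unit: "\<forall>\<^sub>F h in at (0::'a). norm h \<le> 1"
    unfolding eventually_at by (intro exI[of _ 1]) auto
  have "isCont (mollify c g) x" for x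
  proof -
    obtain L R where L: "0 \<le> L" and le: "\<And>h. norm h \<le> 1 \<Longrightarrow>
      ennreal (norm (mollify c g (x + h) - mollify c g x)) \<le> ennreal (L * norm h) * (\<integral>\<^sup>+y\<in>ball x R. ennreal (norm (g y)) \<partial>lborel)"
      using mollify_diff_bound[OF g c] by blast
    obtain B where B: "0 \<le> B" "(\<integral>\<^sup>+y\<in>ball x R. ennreal (norm (g y)) \<partial>lborel) = ennreal B"
      using loc_integrableD(2)[OF g, of x R] by (auto simp: less_top elim!: ennreal_cases)
    have "((\<lambda>h. mollify c g (x + h) - mollify c g x) \<longlongrightarrow> 0) (at 0)"
    proof (rule Lim_null_comparison)
      show "\<forall>\<^sub>F h in at 0. norm (mollify c g (x + h) - mollify c g x) \<le> L * norm h * B"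
        using unit
      proof eventually_elim
        case (elim h)
        from le[OF elim] L B show ?case by (simp add: ennreal_mult[symmetric])
      qed
      show "((\<lambda>h. L * norm h * B) \<longlongrightarrow> 0) (at 0)" by (auto intro!: tendsto_eq_intros)
    qed
    then show ?thesis unfolding isCont_iff by (simp add: LIM_zero_iff)
  qed
  then show "continuous_on UNIV (mollify c g)" by (simp add: continuous_on_eq_continuous_within)
  fix x
  obtain L R where L: "0 \<le> L" and le: "\<And>h. norm h \<le> 1 \<Longrightarrow>
    ennreal \<bar>mollify c f (x + h) - mollify c f x - mollify c g x \<bullet> h\<bar>
      \<le> ennreal (L * (norm h)\<^sup>2) * (\<integral>\<^sup>+y\<in>ball x R. ennreal \<bar>f y\<bar> \<partial>lborel)"
    using mollify_Taylor[OF fg c] by blast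
  obtain B where B: "0 \<le> B" "(\<integral>\<^sup>+y\<in>ball x R. ennreal \<bar>f y\<bar> \<partial>lborel) = ennreal B"
    using loc_integrableD(2)[OF f, of x R] by (auto simp: less_top elim!: ennreal_cases)
  show "(mollify c f has_derivative (\<lambda>h. mollify c g x \<bullet> h)) (at x)"
    unfolding has_derivative_at
  proof
    show "bounded_linear (\<lambda>h. mollify c g x \<bullet> h)" by (rule bounded_linear_inner_right)
    show "((\<lambda>h. norm (mollify c f (x + h) - mollify c f x - mollify c g x \<bullet> h) / norm h) \<longlongrightarrow> 0) (at 0)"
    proof (rule Lim_null_comparison)
      show "\<forall>\<^sub>F h in at 0. norm (norm (mollify c f (x + h) - mollify c f x - mollify c g x \<bullet> h) / norm h) \<le> L * norm h * B"
        using unit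
      proof eventually_elim
        case (elim h)
        from le[OF elim] L B have "\<bar>mollify c f (x + h) - mollify c f x - mollify c g x \<bullet> h\<bar> \<le> L * (norm h)\<^sup>2 * B"
          by (simp add: ennreal_mult[symmetric])
        then show ?case using L B by (cases "h = 0") (auto simp: divide_simps power2_eq_square mult_ac)
      qed
      show "((\<lambda>h. L * norm h * B) \<longlongrightarrow> 0) (at 0)" by (auto intro!: tendsto_eq_intros)
    qed
  qed
qed

section \<open>Continuity of translations and convergence of mollifications\<close>

text \<open>\<open>A\<close> is squeezed between a compact \<open>K\<close> and an open
  \<open>U\<close>. If \<open>h\<close> is too short to lead from \<open>K\<close> out of
  \<open>U\<close>, the indicators at \<open>x\<close> and \<open>x + h\<close> differ only when one
  of the two points lies in \<open>U - K\<close>.\<close>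

lemma indicator_translation_continuous:
  fixes A :: "'a::euclidean_space set" and c :: "'b::euclidean_space"
  assumes A[measurable]: "A \<in> sets borel" and fin: "emeasure lborel A < \<infinity>" and e: "0 < e"
  shows "\<exists>d>0. \<forall>h. norm h < d \<longrightarrow>
    (\<integral>\<^sup>+x. ennreal (norm (indicator A (x + h) *\<^sub>R c - indicator A x *\<^sub>R c)) \<partial>lborel) \<le> ennreal e"
proof -
  \<comment> \<open>The set \<open>D\<close> below has measure at most \<open>2 * e'\<close> and
    occurs twice, hence the 4; the added 1 keeps the denominator positive for
    \<open>c = 0\<close>.\<close>
  define e' where "e' = e / (4 * (norm c + 1))"
  have e': "0 < e'" using e by (auto simp: e'_def add_nonneg_pos)
  obtain U where U: "open U" "A \<subseteq> U" "emeasure lebesgue (U - A) < ennreal e'"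
    using sets_lebesgue_outer_open[of A e'] e' by (metis A sets_completionI_sets sets_lborel)
  obtain K where K: "compact K" "K \<subseteq> A" "emeasure lborel (A - K) < ennreal e'"
  proof -
    \<comment> \<open>Restriction to \<open>A\<close> makes the measure finite, as inner regularity
      by compact sets requires.\<close>
    let ?M = "density lborel (indicator A :: 'a \<Rightarrow> ennreal)"
    have M: "emeasure ?M B = emeasure lborel (A \<inter> B)" if "B \<in> sets borel" for B
      using that by (simp add: emeasure_density indicator_inter_arith[symmetric])
    have "emeasure ?M A = (SUP K\<in>{K. K \<subseteq> A \<and> compact K}. emeasure ?M K)"
      using fin by (intro inner_regular) (auto simp: M)
    show ?thesis
    proof (cases "emeasure lborel A = 0")
      case True
      then show ?thesis using that[of "{}"] e' by simp
    next
      case False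
      then have "emeasure lborel A - ennreal e' < emeasure lborel A"
        using fin e' by (intro ennreal_between) (auto simp: zero_less_iff_neq_zero)
      also have "emeasure lborel A = (SUP K\<in>{K. K \<subseteq> A \<and> compact K}. emeasure ?M K)"
        using \<open>emeasure ?M A = _\<close> by (simp add: M)
      finally obtain K where K: "K \<subseteq> A" "compact K" "emeasure lborel A - ennreal e' < emeasure ?M K"
        by (auto simp: less_SUP_iff)
      have Kb: "K \<in> sets borel" using K(2) by (simp add: compact_imp_closed)
      have MK: "emeasure ?M K = emeasure lborel K" using K Kb by (simp add: M Int_absorb1)
      have fK: "emeasure lborel K \<noteq> \<infinity>" using emeasure_compact_finite[OF K(2)] by simp
      have "emeasure lborel (A - K) = emeasure lborel A - emeasure lborel K"
        using K Kb fK by (intro emeasure_Diff) auto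
      also have "\<dots> < ennreal e'"
      proof -
        obtain a b where ab: "0 \<le> a" "emeasure lborel A = ennreal a" "0 \<le> b" "emeasure lborel K = ennreal b"
          using fin fK by (cases "emeasure lborel A"; cases "emeasure lborel K") auto
        have "\<not> b \<le> a - e'"
        proof
          assume "b \<le> a - e'"
          then have "ennreal b \<le> ennreal a - ennreal e'" using e' by (simp add: ennreal_minus ennreal_leI)
          then show False using K(3) by (simp add: MK ab)
        qed
        then show ?thesis using ab e' by (simp add: ennreal_minus ennreal_lessI)
      qed
      finally show ?thesis using that K by blast
    qed
  qed
  define D where "D = U - K"
  have UK[measurable]: "U \<in> sets borel" "K \<in> sets borel" using U(1) K(1) by (simp_all add: compact_imp_closed)
  have [measurable]: "D \<in> sets borel" unfolding D_def by measurable
  have D: "emeasure lborel D \<le> ennreal (2 * e')"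
  proof -
    have UA: "emeasure lborel (U - A) < ennreal e'" using U by simp
    have "emeasure lborel D \<le> emeasure lborel ((U - A) \<union> (A - K))"
      by (intro emeasure_mono) (auto simp: D_def)
    also have "\<dots> \<le> emeasure lborel (U - A) + emeasure lborel (A - K)"
      by (intro emeasure_subadditive) auto
    also have "\<dots> \<le> ennreal e' + ennreal e'"
      using UA K(3) by (intro add_mono) auto
    also have "\<dots> = ennreal (2 * e')" using e' by (simp add: ennreal_plus[symmetric] del: ennreal_plus)
    finally show ?thesis .
  qed
  obtain d where d: "0 < d" "(\<Union>x\<in>K. ball x d) \<subseteq> U"
    using compact_subset_open_imp_ball_epsilon_subset[OF K(1) U(1)] K(2) U(2) by blast
  show ?thesis
  proof (intro exI[of _ d] conjI allI impI d(1))
    fix h :: 'a assume h: "norm h < d"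
    have pt: "ennreal (norm (indicator A (x + h) *\<^sub>R c - indicator A x *\<^sub>R c))
        \<le> ennreal (norm c) * (indicator D x + indicator D (x + h))" for x
    proof -
      have "x + h \<in> U" if "x \<in> K"
      proof -
        have "x + h \<in> ball x d" using h by (simp add: dist_norm)
        then show ?thesis using that d(2) by blast
      qed
      moreover have "x \<in> U" if "x + h \<in> K"
      proof -
        have "x \<in> ball (x + h) d" using h by (simp add: dist_norm)
        then show ?thesis using that d(2) by blast
      qed
      moreover have "ennreal (norm c) * 1 \<le> ennreal (norm c) * 2" by (intro mult_left_mono) auto
      ultimately show ?thesis
        using U(2) K(2)
        by (cases "x \<in> A"; cases "x + h \<in> A"; cases "x \<in> D"; cases "x + h \<in> D") (auto simp: D_def)
    qed
    have "(\<integral>\<^sup>+x. ennreal (norm (indicator A (x + h) *\<^sub>R c - indicator A x *\<^sub>R c)) \<partial>lborel)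
      \<le> (\<integral>\<^sup>+x. ennreal (norm c) * (indicator D x + indicator D (x + h)) \<partial>lborel)"
      by (intro nn_integral_mono pt)
    also have "\<dots> = ennreal (norm c) * (emeasure lborel D + (\<integral>\<^sup>+x. indicator D (x + h) \<partial>lborel))"
      by (simp add: nn_integral_cmult nn_integral_add)
    also have "(\<integral>\<^sup>+x. indicator D (x + h) \<partial>lborel) = emeasure lborel D"
      using nn_integral_lborel_translate[of "indicator D" h] by simp
    also have "ennreal (norm c) * (emeasure lborel D + emeasure lborel D) \<le> ennreal (norm c) * (ennreal (2 * e') + ennreal (2 * e'))"
      by (intro mult_left_mono add_mono D) auto
    also have "\<dots> = ennreal (norm c * (4 * e'))"
      using e' by (simp add: ennreal_plus[symmetric] ennreal_mult[symmetric] del: ennreal_plus)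
    also have "\<dots> \<le> ennreal e"
    proof (rule ennreal_leI)
      have "0 < norm c + 1" by (simp add: add_nonneg_pos)
      then have "e' * 4 = e / (norm c + 1)" unfolding e'_def by (simp add: divide_simps)
      then have "norm c * (4 * e') = e * (norm c / (norm c + 1))"
        by (simp add: mult.commute)
      also have "\<dots> \<le> e * 1" using e by (intro mult_left_mono) (auto simp: divide_simps add_nonneg_pos)
      finally show "norm c * (4 * e') \<le> e" by simp
    qed
    finally show "(\<integral>\<^sup>+x. ennreal (norm (indicator A (x + h) *\<^sub>R c - indicator A x *\<^sub>R c)) \<partial>lborel) \<le> ennreal e" .
  qed
qed

lemma ennreal_norm_diff_le3:
  fixes a b c d :: "'b::real_normed_vector"
  shows "ennreal (norm (a - d)) \<le> ennreal (norm (a - b)) + ennreal (norm (b - c)) + ennreal (norm (d - c))"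
proof -
  have "norm (a - d) \<le> norm (a - b) + norm (b - c) + norm (d - c)"
    using norm_triangle_ineq[of "a - b" "b - c"] norm_triangle_ineq[of "a - c" "c - d"] by (simp add: norm_minus_commute)
  then show ?thesis by (simp add: ennreal_plus[symmetric] ennreal_leI del: ennreal_plus)
qed

text \<open>Induction over integrable functions, starting from indicators. In the limit step the
  errors at \<open>x + h\<close> and at \<open>x\<close> have equal integrals by translation
  invariance.\<close>

lemma L1_translation_continuous:
  fixes f :: "'a::euclidean_space \<Rightarrow> 'b::euclidean_space"
  assumes "integrable lborel f"
  shows "\<forall>e>0. \<exists>d>0. \<forall>h. norm h < d \<longrightarrow>
    (\<integral>\<^sup>+x. ennreal (norm (f (x + h) - f x)) \<partial>lborel) \<le> ennreal e"
  using assms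
proof (induction f rule: integrable_induct)
  case (base A c)
  then show ?case using indicator_translation_continuous[of A _ c] by auto
next
  case (add f g)
  note [measurable] = borel_measurable_integrable[OF add.hyps(1)] borel_measurable_integrable[OF add.hyps(2)]
  show ?case
  proof (intro allI impI)
    fix e :: real assume e: "0 < e"
    obtain d1 where d1: "0 < d1" "\<And>h. norm h < d1 \<Longrightarrow> (\<integral>\<^sup>+x. ennreal (norm (f (x + h) - f x)) \<partial>lborel) \<le> ennreal (e / 2)"
      using add.IH(1) e by (metis half_gt_zero_iff)
    obtain d2 where d2: "0 < d2" "\<And>h. norm h < d2 \<Longrightarrow> (\<integral>\<^sup>+x. ennreal (norm (g (x + h) - g x)) \<partial>lborel) \<le> ennreal (e / 2)"
      using add.IH(2) e by (metis half_gt_zero_iff)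
    show "\<exists>d>0. \<forall>h. norm h < d \<longrightarrow> (\<integral>\<^sup>+x. ennreal (norm (f (x + h) + g (x + h) - (f x + g x))) \<partial>lborel) \<le> ennreal e"
    proof (intro exI[of _ "min d1 d2"] conjI allI impI)
      fix h :: 'a assume h: "norm h < min d1 d2"
      have "(\<integral>\<^sup>+x. ennreal (norm (f (x + h) + g (x + h) - (f x + g x))) \<partial>lborel)
        \<le> (\<integral>\<^sup>+x. ennreal (norm (f (x + h) - f x)) + ennreal (norm (g (x + h) - g x)) \<partial>lborel)"
      proof (rule nn_integral_mono)
        fix x
        have "norm (f (x + h) + g (x + h) - (f x + g x)) \<le> norm (f (x + h) - f x) + norm (g (x + h) - g x)"
          by (metis add_diff_add norm_triangle_ineq)
        then show "ennreal (norm (f (x + h) + g (x + h) - (f x + g x))) \<le> ennreal (norm (f (x + h) - f x)) + ennreal (norm (g (x + h) - g x))"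
          by (simp add: ennreal_plus[symmetric] ennreal_leI del: ennreal_plus)
      qed
      also have "\<dots> = (\<integral>\<^sup>+x. ennreal (norm (f (x + h) - f x)) \<partial>lborel) + (\<integral>\<^sup>+x. ennreal (norm (g (x + h) - g x)) \<partial>lborel)"
        by (rule nn_integral_add) measurable
      also have "\<dots> \<le> ennreal (e / 2) + ennreal (e / 2)"
        using d1 d2 h by (intro add_mono) auto
      also have "\<dots> = ennreal e" using e by (simp add: ennreal_plus[symmetric] del: ennreal_plus)
      finally show "(\<integral>\<^sup>+x. ennreal (norm (f (x + h) + g (x + h) - (f x + g x))) \<partial>lborel) \<le> ennreal e" .
    qed (use d1 d2 in auto)
  qed
next
  case (lim f s)
  note [measurable] = borel_measurable_integrable[OF lim.hyps(1)] borel_measurable_integrable[OF lim.hyps(4)]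
  show ?case
  proof (intro allI impI)
    fix e :: real assume e: "0 < e"
    have "(\<lambda>i. \<integral>\<^sup>+x. ennreal (norm (f x - s i x)) \<partial>lborel) \<longlonglongrightarrow> 0"
      using lim.hyps by (intro nn_integral_dominated_convergence_norm[where w="\<lambda>x. 2 * norm (f x)"])
        (auto simp: integrable_iff_bounded ennreal_mult nn_integral_cmult ennreal_mult_less_top)
    then have "\<forall>\<^sub>F i in sequentially. (\<integral>\<^sup>+x. ennreal (norm (f x - s i x)) \<partial>lborel) < ennreal (e / 3)"
      using e by (intro order_tendstoD) auto
    then obtain i where i: "(\<integral>\<^sup>+x. ennreal (norm (f x - s i x)) \<partial>lborel) < ennreal (e / 3)"
      by (auto dest: eventually_happens)
    have "0 < e / 3" using e by simp
    then obtain d where d: "0 < d" "\<And>h. norm h < d \<Longrightarrow> (\<integral>\<^sup>+x. ennreal (norm (s i (x + h) - s i x)) \<partial>lborel) \<le> ennreal (e / 3)"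
      using lim.IH(1)[of i] by blast
    show "\<exists>d>0. \<forall>h. norm h < d \<longrightarrow> (\<integral>\<^sup>+x. ennreal (norm (f (x + h) - f x)) \<partial>lborel) \<le> ennreal e"
    proof (intro exI[of _ d] conjI allI impI d(1))
      fix h :: 'a assume h: "norm h < d"
      have "(\<integral>\<^sup>+x. ennreal (norm (f (x + h) - f x)) \<partial>lborel)
        \<le> (\<integral>\<^sup>+x. ennreal (norm (f (x + h) - s i (x + h))) + ennreal (norm (s i (x + h) - s i x)) + ennreal (norm (f x - s i x)) \<partial>lborel)"
        by (intro nn_integral_mono ennreal_norm_diff_le3)
      also have "\<dots> = (\<integral>\<^sup>+x. ennreal (norm (f (x + h) - s i (x + h))) \<partial>lborel) + (\<integral>\<^sup>+x. ennreal (norm (s i (x + h) - s i x)) \<partial>lborel)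
          + (\<integral>\<^sup>+x. ennreal (norm (f x - s i x)) \<partial>lborel)"
        by (subst nn_integral_add, measurable, subst nn_integral_add, measurable)
      also have "(\<integral>\<^sup>+x. ennreal (norm (f (x + h) - s i (x + h))) \<partial>lborel) = (\<integral>\<^sup>+x. ennreal (norm (f x - s i x)) \<partial>lborel)"
        using nn_integral_lborel_translate[of "\<lambda>x. ennreal (norm (f x - s i x))" h] by simp
      also have "(\<integral>\<^sup>+x. ennreal (norm (f x - s i x)) \<partial>lborel) + (\<integral>\<^sup>+x. ennreal (norm (s i (x + h) - s i x)) \<partial>lborel)
          + (\<integral>\<^sup>+x. ennreal (norm (f x - s i x)) \<partial>lborel) \<le> ennreal (e / 3) + ennreal (e / 3) + ennreal (e / 3)"
        using i d(2)[OF h] by (intro add_mono) auto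
      also have "\<dots> = ennreal e" using e by (simp add: ennreal_plus[symmetric] del: ennreal_plus)
      finally show "(\<integral>\<^sup>+x. ennreal (norm (f (x + h) - f x)) \<partial>lborel) \<le> ennreal e" .
    qed
  qed
qed

text \<open>Truncation in value and in space approximates \<open>u\<close> in L^p by dominated
  convergence. For the bounded truncation the p-th power of a difference is at most \<open>m\<close>
  times the difference, which reduces the claim to L^1.\<close>

lemma Lp_translation_continuous:
  fixes u :: "'a::euclidean_space \<Rightarrow> 'b::euclidean_space"
  assumes [measurable]: "u \<in> borel_measurable borel" and p: "1 \<le> p"
    and fin: "(\<integral>\<^sup>+x. ennreal (norm (u x) powr p) \<partial>lborel) < top" and e: "0 < e"
  shows "\<exists>d>0. \<forall>h. norm h < d \<longrightarrow>
    (\<integral>\<^sup>+x. ennreal (norm (u (x + h) - u x) powr p) \<partial>lborel) \<le> ennreal e"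
proof -
  define uk where "uk = (\<lambda>(k::nat) x. (if norm (u x) \<le> k \<and> norm x \<le> k then 1 else 0) *\<^sub>R u x)"
  have [measurable]: "uk k \<in> borel_measurable borel" for k unfolding uk_def by measurable
  have "(\<lambda>k. \<integral>\<^sup>+x. ennreal (norm (0 - norm (u x - uk k x) powr p)) \<partial>lborel) \<longlonglongrightarrow> 0"
  proof (rule nn_integral_dominated_convergence_norm[where w="\<lambda>x. norm (u x) powr p"])
    show "AE x in lborel. (\<lambda>k. norm (u x - uk k x) powr p) \<longlonglongrightarrow> 0"
    proof (rule AE_I2)
      fix x
      obtain n :: nat where n: "max (norm (u x)) (norm x) \<le> n" using real_arch_simple by blast
      have "\<forall>\<^sub>F k in sequentially. norm (u x - uk k x) powr p = 0"
        using eventually_ge_at_top[of n]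
      proof eventually_elim
        case (elim k)
        then have "norm (u x) \<le> k" "norm x \<le> k" using n by (auto intro: order_trans)
        then show ?case by (simp add: uk_def)
      qed
      then show "(\<lambda>k. norm (u x - uk k x) powr p) \<longlonglongrightarrow> 0" by (rule tendsto_eventually)
    qed
    show "AE x in lborel. norm (norm (u x - uk j x) powr p) \<le> norm (u x) powr p" for j
      using p by (intro AE_I2) (auto simp: uk_def)
  qed (use fin in auto)
  \<comment> \<open>Three errors, each with the factor \<open>4 powr p\<close> that two applications
    of the two-term inequality produce.\<close>
  moreover define e' where "e' = e / (3 * 4 powr p)"
  have e': "0 < e'" using e by (simp add: e'_def)
  ultimately have "\<forall>\<^sub>F k in sequentially. (\<integral>\<^sup>+x. ennreal (norm (u x - uk k x) powr p) \<partial>lborel) < ennreal e'"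
    using order_tendstoD(2)[of _ 0 sequentially "ennreal e'"] by simp
  then obtain k where k: "(\<integral>\<^sup>+x. ennreal (norm (u x - uk k x) powr p) \<partial>lborel) < ennreal e'"
    by (auto dest: eventually_happens)
  have uk_le: "norm (uk k x) \<le> k" for x by (auto simp: uk_def)
  have uk_int: "integrable lborel (uk k)"
  proof (rule integrableI_bounded)
    have "(\<integral>\<^sup>+x. ennreal (norm (uk k x)) \<partial>lborel) \<le> (\<integral>\<^sup>+x. ennreal k * indicator (cball 0 k) (x::'a) \<partial>lborel)"
      by (intro nn_integral_mono) (auto simp: uk_def intro!: ennreal_leI split: split_indicator)
    also have "\<dots> < \<infinity>"
      using emeasure_compact_finite[of "cball (0::'a) k"] by (simp add: nn_integral_cmult_indicator ennreal_mult_less_top)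
    finally show "(\<integral>\<^sup>+x. ennreal (norm (uk k x)) \<partial>lborel) < \<infinity>" .
  qed measurable
  \<comment> \<open>Differences of truncations are bounded by \<open>2 * k\<close>; the added 1
    keeps \<open>m\<close> positive for \<open>k = 0\<close>.\<close>
  define m where "m = (2 * real k + 1) powr (p - 1)"
  have m: "0 < m" by (simp add: m_def add_nonneg_pos)
  have "0 < e' / m" using e' m by simp
  then obtain d where d: "0 < d" "\<And>h. norm h < d \<Longrightarrow> (\<integral>\<^sup>+x. ennreal (norm (uk k (x + h) - uk k x)) \<partial>lborel) \<le> ennreal (e' / m)"
    using L1_translation_continuous[OF uk_int] by blast
  show ?thesis
  proof (intro exI[of _ d] conjI allI impI d(1))
    fix h :: 'a assume h: "norm h < d"
    have pt: "ennreal (norm (u (x + h) - u x) powr p)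
      \<le> ennreal (4 powr p) * (ennreal (norm (u (x + h) - uk k (x + h)) powr p)
          + ennreal m * ennreal (norm (uk k (x + h) - uk k x)) + ennreal (norm (u x - uk k x) powr p))" for x
    proof -
      define a where "a = norm (u (x + h) - uk k (x + h))"
      define b where "b = norm (uk k (x + h) - uk k x)"
      define c where "c = norm (u x - uk k x)"
      have abc: "0 \<le> a" "0 \<le> b" "0 \<le> c" by (auto simp: a_def b_def c_def)
      have "norm (u (x + h) - u x) \<le> a + b + c"
        using norm_triangle_ineq[of "u (x + h) - uk k (x + h)" "uk k (x + h) - uk k x"]
          norm_triangle_ineq[of "u (x + h) - uk k x" "uk k x - u x"]
        by (simp add: a_def b_def c_def norm_minus_commute)
      then have "norm (u (x + h) - u x) powr p \<le> (a + b + c) powr p" using p by (intro powr_mono2) auto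
      also have "\<dots> \<le> 2 powr p * ((a + b) powr p + c powr p)" using abc p by (intro powr_add_le_two) auto
      also have "\<dots> \<le> 2 powr p * (2 powr p * (a powr p + b powr p) + 2 powr p * c powr p)"
      proof (intro mult_left_mono add_mono powr_add_le_two)
        have "1 \<le> (2::real) powr p" using p by (intro ge_one_powr_ge_zero) auto
        from mult_right_mono[OF this, of "c powr p"] show "c powr p \<le> 2 powr p * c powr p" by simp
      qed (use abc p in auto)
      also have "\<dots> = 4 powr p * (a powr p + b powr p + c powr p)"
        using powr_mult[of 2 2 p] by (simp add: algebra_simps)
      also have "\<dots> \<le> 4 powr p * (a powr p + m * b + c powr p)"
      proof -
        have b2: "b \<le> 2 * real k + 1"
          using norm_triangle_ineq4[of "uk k (x + h)" "uk k x"] uk_le[of x] uk_le[of "x + h"] by (simp add: b_def)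
        have "b powr p = b powr (p - 1) * b" using abc by (simp add: powr_diff)
        also have "\<dots> \<le> m * b" unfolding m_def using b2 abc p by (intro mult_right_mono powr_mono2) auto
        finally show ?thesis by (intro mult_left_mono add_mono) auto
      qed
      finally show ?thesis
        using abc m by (simp add: a_def[symmetric] b_def[symmetric] c_def[symmetric] ennreal_plus[symmetric] ennreal_mult[symmetric] ennreal_leI del: ennreal_plus)
    qed
    have "(\<integral>\<^sup>+x. ennreal (norm (u (x + h) - u x) powr p) \<partial>lborel)
      \<le> (\<integral>\<^sup>+x. ennreal (4 powr p) * (ennreal (norm (u (x + h) - uk k (x + h)) powr p)
          + ennreal m * ennreal (norm (uk k (x + h) - uk k x)) + ennreal (norm (u x - uk k x) powr p)) \<partial>lborel)"
      by (intro nn_integral_mono pt)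
    also have "\<dots> = ennreal (4 powr p) * ((\<integral>\<^sup>+x. ennreal (norm (u (x + h) - uk k (x + h)) powr p) \<partial>lborel)
          + ennreal m * (\<integral>\<^sup>+x. ennreal (norm (uk k (x + h) - uk k x)) \<partial>lborel) + (\<integral>\<^sup>+x. ennreal (norm (u x - uk k x) powr p) \<partial>lborel))"
      by (subst nn_integral_cmult, measurable, subst nn_integral_add, measurable, subst nn_integral_add, measurable,
          subst nn_integral_cmult, measurable)
    also have "(\<integral>\<^sup>+x. ennreal (norm (u (x + h) - uk k (x + h)) powr p) \<partial>lborel) = (\<integral>\<^sup>+x. ennreal (norm (u x - uk k x) powr p) \<partial>lborel)"
      using nn_integral_lborel_translate[of "\<lambda>x. ennreal (norm (u x - uk k x) powr p)" h] by simp
    also have "ennreal (4 powr p) * ((\<integral>\<^sup>+x. ennreal (norm (u x - uk k x) powr p) \<partial>lborel)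
          + ennreal m * (\<integral>\<^sup>+x. ennreal (norm (uk k (x + h) - uk k x)) \<partial>lborel) + (\<integral>\<^sup>+x. ennreal (norm (u x - uk k x) powr p) \<partial>lborel))
      \<le> ennreal (4 powr p) * (ennreal e' + ennreal m * ennreal (e' / m) + ennreal e')"
      using k d(2)[OF h] by (intro mult_left_mono add_mono) auto
    also have "\<dots> = ennreal e"
    proof -
      have "ennreal m * ennreal (e' / m) = ennreal e'" using e' m by (simp add: ennreal_mult[symmetric])
      then have "ennreal (4 powr p) * (ennreal e' + ennreal m * ennreal (e' / m) + ennreal e') = ennreal (4 powr p * (e' + e' + e'))"
        using e' by (simp only:) (subst ennreal_mult, simp, simp, simp only: ennreal_plus add_nonneg_nonneg less_imp_le)
      also have "4 powr p * (e' + e' + e') = e" by (simp add: e'_def)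
      finally show ?thesis .
    qed
    finally show "(\<integral>\<^sup>+x. ennreal (norm (u (x + h) - u x) powr p) \<partial>lborel) \<le> ennreal e" .
  qed
qed

text \<open>Rests on \<open>t \<le> 1 + t powr p\<close> for nonnegative \<open>t\<close> and on the
  finite volume of balls.\<close>

lemma loc_integrable_Lp:
  fixes u :: "'a::euclidean_space \<Rightarrow> 'b::euclidean_space"
  assumes [measurable]: "u \<in> borel_measurable borel" and p: "1 \<le> p"
    and fin: "(\<integral>\<^sup>+x. ennreal (norm (u x) powr p) \<partial>lborel) < top"
  shows "loc_integrable u"
  unfolding loc_integrable_def
proof (intro conjI allI)
  fix R
  have le: "norm (u y) \<le> 1 + norm (u y) powr p" for y
  proof (cases "norm (u y) \<le> 1")
    case False
    then have "norm (u y) powr 1 \<le> norm (u y) powr p" using p by (intro powr_mono) auto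
    then show ?thesis using False by simp
  qed (simp add: add_increasing2)
  have "(\<integral>\<^sup>+y\<in>ball 0 R. ennreal (norm (u y)) \<partial>lborel) \<le> (\<integral>\<^sup>+y. indicator (ball 0 R) y + ennreal (norm (u y) powr p) \<partial>lborel)"
  proof (rule nn_integral_mono)
    fix y
    have "ennreal (norm (u y)) \<le> 1 + ennreal (norm (u y) powr p)"
      using ennreal_leI[OF le[of y]] by simp
    then show "ennreal (norm (u y)) * indicator (ball 0 R) y \<le> indicator (ball 0 R) y + ennreal (norm (u y) powr p)"
      by (auto split: split_indicator)
  qed
  also have "\<dots> = emeasure lborel (ball (0::'a) R) + (\<integral>\<^sup>+x. ennreal (norm (u x) powr p) \<partial>lborel)"
    by (simp add: nn_integral_add)
  also have "\<dots> < top"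
    using fin emeasure_lborel_ball_pos(2)[of R "0::'a"] by (cases "0 < R") (auto simp: less_top ball_empty)
  finally show "(\<integral>\<^sup>+y\<in>ball 0 R. ennreal (norm (u y)) \<partial>lborel) < top" .
qed measurable

lemma borel_measurable_mollify [measurable]:
  assumes [measurable]: "u \<in> borel_measurable borel"
  shows "mollify c u \<in> borel_measurable borel"
  unfolding mollify_def[abs_def] bump_def by measurable

lemma nn_integral_bump:
  assumes c: "0 < c"
  shows "(\<integral>\<^sup>+h. ennreal (bump c (0::'a::euclidean_space) h / bump_mass TYPE('a) c) \<partial>lborel) = 1"
proof -
  have "integrable lborel (\<lambda>h. bump c (0::'a) h / bump_mass TYPE('a) c)"
    using integrable_bump[OF c, of "0::'a"] by simp
  then have "(\<integral>\<^sup>+h. ennreal (bump c (0::'a) h / bump_mass TYPE('a) c) \<partial>lborel)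
      = ennreal (\<integral>h. bump c (0::'a) h / bump_mass TYPE('a) c \<partial>lborel)"
    using bump_mass_pos[OF c, where 'a='a]
    by (intro nn_integral_eq_integral) (auto simp: bump_nonneg less_imp_le)
  also have "(\<integral>h. bump c (0::'a) h / bump_mass TYPE('a) c \<partial>lborel) = 1"
    using bump_mass_pos[OF c, where 'a='a] by (simp add: bump_mass_def)
  finally show ?thesis by simp
qed

text \<open>As the kernel has total mass 1, \<open>u x\<close> can be written under the same
  integral; shifting the variable then centres the kernel at 0.\<close>

lemma norm_mollify_diff_le:
  fixes u :: "'a::euclidean_space \<Rightarrow> 'b::euclidean_space"
  assumes u: "loc_integrable u" and c: "0 < c"
  shows "ennreal (norm (mollify c u x - u x))
    \<le> (\<integral>\<^sup>+h. ennreal (bump c 0 h / bump_mass TYPE('a) c) * ennreal (norm (u (x + h) - u x)) \<partial>lborel)"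
proof -
  note [measurable] = loc_integrableD(1)[OF u]
  define Z where "Z = bump_mass TYPE('a) c"
  have Z: "0 < Z" unfolding Z_def by (rule bump_mass_pos[OF c])
  have int: "integrable lborel (\<lambda>y. bump c x y *\<^sub>R u y)" "integrable lborel (\<lambda>y. bump c x y *\<^sub>R u x)"
    using integrable_bump_mult[OF u c] integrable_bump[OF c, of x] by auto
  have mass: "(\<integral>y. bump c x y \<partial>lborel) = Z"
  proof -
    have "ennreal (\<integral>y. bump c x y \<partial>lborel) = (\<integral>\<^sup>+y. ennreal (bump c 0 (y - x)) \<partial>lborel)"
      using integrable_bump[OF c, of x] bump_shift[of c x 0]
      by (subst nn_integral_eq_integral[symmetric]) (auto simp: bump_nonneg)
    also have "\<dots> = (\<integral>\<^sup>+y. ennreal (bump c (0::'a) y) \<partial>lborel)"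
      using nn_integral_lborel_translate[of "\<lambda>y. ennreal (bump c (0::'a) y)" "- x"] by simp
    also have "\<dots> = ennreal Z"
      unfolding Z_def bump_mass_def
      by (rule nn_integral_eq_integral) (auto simp: bump_nonneg integrable_bump c)
    finally show ?thesis
      using Z by (simp add: bump_nonneg)
  qed
  have "(\<integral>y. (bump c x y / Z) *\<^sub>R (u y - u x) \<partial>lborel) = (\<integral>y. bump c x y *\<^sub>R u y - bump c x y *\<^sub>R u x \<partial>lborel) /\<^sub>R Z"
    by (subst integral_scaleR_right[symmetric]) (simp add: divide_inverse mult.commute scaleR_right_diff_distrib)
  also have "\<dots> = mollify c u x - u x"
    using int Z by (simp add: mollify_eq Z_def[symmetric] scaleR_right_diff_distrib mass integrable_bump[OF c])
  finally have "ennreal (norm (mollify c u x - u x)) = ennreal (norm (\<integral>y. (bump c x y / Z) *\<^sub>R (u y - u x) \<partial>lborel))"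
    by simp
  also have "\<dots> \<le> (\<integral>\<^sup>+y. ennreal (norm ((bump c x y / Z) *\<^sub>R (u y - u x))) \<partial>lborel)"
  proof (rule integral_norm_bound_ennreal)
    have "integrable lborel (\<lambda>y. inverse Z *\<^sub>R (bump c x y *\<^sub>R u y - bump c x y *\<^sub>R u x))"
      by (intro integrable_scaleR_right Bochner_Integration.integrable_diff int)
    then show "integrable lborel (\<lambda>y. (bump c x y / Z) *\<^sub>R (u y - u x))"
      by (simp add: divide_inverse mult.commute scaleR_right_diff_distrib)
  qed
  also have "\<dots> = (\<integral>\<^sup>+y. ennreal (bump c 0 (y - x) / Z) * ennreal (norm (u (x + (y - x)) - u x)) \<partial>lborel)"
    using Z bump_shift[of c x 0] by (intro nn_integral_cong) (simp add: bump_nonneg ennreal_mult[symmetric])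
  also have "\<dots> = (\<integral>\<^sup>+h. ennreal (bump c 0 h / Z) * ennreal (norm (u (x + h) - u x)) \<partial>lborel)"
    using nn_integral_lborel_translate[of "\<lambda>h. ennreal (bump c 0 h / Z) * ennreal (norm (u (x + h) - u x))" "- x"] by simp
  finally show ?thesis by (simp add: Z_def)
qed

text \<open>By Jensen's inequality for the kernel and Tonelli's theorem, the error is at most an
  average of translation errors over shifts shorter than \<open>1 / c\<close>.\<close>

lemma mollify_Lp_bound:
  fixes u :: "'a::euclidean_space \<Rightarrow> 'b::euclidean_space"
  assumes u: "loc_integrable u" and c: "0 < c" and p: "1 \<le> p"
    and e: "\<And>h. norm h < 1 / c \<Longrightarrow> (\<integral>\<^sup>+x. ennreal (norm (u (x + h) - u x) powr p) \<partial>lborel) \<le> e"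
  shows "(\<integral>\<^sup>+x. ennreal (norm (mollify c u x - u x) powr p) \<partial>lborel) \<le> e"
proof -
  note [measurable] = loc_integrableD(1)[OF u]
  define k where "k = (\<lambda>h::'a. ennreal (bump c 0 h / bump_mass TYPE('a) c))"
  have [measurable]: "k \<in> borel_measurable borel" unfolding k_def by measurable
  have "(\<integral>\<^sup>+x. ennreal (norm (mollify c u x - u x) powr p) \<partial>lborel)
    \<le> (\<integral>\<^sup>+x. (\<integral>\<^sup>+h. k h * ennreal (norm (u (x + h) - u x) powr p) \<partial>lborel) \<partial>lborel)"
  proof (rule nn_integral_mono)
    fix x
    have "ennreal (norm (mollify c u x - u x) powr p) = epowr (ennreal (norm (mollify c u x - u x))) p"
      by (simp add: epowr_ennreal)
    also have "\<dots> \<le> epowr (\<integral>\<^sup>+h. k h * ennreal (norm (u (x + h) - u x)) \<partial>lborel) p"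
      unfolding k_def using p by (intro epowr_mono norm_mollify_diff_le u c) auto
    also have "\<dots> \<le> (\<integral>\<^sup>+h. k h * epowr (ennreal (norm (u (x + h) - u x))) p \<partial>lborel)"
      using nn_integral_bump[OF c, where 'a='a] p by (intro epowr_nn_integral_le) (auto simp: k_def)
    finally show "ennreal (norm (mollify c u x - u x) powr p) \<le> (\<integral>\<^sup>+h. k h * ennreal (norm (u (x + h) - u x) powr p) \<partial>lborel)"
      by (simp add: epowr_ennreal)
  qed
  also have "\<dots> = (\<integral>\<^sup>+h. (\<integral>\<^sup>+x. k h * ennreal (norm (u (x + h) - u x) powr p) \<partial>lborel) \<partial>lborel)"
    by (rule lborel_pair.Fubini') measurable
  also have "\<dots> = (\<integral>\<^sup>+h. k h * (\<integral>\<^sup>+x. ennreal (norm (u (x + h) - u x) powr p) \<partial>lborel) \<partial>lborel)"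
    by (intro nn_integral_cong nn_integral_cmult) measurable
  also have "\<dots> \<le> (\<integral>\<^sup>+h. k h * e \<partial>lborel)"
  proof (rule nn_integral_mono)
    fix h :: 'a
    show "k h * (\<integral>\<^sup>+x. ennreal (norm (u (x + h) - u x) powr p) \<partial>lborel) \<le> k h * e"
    proof (cases "norm h < 1 / c")
      case True
      then show ?thesis by (intro mult_left_mono e) auto
    next
      case False
      then show ?thesis using bump_eq_0[OF c, of h 0] by (simp add: k_def)
    qed
  qed
  also have "\<dots> = e"
    using nn_integral_bump[OF c, where 'a='a] by (simp add: nn_integral_multc k_def)
  finally show ?thesis .
qed

section \<open>Limits of mollifications in L^p and almost everywhere\<close>

lemma tendsto_0_ennrealI:
  fixes X :: "'c \<Rightarrow> ennreal"
  assumes "\<And>e. 0 < e \<Longrightarrow> \<forall>\<^sub>F n in F. X n \<le> ennreal e"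
  shows "(X \<longlongrightarrow> 0) F"
proof (rule order_tendstoI)
  fix a :: ennreal assume "0 < a"
  then obtain e where e: "0 < e" "ennreal e < a"
    by (cases a) (auto intro: that[of 1] that[of "enn2real a / 2"] simp: ennreal_less_iff)
  then show "\<forall>\<^sub>F n in F. X n < a" using assms[OF e(1)] by (auto elim!: eventually_mono)
qed simp

lemma mollify_tendsto_Lp:
  fixes u :: "'a::euclidean_space \<Rightarrow> 'b::euclidean_space"
  assumes u: "u \<in> borel_measurable borel" and p: "1 \<le> p"
    and fin: "(\<integral>\<^sup>+x. ennreal (norm (u x) powr p) \<partial>lborel) < top"
  shows "(\<lambda>n. \<integral>\<^sup>+x. ennreal (norm (mollify (real (Suc n)) u x - u x) powr p) \<partial>lborel) \<longlonglongrightarrow> 0"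
proof (rule tendsto_0_ennrealI)
  fix e :: real assume "0 < e"
  then obtain d where d: "0 < d" "\<And>h. norm h < d \<Longrightarrow> (\<integral>\<^sup>+x. ennreal (norm (u (x + h) - u x) powr p) \<partial>lborel) \<le> ennreal e"
    using Lp_translation_continuous[OF u p fin] by blast
  obtain n0 where n0: "1 / real (Suc n0) < d" using d(1) reals_Archimedean by (auto simp: inverse_eq_divide)
  show "\<forall>\<^sub>F n in sequentially. (\<integral>\<^sup>+x. ennreal (norm (mollify (real (Suc n)) u x - u x) powr p) \<partial>lborel) \<le> ennreal e"
    using eventually_ge_at_top[of n0]
  proof eventually_elim
    case (elim n)
    have "1 / real (Suc n) \<le> 1 / real (Suc n0)" using elim by (simp add: frac_le)
    then show ?case
      using n0 by (intro mollify_Lp_bound loc_integrable_Lp[OF u p fin] p d(2)) auto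
  qed
qed

lemma Lp_tendsto_0_AE_subseq:
  fixes w :: "nat \<Rightarrow> 'a \<Rightarrow> 'b::{banach, second_countable_topology}"
  assumes [measurable]: "\<And>n. w n \<in> borel_measurable M" and p: "0 < p"
    and lim: "(\<lambda>n. \<integral>\<^sup>+x. ennreal (norm (w n x) powr p) \<partial>M) \<longlonglongrightarrow> 0"
  shows "\<exists>r::nat \<Rightarrow> nat. strict_mono r \<and> (AE x in M. (\<lambda>n. w (r n) x) \<longlonglongrightarrow> 0)"
proof -
  have "\<forall>\<^sub>F n in sequentially. (\<integral>\<^sup>+x. ennreal (norm (w n x) powr p) \<partial>M) < 1"
    using lim by (rule order_tendstoD) simp
  then obtain n0 where n0: "\<And>n. n0 \<le> n \<Longrightarrow> (\<integral>\<^sup>+x. ennreal (norm (w n x) powr p) \<partial>M) < 1"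
    by (auto simp: eventually_sequentially)
  \<comment> \<open>Early terms may have infinite integral, so the sequence is shifted to where all
    integrals are below 1.\<close>
  define v where "v = (\<lambda>n x. norm (w (n + n0) x) powr p)"
  have v_int: "integrable M (v n)" for n
    unfolding v_def using n0[of "n + n0"] by (intro integrableI_bounded) (auto intro: order_less_trans)
  have "(\<lambda>n. \<integral>x. norm (v n x) \<partial>M) \<longlonglongrightarrow> 0"
  proof -
    have "(\<lambda>n. \<integral>\<^sup>+x. ennreal (v n x) \<partial>M) \<longlonglongrightarrow> 0"
      unfolding v_def using LIMSEQ_ignore_initial_segment[OF lim, of n0] .
    moreover have "(\<integral>\<^sup>+x. ennreal (v n x) \<partial>M) = ennreal (\<integral>x. norm (v n x) \<partial>M)" for n
      using v_int[of n] by (subst nn_integral_eq_integral) (auto simp: v_def)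
    ultimately have "(\<lambda>n. ennreal (\<integral>x. norm (v n x) \<partial>M)) \<longlonglongrightarrow> ennreal 0" by simp
    then show ?thesis by (subst (asm) tendsto_ennreal_iff) auto
  qed
  then obtain r :: "nat \<Rightarrow> nat" where r: "strict_mono r" "AE x in M. (\<lambda>n. v (r n) x) \<longlonglongrightarrow> 0"
    using tendsto_L1_AE_subseq[of M v] v_int by blast
  show ?thesis
  proof (intro exI[of _ "\<lambda>n. r n + n0"] conjI)
    show "strict_mono (\<lambda>n. r n + n0)" using r(1) by (simp add: strict_mono_def)
    show "AE x in M. (\<lambda>n. w (r n + n0) x) \<longlonglongrightarrow> 0"
      using r(2)
    proof eventually_elim
      case (elim x)
      have "(\<lambda>n. v (r n) x powr (1 / p)) \<longlonglongrightarrow> 0"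
        using p by (intro tendsto_zero_powrI[OF elim tendsto_const]) (auto simp: v_def)
      then have "(\<lambda>n. norm (w (r n + n0) x)) \<longlonglongrightarrow> 0"
        using p by (simp add: v_def powr_powr)
      then show ?case by (rule tendsto_norm_zero_cancel)
    qed
  qed
qed

text \<open>Prepares the uniqueness of weak gradients. To have convergence in L^1, \<open>k\<close>
  is cut off at radius \<open>R + 1\<close>; for kernels of radius at most 1 this leaves the
  mollification on the ball of radius \<open>R\<close> unchanged.\<close>

lemma mollify_eq_0_imp_AE:
  fixes k :: "'a::euclidean_space \<Rightarrow> 'b::euclidean_space"
  assumes k: "loc_integrable k" and zero: "\<And>c x. 0 < c \<Longrightarrow> mollify c k x = 0"
  shows "AE x in lborel. k x = 0"
proof -
  note [measurable] = loc_integrableD(1)[OF k]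
  have "AE x in lborel. x \<in> ball 0 (real R) \<longrightarrow> k x = 0" for R :: nat
  proof -
    define K where "K = (\<lambda>x. indicator (ball 0 (real R + 1)) x *\<^sub>R k x)"
    have [measurable]: "K \<in> borel_measurable borel" unfolding K_def by measurable
    have "(\<integral>\<^sup>+x. ennreal (norm (K x) powr 1) \<partial>lborel) = (\<integral>\<^sup>+x\<in>ball 0 (real R + 1). ennreal (norm (k x)) \<partial>lborel)"
      by (intro nn_integral_cong) (auto simp: K_def split: split_indicator)
    also have "\<dots> < top" by (rule loc_integrableD(2)[OF k])
    finally have fin: "(\<integral>\<^sup>+x. ennreal (norm (K x) powr 1) \<partial>lborel) < top" .
    have lim: "(\<lambda>n. \<integral>\<^sup>+x. ennreal (norm (mollify (real (Suc n)) K x - K x) powr 1) \<partial>lborel) \<longlonglongrightarrow> 0"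
      by (intro mollify_tendsto_Lp fin) auto
    have le: "(\<integral>\<^sup>+x\<in>ball 0 (real R). ennreal (norm (k x)) \<partial>lborel) \<le> (\<integral>\<^sup>+x. ennreal (norm (mollify (real (Suc n)) K x - K x) powr 1) \<partial>lborel)" for n
    proof (rule nn_integral_mono)
      fix x
      show "ennreal (norm (k x)) * indicator (ball 0 (real R)) x \<le> ennreal (norm (mollify (real (Suc n)) K x - K x) powr 1)"
      proof (cases "x \<in> ball 0 (real R)")
        case True
        have "bump (real (Suc n)) x y *\<^sub>R K y = bump (real (Suc n)) x y *\<^sub>R k y" for y
        proof (cases "y \<in> ball 0 (real R + 1)")
          case False
          have "1 \<le> norm (y - x)"
            using False True norm_triangle_sub[of y x] by simp
          moreover have "1 / real (Suc n) \<le> 1" by (simp add: divide_le_eq_1)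
          ultimately have "1 / real (Suc n) \<le> norm (y - x)" by linarith
          then have "bump (real (Suc n)) x y = 0" by (intro bump_eq_0) auto
          then show ?thesis by simp
        qed (simp add: K_def)
        then have "mollify (real (Suc n)) K x = mollify (real (Suc n)) k x"
          by (simp only: mollify_eq)
        then show ?thesis using True zero[of "real (Suc n)" x] by (simp add: K_def)
      qed simp
    qed
    have "(\<integral>\<^sup>+x\<in>ball 0 (real R). ennreal (norm (k x)) \<partial>lborel) \<le> 0"
      by (rule LIMSEQ_le_const[OF lim]) (use le in blast)
    then have "(\<integral>\<^sup>+x\<in>ball 0 (real R). ennreal (norm (k x)) \<partial>lborel) = 0" by simp
    then have "AE x in lborel. ennreal (norm (k x)) * indicator (ball 0 (real R)) x = 0"
      by (subst (asm) nn_integral_0_iff_AE) auto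
    then show ?thesis by eventually_elim (auto split: split_indicator_asm)
  qed
  then have "AE x in lborel. \<forall>R::nat. x \<in> ball 0 (real R) \<longrightarrow> k x = 0"
    by (simp only: AE_all_countable) blast
  then show ?thesis
  proof eventually_elim
    case (elim x)
    obtain R :: nat where "norm x < real R" using reals_Archimedean2 by blast
    then show ?case using elim by auto
  qed
qed

section \<open>Limits and perturbations of the Taylor mean\<close>

text \<open>With the volume moved inside, the mean is an integral against a probability density, the
  form required by Jensen's inequality.\<close>

lemma taylor_mean_finite_eq:
  fixes v :: "'a::euclidean_space \<Rightarrow> real"
  assumes [measurable]: "v \<in> borel_measurable borel" and \<epsilon>: "0 < \<epsilon>"
  shows "taylor_mean p (ereal q) v g \<epsilon> x = epowr (\<integral>\<^sup>+h. (indicator (ball 0 \<epsilon>) h / emeasure lborel (ball (0::'a) \<epsilon>))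
      * epowr (ennreal (\<bar>v (x + h) - v x - g x \<bullet> h\<bar> / norm h)) (p * q) \<partial>lborel) (1 / q)"
proof -
  have "(\<integral>\<^sup>+h. (indicator (ball 0 \<epsilon>) h / emeasure lborel (ball (0::'a) \<epsilon>))
      * epowr (ennreal (\<bar>v (x + h) - v x - g x \<bullet> h\<bar> / norm h)) (p * q) \<partial>lborel)
    = (\<integral>\<^sup>+h. (ennreal (\<bar>v (x + h) - v x - g x \<bullet> h\<bar> powr (p * q) / norm h powr (p * q)) * indicator (ball 0 \<epsilon>) h)
        * inverse (emeasure lborel (ball (0::'a) \<epsilon>)) \<partial>lborel)"
    by (intro nn_integral_cong) (simp add: epowr_ennreal powr_divide divide_ennreal_def mult_ac)
  also have "\<dots> = (\<integral>\<^sup>+h\<in>ball 0 \<epsilon>. ennreal (\<bar>v (x + h) - v x - g x \<bullet> h\<bar> powr (p * q) / norm h powr (p * q)) \<partial>lborel)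
      / emeasure lborel (ball (0::'a) \<epsilon>)"
    unfolding divide_ennreal_def by (rule nn_integral_multc) measurable
  finally show ?thesis by (simp add: taylor_mean_lborel)
qed

lemma nn_integral_ball_kernel:
  fixes \<epsilon> :: real
  assumes "0 < \<epsilon>"
  shows "(\<integral>\<^sup>+h. indicator (ball (0::'a::euclidean_space) \<epsilon>) h / emeasure lborel (ball (0::'a) \<epsilon>) \<partial>lborel) = 1"
  using emeasure_lborel_ball_pos[OF assms, of "0::'a"]
  by (simp add: divide_ennreal_def nn_integral_multc) (simp add: divide_ennreal_def[symmetric] less_top)

lemma AE_lebesgue_on_ball_iff:
  "(AE h in lebesgue_on (ball (0::'a::euclidean_space) \<epsilon>). P h) \<longleftrightarrow> (AE h in lborel. h \<in> ball 0 \<epsilon> \<longrightarrow> P h)"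
  by (subst AE_restrict_space_iff) (auto simp: AE_completion_iff)

lemma measurable_lebesgue_on_ball:
  assumes "u \<in> borel_measurable borel"
  shows "u \<in> borel_measurable (lebesgue_on S)"
  using assms by (intro measurable_restrict_space1 measurable_completion) simp

text \<open>The mean is the p-th power of an L^(pq) norm of the quotient for a probability measure;
  such norms increase with the exponent, up to the essential supremum.\<close>

lemma taylor_mean_mono_exponent:
  fixes v :: "'a::euclidean_space \<Rightarrow> real"
  assumes v[measurable]: "v \<in> borel_measurable borel" and p: "1 \<le> p" and q: "1 \<le> q" "q \<le> q'" and \<epsilon>: "0 < \<epsilon>"
  shows "taylor_mean p q v g \<epsilon> x \<le> taylor_mean p q' v g \<epsilon> x"
proof (cases "q = q'")
  case False
  with q obtain r where r: "q = ereal r" "1 \<le> r" by (cases q) auto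
  let ?Q = "\<lambda>h. ennreal (\<bar>v (x + h) - v x - g x \<bullet> h\<bar> / norm h)"
  define k where "k = (\<lambda>h. indicator (ball (0::'a) \<epsilon>) h / emeasure lborel (ball (0::'a) \<epsilon>))"
  have [measurable]: "k \<in> borel_measurable borel" unfolding k_def by measurable
  have k1: "(\<integral>\<^sup>+h. k h \<partial>lborel) = 1" unfolding k_def by (rule nn_integral_ball_kernel[OF \<epsilon>])
  show ?thesis
  proof (cases q')
    case (real r')
    then have r': "1 \<le> r' / r" "0 < r'" using q r by (auto simp: divide_simps)
    have "epowr (\<integral>\<^sup>+h. k h * epowr (?Q h) (p * r) \<partial>lborel) (r' / r) \<le> (\<integral>\<^sup>+h. k h * epowr (epowr (?Q h) (p * r)) (r' / r) \<partial>lborel)"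
      by (rule epowr_nn_integral_le) (use k1 r' in measurable)
    also have "\<dots> = (\<integral>\<^sup>+h. k h * epowr (?Q h) (p * r') \<partial>lborel)"
      using r by (simp add: epowr_epowr)
    finally have "epowr (epowr (\<integral>\<^sup>+h. k h * epowr (?Q h) (p * r) \<partial>lborel) (r' / r)) (1 / r')
        \<le> epowr (\<integral>\<^sup>+h. k h * epowr (?Q h) (p * r') \<partial>lborel) (1 / r')"
      using r' by (intro epowr_mono) auto
    then show ?thesis
      using r r' real by (simp add: taylor_mean_finite_eq \<epsilon> epowr_epowr k_def)
  next
    case PInf
    define S where "S = esssup (lebesgue_on (ball 0 \<epsilon>)) ?Q"
    have "AE h in lborel. h \<in> ball 0 \<epsilon> \<longrightarrow> ?Q h \<le> S"
      using esssup_AE[of ?Q "lebesgue_on (ball 0 \<epsilon>)"] unfolding S_def AE_lebesgue_on_ball_iff .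
    then have "(\<integral>\<^sup>+h. k h * epowr (?Q h) (p * r) \<partial>lborel) \<le> (\<integral>\<^sup>+h. k h * epowr S (p * r) \<partial>lborel)"
    proof (intro nn_integral_mono_AE, eventually_elim)
      case (elim h)
      show ?case
      proof (cases "h \<in> ball 0 \<epsilon>")
        case True
        then show ?thesis using elim p r by (intro mult_left_mono epowr_mono) auto
      qed (simp add: k_def)
    qed
    also have "\<dots> = epowr S (p * r)" using k1 by (simp add: nn_integral_multc)
    finally have "epowr (\<integral>\<^sup>+h. k h * epowr (?Q h) (p * r) \<partial>lborel) (1 / r) \<le> epowr (epowr S (p * r)) (1 / r)"
      using r by (intro epowr_mono) auto
    then show ?thesis
      using r PInf by (simp add: taylor_mean_finite_eq \<epsilon> epowr_epowr k_def) (simp add: taylor_mean_def S_def)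
  qed (use q in auto)
qed simp

lemma taylor_mean_dominated_mono:
  assumes "taylor_mean_dominated TYPE('a::euclidean_space) p q'" "1 \<le> p" "1 \<le> q" "q \<le> q'"
  shows "taylor_mean_dominated TYPE('a) p q"
proof -
  obtain C where C: "C \<ge> 0" and H: "\<And>\<epsilon> (v :: 'a \<Rightarrow> real) G. 0 < \<epsilon> \<Longrightarrow> \<epsilon> \<le> 1 \<Longrightarrow> C1_grad v G \<Longrightarrow>
     (\<exists>m\<in>borel_measurable borel. (\<forall>x. taylor_mean p q' v (\<lambda>_. 0) \<epsilon> x \<le> m x) \<and>
       (\<integral>\<^sup>+x. m x \<partial>lborel) \<le> ennreal C * (\<integral>\<^sup>+x. ennreal (norm (G x) powr p) \<partial>lborel))"
    using assms(1) unfolding taylor_mean_dominated_def by blast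
  show ?thesis unfolding taylor_mean_dominated_def
  proof (intro exI[of _ C] conjI C allI impI)
    fix \<epsilon> :: real and v :: "'a \<Rightarrow> real" and G
    assume \<epsilon>: "0 < \<epsilon>" "\<epsilon> \<le> 1" and v: "C1_grad v G"
    from H[OF \<epsilon> v] obtain m where m: "m\<in>borel_measurable borel" "\<And>x. taylor_mean p q' v (\<lambda>_. 0) \<epsilon> x \<le> m x"
       "(\<integral>\<^sup>+x. m x \<partial>lborel) \<le> ennreal C * (\<integral>\<^sup>+x. ennreal (norm (G x) powr p) \<partial>lborel)" by blast
    then show "\<exists>m\<in>borel_measurable borel. (\<forall>x. taylor_mean p q v (\<lambda>_. 0) \<epsilon> x \<le> m x) \<and>
       (\<integral>\<^sup>+x. m x \<partial>lborel) \<le> ennreal C * (\<integral>\<^sup>+x. ennreal (norm (G x) powr p) \<partial>lborel)"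
      using taylor_mean_mono_exponent[OF C1_gradD(4)[OF v] assms(2-4) \<epsilon>(1)]
      by (intro bexI[of _ m] conjI allI) (auto intro: order_trans)
  qed
qed

text \<open>Convergence at the point \<open>x\<close> is a separate hypothesis: \<open>v n x\<close>
  enters every quotient, and almost everywhere convergence says nothing about a single point. For
  finite \<open>q\<close> the claim is Fatou's lemma in \<open>h\<close>.\<close>

lemma taylor_mean_liminf:
  fixes v :: "nat \<Rightarrow> 'a::euclidean_space \<Rightarrow> real"
  assumes [measurable]: "w \<in> borel_measurable borel" "\<And>n. v n \<in> borel_measurable borel"
    and p: "1 \<le> p" and q: "1 \<le> q" and \<epsilon>: "0 < \<epsilon>"
    and x: "(\<lambda>n. v n x) \<longlonglongrightarrow> w x" and ae: "AE y in lborel. (\<lambda>n. v n y) \<longlonglongrightarrow> w y"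
  shows "taylor_mean p q w (\<lambda>_. 0) \<epsilon> x \<le> liminf (\<lambda>n. taylor_mean p q (v n) (\<lambda>_. 0) \<epsilon> x)"
proof -
  define Q where "Q = (\<lambda>u h. ennreal (\<bar>u (x + h) - u x\<bar> / norm h))"
  have Qm[measurable]: "Q u \<in> borel_measurable borel" if [measurable]: "u \<in> borel_measurable borel" for u
    unfolding Q_def by measurable
  have Q_lim: "AE h in lborel. (\<lambda>n. Q (v n) h) \<longlonglongrightarrow> Q w h"
    using AE_lborel_translate[OF ae, of x]
  proof eventually_elim
    case (elim h)
    show ?case unfolding Q_def
      by (cases "h = 0") (auto intro!: tendsto_intros elim x)
  qed
  show ?thesis
  proof (cases q)
    case (real r)
    with q have r: "1 \<le> r" by simp
    define k where "k = (\<lambda>h. indicator (ball (0::'a) \<epsilon>) h / emeasure lborel (ball (0::'a) \<epsilon>))"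
    have [measurable]: "k \<in> borel_measurable borel" unfolding k_def by measurable
    have k_fin: "k h < top" for h
      using emeasure_lborel_ball_pos[OF \<epsilon>, of "0::'a"]
      by (auto simp: k_def ennreal_divide_eq_top_iff less_top[symmetric] split: split_indicator)
    have eq: "taylor_mean p q u (\<lambda>_. 0) \<epsilon> x = epowr (\<integral>\<^sup>+h. k h * epowr (Q u h) (p * r) \<partial>lborel) (1 / r)"
      if "u \<in> borel_measurable borel" for u
      using that by (simp add: real taylor_mean_finite_eq \<epsilon> k_def Q_def)
    have "(\<integral>\<^sup>+h. k h * epowr (Q w h) (p * r) \<partial>lborel) \<le> (\<integral>\<^sup>+h. liminf (\<lambda>n. k h * epowr (Q (v n) h) (p * r)) \<partial>lborel)"
      using Q_lim
    proof (intro nn_integral_mono_AE, eventually_elim)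
      case (elim h)
      have "(\<lambda>n. epowr (Q (v n) h) (p * r)) \<longlonglongrightarrow> epowr (Q w h) (p * r)"
      proof -
        have "(\<lambda>n. \<bar>v n (x + h) - v n x\<bar> / norm h) \<longlonglongrightarrow> \<bar>w (x + h) - w x\<bar> / norm h"
          using elim unfolding Q_def by (subst (asm) tendsto_ennreal_iff) auto
        then have "(\<lambda>n. ennreal ((\<bar>v n (x + h) - v n x\<bar> / norm h) powr (p * r))) \<longlonglongrightarrow> ennreal ((\<bar>w (x + h) - w x\<bar> / norm h) powr (p * r))"
          using p r by (intro tendsto_ennrealI tendsto_powr' tendsto_const) auto
        then show ?thesis by (simp add: Q_def epowr_ennreal)
      qed
      then have "(\<lambda>n. k h * epowr (Q (v n) h) (p * r)) \<longlonglongrightarrow> k h * epowr (Q w h) (p * r)"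
        by (intro ennreal_tendsto_cmult k_fin)
      then show ?case by (simp add: lim_imp_Liminf)
    qed
    also have "\<dots> \<le> liminf (\<lambda>n. \<integral>\<^sup>+h. k h * epowr (Q (v n) h) (p * r) \<partial>lborel)"
      by (rule nn_integral_liminf) measurable
    finally have "taylor_mean p q w (\<lambda>_. 0) \<epsilon> x \<le> epowr (liminf (\<lambda>n. \<integral>\<^sup>+h. k h * epowr (Q (v n) h) (p * r) \<partial>lborel)) (1 / r)"
      using r by (subst eq) (auto intro!: epowr_mono)
    also have "\<dots> \<le> liminf (\<lambda>n. epowr (\<integral>\<^sup>+h. k h * epowr (Q (v n) h) (p * r) \<partial>lborel) (1 / r))"
      using r by (intro epowr_liminf_le) auto
    finally show ?thesis by (simp add: eq)
  next
    case PInf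
    define S where "S = (\<lambda>u. esssup (lebesgue_on (ball 0 \<epsilon>)) (Q u))"
    have eq: "taylor_mean p q u (\<lambda>_. 0) \<epsilon> x = epowr (S u) p" for u
      by (simp add: PInf taylor_mean_def S_def Q_def)
    have "AE h in lborel. h \<in> ball 0 \<epsilon> \<longrightarrow> Q (v n) h \<le> S (v n)" for n
      using esssup_AE[of "Q (v n)" "lebesgue_on (ball 0 \<epsilon>)"] unfolding S_def AE_lebesgue_on_ball_iff .
    \<comment> \<open>The countably many exceptional sets, one for each essential supremum, are
      united.\<close>
    then have "AE h in lborel. \<forall>n. h \<in> ball 0 \<epsilon> \<longrightarrow> Q (v n) h \<le> S (v n)"
      by (simp only: AE_all_countable) blast
    then have "AE h in lborel. h \<in> ball 0 \<epsilon> \<longrightarrow> Q w h \<le> liminf (\<lambda>n. S (v n))"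
      using Q_lim
    proof eventually_elim
      case (elim h)
      show ?case
      proof
        assume "h \<in> ball 0 \<epsilon>"
        then have "liminf (\<lambda>n. Q (v n) h) \<le> liminf (\<lambda>n. S (v n))"
          using elim(1) by (intro Liminf_mono) auto
        then show "Q w h \<le> liminf (\<lambda>n. S (v n))"
          using lim_imp_Liminf[OF _ elim(2)] by simp
      qed
    qed
    then have "S w \<le> liminf (\<lambda>n. S (v n))"
      unfolding S_def by (intro esssup_I) (auto simp: AE_lebesgue_on_ball_iff intro!: measurable_lebesgue_on_ball)
    then have "epowr (S w) p \<le> epowr (liminf (\<lambda>n. S (v n))) p"
      using p by (intro epowr_mono) auto
    also have "\<dots> \<le> liminf (\<lambda>n. epowr (S (v n)) p)"
      using p by (intro epowr_liminf_le) auto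
    finally show ?thesis by (simp add: eq)
  qed (use q in auto)
qed

text \<open>\<open>K\<close> does not depend on \<open>h\<close>, so averaging leaves its power
  unchanged. For finite exponents \<open>r\<close> the factor \<open>2 powr (p * r)\<close> becomes
  \<open>2 powr p\<close> under the root, and the root of the sum splits because
  \<open>1 / r \<le> 1\<close>.\<close>

lemma taylor_mean_perturb:
  fixes f w :: "'a::euclidean_space \<Rightarrow> real"
  assumes [measurable]: "f \<in> borel_measurable borel" "w \<in> borel_measurable borel"
    and p: "1 \<le> p" and q: "1 \<le> q" and \<epsilon>: "0 < \<epsilon>"
    and le: "\<And>h. norm h < \<epsilon> \<Longrightarrow> ennreal (\<bar>f (x + h) - f x - g x \<bullet> h\<bar> / norm h) \<le> ennreal (\<bar>w (x + h) - w x\<bar> / norm h) + K"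
  shows "taylor_mean p q f g \<epsilon> x \<le> ennreal (2 powr p) * (taylor_mean p q w (\<lambda>_. 0) \<epsilon> x + epowr K p)"
proof -
  define Q where "Q = (\<lambda>h. ennreal (\<bar>f (x + h) - f x - g x \<bullet> h\<bar> / norm h))"
  define P where "P = (\<lambda>h. ennreal (\<bar>w (x + h) - w x\<bar> / norm h))"
  have [measurable]: "Q \<in> borel_measurable borel" "P \<in> borel_measurable borel" unfolding Q_def P_def by measurable
  have QP: "Q h \<le> P h + K" if "norm h < \<epsilon>" for h using le[OF that] by (simp add: Q_def P_def)
  show ?thesis
  proof (cases q)
    case (real r)
    with q have r: "1 \<le> r" by simp
    have pr: "0 < p * r" using p r by simp
    define k where "k = (\<lambda>h. indicator (ball (0::'a) \<epsilon>) h / emeasure lborel (ball (0::'a) \<epsilon>))"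
    have [measurable]: "k \<in> borel_measurable borel" unfolding k_def by measurable
    have k1: "(\<integral>\<^sup>+h. k h \<partial>lborel) = 1" unfolding k_def by (rule nn_integral_ball_kernel[OF \<epsilon>])
    have "(\<integral>\<^sup>+h. k h * epowr (Q h) (p * r) \<partial>lborel)
        \<le> (\<integral>\<^sup>+h. ennreal (2 powr (p * r)) * (k h * epowr (P h) (p * r) + k h * epowr K (p * r)) \<partial>lborel)"
    proof (rule nn_integral_mono)
      fix h
      show "k h * epowr (Q h) (p * r) \<le> ennreal (2 powr (p * r)) * (k h * epowr (P h) (p * r) + k h * epowr K (p * r))"
      proof (cases "norm h < \<epsilon>")
        case True
        have "epowr (Q h) (p * r) \<le> epowr (P h + K) (p * r)"
          using pr by (intro epowr_mono QP True) auto
        also have "\<dots> \<le> ennreal (2 powr (p * r)) * (epowr (P h) (p * r) + epowr K (p * r))"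
          using pr by (rule epowr_add_le_two)
        finally have "k h * epowr (Q h) (p * r) \<le> k h * (ennreal (2 powr (p * r)) * (epowr (P h) (p * r) + epowr K (p * r)))"
          by (intro mult_left_mono) auto
        then show ?thesis by (simp add: distrib_left mult_ac)
      qed (simp add: k_def)
    qed
    also have "\<dots> = ennreal (2 powr (p * r)) * ((\<integral>\<^sup>+h. k h * epowr (P h) (p * r) \<partial>lborel) + epowr K (p * r))"
      using k1 by (simp add: nn_integral_cmult nn_integral_add nn_integral_multc)
    finally have "epowr (\<integral>\<^sup>+h. k h * epowr (Q h) (p * r) \<partial>lborel) (1 / r)
        \<le> epowr (ennreal (2 powr (p * r)) * ((\<integral>\<^sup>+h. k h * epowr (P h) (p * r) \<partial>lborel) + epowr K (p * r))) (1 / r)"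
      using r by (intro epowr_mono) auto
    also have "\<dots> = ennreal (2 powr p) * epowr ((\<integral>\<^sup>+h. k h * epowr (P h) (p * r) \<partial>lborel) + epowr K (p * r)) (1 / r)"
      using r by (simp add: epowr_mult epowr_ennreal powr_powr)
    also have "\<dots> \<le> ennreal (2 powr p) * (epowr (\<integral>\<^sup>+h. k h * epowr (P h) (p * r) \<partial>lborel) (1 / r) + epowr (epowr K (p * r)) (1 / r))"
      using r by (intro mult_left_mono epowr_add_le) auto
    finally show ?thesis
      using r by (simp add: real taylor_mean_finite_eq \<epsilon> k_def Q_def P_def epowr_epowr)
  next
    case PInf
    define S where "S = esssup (lebesgue_on (ball 0 \<epsilon>)) P"
    have "AE h in lborel. h \<in> ball 0 \<epsilon> \<longrightarrow> P h \<le> S"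
      using esssup_AE[of P "lebesgue_on (ball 0 \<epsilon>)"] unfolding S_def AE_lebesgue_on_ball_iff .
    then have "AE h in lborel. h \<in> ball 0 \<epsilon> \<longrightarrow> Q h \<le> S + K"
      by eventually_elim (auto intro: order_trans[OF QP] add_right_mono)
    then have "esssup (lebesgue_on (ball 0 \<epsilon>)) Q \<le> S + K"
      by (intro esssup_I) (auto simp: AE_lebesgue_on_ball_iff intro!: measurable_lebesgue_on_ball)
    then have "epowr (esssup (lebesgue_on (ball 0 \<epsilon>)) Q) p \<le> epowr (S + K) p"
      using p by (intro epowr_mono) auto
    also have "\<dots> \<le> ennreal (2 powr p) * (epowr S p + epowr K p)"
      using p by (intro epowr_add_le_two) auto
    finally show ?thesis by (simp add: PInf taylor_mean_def S_def Q_def[abs_def] P_def[abs_def])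
  qed (use q in auto)
qed

text \<open>These ball integrals are the constants in the Taylor bound of a mollification, so their
  p-th power has to be integrable. Hoelder's inequality on the ball and Tonelli's theorem reduce
  this to the integral of \<open>\<bar>f x\<bar> powr p\<close>.\<close>

lemma nn_integral_epowr_ball_integral:
  fixes f :: "'a::euclidean_space \<Rightarrow> real"
  assumes [measurable]: "f \<in> borel_measurable borel" and p: "1 \<le> p"
    and fin: "(\<integral>\<^sup>+x. ennreal (\<bar>f x\<bar> powr p) \<partial>lborel) < top"
  shows "(\<integral>\<^sup>+x. epowr (\<integral>\<^sup>+y\<in>ball x R. ennreal \<bar>f y\<bar> \<partial>lborel) p \<partial>lborel) < top"
proof (cases "0 < R")
  case R: True
  define V where "V = emeasure lborel (ball (0::'a) R)"
  have V: "V < top" "V \<noteq> 0" using emeasure_lborel_ball_pos[OF R, of "0::'a"] by (auto simp: V_def less_top)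
  \<comment> \<open>The cost of Hoelder's inequality, which is applied for exponents above 1; for
    \<open>p = 1\<close> both sides agree with factor 1.\<close>
  define c where "c = (if p = 1 then 1 else epowr V (p - 1))"
  have c: "c < top" using V by (auto simp: c_def less_top[symmetric])
  have shift: "(\<integral>\<^sup>+y\<in>ball x R. u y \<partial>lborel) = (\<integral>\<^sup>+y\<in>ball 0 R. u (x + y) \<partial>lborel)"
    if [measurable]: "u \<in> borel_measurable borel" for u :: "'a \<Rightarrow> ennreal" and x
  proof -
    have "(\<integral>\<^sup>+y\<in>ball x R. u y \<partial>lborel) = (\<integral>\<^sup>+y. u (y + x) * indicator (ball x R) (y + x) \<partial>lborel)"
      using nn_integral_lborel_translate[of "\<lambda>y. u y * indicator (ball x R) y" x] by simp
    also have "\<dots> = (\<integral>\<^sup>+y\<in>ball 0 R. u (x + y) \<partial>lborel)"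
      by (intro nn_integral_cong) (auto simp: dist_norm add.commute split: split_indicator)
    finally show ?thesis .
  qed
  have "(\<integral>\<^sup>+x. epowr (\<integral>\<^sup>+y\<in>ball x R. ennreal \<bar>f y\<bar> \<partial>lborel) p \<partial>lborel)
      \<le> (\<integral>\<^sup>+x. c * (\<integral>\<^sup>+y\<in>ball 0 R. ennreal (\<bar>f (x + y)\<bar> powr p) \<partial>lborel) \<partial>lborel)"
  proof (rule nn_integral_mono)
    fix x
    have "epowr (\<integral>\<^sup>+y\<in>ball 0 R. ennreal \<bar>f (x + y)\<bar> \<partial>lborel) p \<le> c * (\<integral>\<^sup>+y\<in>ball 0 R. epowr (ennreal \<bar>f (x + y)\<bar>) p \<partial>lborel)"
    proof (cases "p = 1")
      case True
      then show ?thesis by (simp add: c_def)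
    next
      case False
      then have "epowr (\<integral>\<^sup>+y\<in>ball 0 R. ennreal \<bar>f (x + y)\<bar> \<partial>lborel) p
          \<le> epowr V (p - 1) * (\<integral>\<^sup>+y\<in>ball 0 R. epowr (ennreal \<bar>f (x + y)\<bar>) p \<partial>lborel)"
        unfolding V_def using p by (intro epowr_set_nn_integral_le) auto
      then show ?thesis using False by (simp only: c_def if_False)
    qed
    then show "epowr (\<integral>\<^sup>+y\<in>ball x R. ennreal \<bar>f y\<bar> \<partial>lborel) p \<le> c * (\<integral>\<^sup>+y\<in>ball 0 R. ennreal (\<bar>f (x + y)\<bar> powr p) \<partial>lborel)"
      using shift[of "\<lambda>y. ennreal \<bar>f y\<bar>" x] by (simp add: epowr_ennreal)
  qed
  also have "\<dots> = c * (\<integral>\<^sup>+x. (\<integral>\<^sup>+y\<in>ball 0 R. ennreal (\<bar>f (x + y)\<bar> powr p) \<partial>lborel) \<partial>lborel)"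
    by (rule nn_integral_cmult) measurable
  also have "(\<integral>\<^sup>+x. (\<integral>\<^sup>+y\<in>ball 0 R. ennreal (\<bar>f (x + y)\<bar> powr p) \<partial>lborel) \<partial>lborel)
      = (\<integral>\<^sup>+y. (\<integral>\<^sup>+x. ennreal (\<bar>f (x + y)\<bar> powr p) * indicator (ball 0 R) y \<partial>lborel) \<partial>lborel)"
    by (rule lborel_pair.Fubini'[symmetric]) measurable
  also have "\<dots> = (\<integral>\<^sup>+y. (\<integral>\<^sup>+x. ennreal (\<bar>f x\<bar> powr p) \<partial>lborel) * indicator (ball (0::'a) R) y \<partial>lborel)"
    by (simp add: nn_integral_multc nn_integral_lborel_translate[of "\<lambda>x. ennreal (\<bar>f x\<bar> powr p)"])
  also have "\<dots> = (\<integral>\<^sup>+x. ennreal (\<bar>f x\<bar> powr p) \<partial>lborel) * V"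
    by (simp add: nn_integral_cmult_indicator V_def)
  finally show ?thesis
    using fin V c by (auto simp: ennreal_mult_less_top order_le_less_trans)
next
  case False
  then show ?thesis by (simp add: ball_empty)
qed

lemma norm_diff_powr_le:
  fixes a b c :: "'b::real_normed_vector"
  assumes p: "1 \<le> p"
  shows "ennreal (norm (a - b) powr p) \<le> ennreal (2 powr p) * (ennreal (norm (a - c) powr p) + ennreal (norm (b - c) powr p))"
proof -
  have "norm (a - b) \<le> norm (a - c) + norm (b - c)"
    using norm_triangle_ineq4[of "a - c" "b - c"] by simp
  then have "norm (a - b) powr p \<le> (norm (a - c) + norm (b - c)) powr p" using p by (intro powr_mono2) auto
  also have "\<dots> \<le> 2 powr p * (norm (a - c) powr p + norm (b - c) powr p)" using p by (intro powr_add_le_two) auto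
  finally show ?thesis
    by (simp add: ennreal_plus[symmetric] ennreal_mult[symmetric] ennreal_leI del: ennreal_plus)
qed

lemma taylor_mean_tendsto_0:
  fixes f :: "'a::euclidean_space \<Rightarrow> real"
  assumes dom: "taylor_mean_dominated TYPE('a) p q" and p: "1 \<le> p" and q: "1 \<le> q"
    and f[measurable]: "f \<in> borel_measurable borel" and g[measurable]: "g \<in> borel_measurable borel"
    and f_fin: "(\<integral>\<^sup>+x. ennreal (\<bar>f x\<bar> powr p) \<partial>lborel) < top"
    and g_fin: "(\<integral>\<^sup>+x. ennreal (norm (g x) powr p) \<partial>lborel) < top"
    and fg: "bump_weak_gradient f g"
  shows "((\<lambda>\<epsilon>. \<integral>\<^sup>+x. taylor_mean p q f g \<epsilon> x \<partial>lborel) \<longlongrightarrow> 0) (at_right 0)"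
proof (rule tendsto_0_ennrealI)
  fix e :: real assume e: "0 < e"
  obtain C where C: "0 \<le> C" and H: "\<And>\<epsilon> (v :: 'a \<Rightarrow> real) G. 0 < \<epsilon> \<Longrightarrow> \<epsilon> \<le> 1 \<Longrightarrow> C1_grad v G \<Longrightarrow>
     (\<exists>m\<in>borel_measurable borel. (\<forall>x. taylor_mean p q v (\<lambda>_. 0) \<epsilon> x \<le> m x) \<and>
       (\<integral>\<^sup>+x. m x \<partial>lborel) \<le> ennreal C * (\<integral>\<^sup>+x. ennreal (norm (G x) powr p) \<partial>lborel))"
    using dom unfolding taylor_mean_dominated_def by blast
  define F where "F = (\<lambda>n. mollify (real (Suc n)) f)"
  define G where "G = (\<lambda>n. mollify (real (Suc n)) g)"
  have FG: "C1_grad (F n) (G n)" for n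
    unfolding F_def G_def by (rule C1_grad_mollify[OF fg]) simp
  note [measurable] = C1_gradD(4,5)[OF FG]
  define \<gamma> where "\<gamma> = (\<lambda>n. \<integral>\<^sup>+x. ennreal (norm (G n x - g x) powr p) \<partial>lborel)"
  have \<gamma>_lim: "\<gamma> \<longlonglongrightarrow> 0"
    unfolding \<gamma>_def G_def by (rule mollify_tendsto_Lp[OF g p g_fin])
  have "(\<lambda>n. \<integral>\<^sup>+x. ennreal (norm (F n x - f x) powr p) \<partial>lborel) \<longlonglongrightarrow> 0"
    unfolding F_def using f_fin by (intro mollify_tendsto_Lp[OF f p]) auto
  then have "\<exists>r::nat \<Rightarrow> nat. strict_mono r \<and> (AE x in lborel. (\<lambda>n. F (r n) x - f x) \<longlonglongrightarrow> 0)"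
    using p by (intro Lp_tendsto_0_AE_subseq[where p=p]) auto
  then obtain r :: "nat \<Rightarrow> nat" where r: "strict_mono r" "AE x in lborel. (\<lambda>n. F (r n) x - f x) \<longlonglongrightarrow> 0"
    by blast
  have F_ae: "AE x in lborel. (\<lambda>n. F (r n) x) \<longlonglongrightarrow> f x"
    using r(2) by (simp add: LIM_zero_iff)
  have \<gamma>r_lim: "(\<lambda>n. \<gamma> (r n)) \<longlonglongrightarrow> 0"
    using LIMSEQ_subseq_LIMSEQ[OF \<gamma>_lim r(1)] by (simp add: o_def)
  \<comment> \<open>Collects the two places where \<open>\<gamma> m\<close> will occur: the limit of
    the uniform estimate for \<open>F (r n) - F m\<close>, and the direct error
    \<open>norm (G m x - g x)\<close>.\<close>
  define D where "D = 2 powr p * (C * 2 powr p + 2 powr p)"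
  have D: "0 < D" using C by (simp add: D_def add_nonneg_pos)
  have "\<forall>\<^sub>F n in sequentially. \<gamma> n < ennreal (e / (2 * D))"
    using \<gamma>_lim e D by (intro order_tendstoD) auto
  \<comment> \<open>The mollification index is fixed here, before \<open>\<epsilon>\<close>; the
    constants \<open>L\<close>, \<open>R\<close> and \<open>J\<close> below may depend on
    it.\<close>
  then obtain m where m: "\<gamma> m < ennreal (e / (2 * D))" by (auto dest: eventually_happens)
  obtain L R where L: "0 \<le> L" and Tay: "\<And>x h. norm h \<le> 1 \<Longrightarrow>
      ennreal \<bar>F m (x + h) - F m x - G m x \<bullet> h\<bar> \<le> ennreal (L * (norm h)\<^sup>2) * (\<integral>\<^sup>+y\<in>ball x R. ennreal \<bar>f y\<bar> \<partial>lborel)"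
    using mollify_Taylor[OF fg, of "real (Suc m)"] unfolding F_def G_def by auto
  define I where "I = (\<lambda>x. \<integral>\<^sup>+y\<in>ball x R. ennreal \<bar>f y\<bar> \<partial>lborel)"
  have I[measurable]: "I \<in> borel_measurable borel"
  proof -
    have "I = (\<lambda>x. \<integral>\<^sup>+y. ennreal \<bar>f y\<bar> * (if dist x y < R then 1 else 0) \<partial>lborel)"
      by (auto simp: I_def fun_eq_iff intro!: nn_integral_cong split: split_indicator)
    then show ?thesis by simp
  qed
  obtain J where J: "0 \<le> J" "(\<integral>\<^sup>+x. epowr (I x) p \<partial>lborel) = ennreal J"
  proof -
    have "(\<integral>\<^sup>+x. epowr (I x) p \<partial>lborel) < top"
      unfolding I_def by (rule nn_integral_epowr_ball_integral[OF f p f_fin])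
    then show ?thesis using that by (cases "\<integral>\<^sup>+x. epowr (I x) p \<partial>lborel") auto
  qed
  \<comment> \<open>In general not continuously differentiable, so the uniform estimate reaches it
    only through the approximations \<open>F (r n) - F m\<close>.\<close>
  define w where "w = (\<lambda>x. f x - F m x)"
  have [measurable]: "w \<in> borel_measurable borel" unfolding w_def by measurable
  define \<kappa> where "\<kappa> = 2 powr p * 2 powr p * L powr p * J"
  have main: "(\<integral>\<^sup>+x. taylor_mean p q f g \<epsilon> x \<partial>lborel) \<le> ennreal D * \<gamma> m + ennreal (\<kappa> * \<epsilon> powr p)"
    if \<epsilon>: "0 < \<epsilon>" "\<epsilon> \<le> 1" for \<epsilon>
  proof -
    \<comment> \<open>The approximations have the gradients \<open>G (r n) - G m\<close>. A whole
      sequence of majorants is chosen because Fatou's lemma in \<open>x\<close> is applied to the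
      majorants, not to the means.\<close>
    have "\<forall>n. \<exists>M\<in>borel_measurable borel. (\<forall>x. taylor_mean p q (\<lambda>x. F (r n) x - F m x) (\<lambda>_. 0) \<epsilon> x \<le> M x) \<and>
       (\<integral>\<^sup>+x. M x \<partial>lborel) \<le> ennreal C * (\<integral>\<^sup>+x. ennreal (norm (G (r n) x - G m x) powr p) \<partial>lborel)"
      using H[OF \<epsilon> C1_grad_diff[OF FG FG]] by blast
    from this[unfolded Bex_def, THEN choice] obtain M where MM: "\<forall>n. M n \<in> borel_measurable borel \<and>
       (\<forall>x. taylor_mean p q (\<lambda>x. F (r n) x - F m x) (\<lambda>_. 0) \<epsilon> x \<le> M n x) \<and>
       (\<integral>\<^sup>+x. M n x \<partial>lborel) \<le> ennreal C * (\<integral>\<^sup>+x. ennreal (norm (G (r n) x - G m x) powr p) \<partial>lborel)"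
      by (rule exE)
    then have M[measurable]: "\<And>n. M n \<in> borel_measurable borel"
      and M_le: "\<And>n x. taylor_mean p q (\<lambda>x. F (r n) x - F m x) (\<lambda>_. 0) \<epsilon> x \<le> M n x"
      and M_int: "\<And>n. (\<integral>\<^sup>+x. M n x \<partial>lborel) \<le> ennreal C * (\<integral>\<^sup>+x. ennreal (norm (G (r n) x - G m x) powr p) \<partial>lborel)"
      by simp_all
    \<comment> \<open>The part of the bound independent of \<open>h\<close>: the gradient error, and
      the remainder bound \<open>L * (norm h)\<^sup>2 * I x\<close> of the mollification after
      division by \<open>norm h\<close>, where \<open>norm h < \<epsilon>\<close>.\<close>
    define K where "K = (\<lambda>x. ennreal (norm (G m x - g x)) + ennreal (L * \<epsilon>) * I x)"
    have w_ae: "AE x in lborel. (\<lambda>n. F (r n) x - F m x) \<longlonglongrightarrow> w x"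
      using F_ae unfolding w_def by eventually_elim (intro tendsto_diff tendsto_const)
    have tm_w: "AE x in lborel. taylor_mean p q w (\<lambda>_. 0) \<epsilon> x \<le> liminf (\<lambda>n. M n x)"
      using w_ae
    proof eventually_elim
      case (elim x)
      have "taylor_mean p q w (\<lambda>_. 0) \<epsilon> x \<le> liminf (\<lambda>n. taylor_mean p q (\<lambda>x. F (r n) x - F m x) (\<lambda>_. 0) \<epsilon> x)"
        by (rule taylor_mean_liminf[OF _ _ p q \<epsilon>(1) elim w_ae]) measurable
      also have "\<dots> \<le> liminf (\<lambda>n. M n x)"
        by (intro Liminf_mono always_eventually allI M_le)
      finally show ?case .
    qed
    have tm_f: "taylor_mean p q f g \<epsilon> x \<le> ennreal (2 powr p) * (taylor_mean p q w (\<lambda>_. 0) \<epsilon> x + epowr (K x) p)" for x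
    proof (rule taylor_mean_perturb[OF _ _ p q \<epsilon>(1)])
      fix h :: 'a assume h: "norm h < \<epsilon>"
      show "ennreal (\<bar>f (x + h) - f x - g x \<bullet> h\<bar> / norm h) \<le> ennreal (\<bar>w (x + h) - w x\<bar> / norm h) + K x"
      proof (cases "h = 0")
        case False
        define a where "a = \<bar>F m (x + h) - F m x - G m x \<bullet> h\<bar>"
        have "\<bar>f (x + h) - f x - g x \<bullet> h\<bar> \<le> \<bar>w (x + h) - w x\<bar> + \<bar>(G m x - g x) \<bullet> h\<bar> + a"
          by (simp add: w_def a_def inner_diff_left)
        also have "\<bar>(G m x - g x) \<bullet> h\<bar> \<le> norm (G m x - g x) * norm h" by (rule Cauchy_Schwarz_ineq2)
        finally have "\<bar>f (x + h) - f x - g x \<bullet> h\<bar> / norm h \<le> (\<bar>w (x + h) - w x\<bar> + norm (G m x - g x) * norm h + a) / norm h"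
          using False by (intro divide_right_mono) auto
        also have "\<dots> = \<bar>w (x + h) - w x\<bar> / norm h + norm (G m x - g x) + a / norm h"
          using False by (simp add: add_divide_distrib)
        finally have "ennreal (\<bar>f (x + h) - f x - g x \<bullet> h\<bar> / norm h)
           \<le> ennreal (\<bar>w (x + h) - w x\<bar> / norm h + norm (G m x - g x) + a / norm h)" by (rule ennreal_leI)
        also have "\<dots> = ennreal (\<bar>w (x + h) - w x\<bar> / norm h) + ennreal (norm (G m x - g x)) + ennreal (a / norm h)"
          by (simp add: a_def)
        also have "ennreal (a / norm h) \<le> ennreal (L * \<epsilon>) * I x"
        proof -
          have "ennreal (a / norm h) = ennreal (1 / norm h) * ennreal a" by (simp add: a_def ennreal_mult[symmetric])
          also have "\<dots> \<le> ennreal (1 / norm h) * (ennreal (L * (norm h)\<^sup>2) * I x)"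
            unfolding a_def I_def using h \<epsilon> by (intro mult_left_mono Tay) auto
          also have "\<dots> = ennreal (L * norm h) * I x"
            using False L by (simp add: mult.assoc[symmetric] ennreal_mult[symmetric] power2_eq_square)
          also have "\<dots> \<le> ennreal (L * \<epsilon>) * I x"
            using h L by (intro mult_right_mono ennreal_leI mult_left_mono) auto
          finally show ?thesis .
        qed
        finally show ?thesis by (simp add: K_def add.assoc add_left_mono)
      qed simp
    qed measurable
    have K_le: "epowr (K x) p \<le> ennreal (2 powr p) * (ennreal (norm (G m x - g x) powr p) + ennreal ((L * \<epsilon>) powr p) * epowr (I x) p)" for x
      using epowr_add_le_two[of p "ennreal (norm (G m x - g x))" "ennreal (L * \<epsilon>) * I x"] p L \<epsilon>
      by (simp add: K_def epowr_mult epowr_ennreal)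
    have "(\<integral>\<^sup>+x. taylor_mean p q f g \<epsilon> x \<partial>lborel) \<le> (\<integral>\<^sup>+x. ennreal (2 powr p) * (liminf (\<lambda>n. M n x)
        + ennreal (2 powr p) * (ennreal (norm (G m x - g x) powr p) + ennreal ((L * \<epsilon>) powr p) * epowr (I x) p)) \<partial>lborel)"
      using tm_w
    proof (intro nn_integral_mono_AE, eventually_elim)
      case (elim x)
      show ?case
        by (rule order_trans[OF tm_f]) (intro mult_left_mono add_mono elim K_le, simp)
    qed
    \<comment> \<open>The integrand is now a combination of measurable majorants, so the integral
      may be split.\<close>
    also have "\<dots> = ennreal (2 powr p) * ((\<integral>\<^sup>+x. liminf (\<lambda>n. M n x) \<partial>lborel)
        + ennreal (2 powr p) * (\<gamma> m + ennreal ((L * \<epsilon>) powr p) * ennreal J))"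
      by (simp add: nn_integral_cmult nn_integral_add \<gamma>_def J(2))
    also have "\<dots> \<le> ennreal (2 powr p) * (ennreal (C * 2 powr p) * \<gamma> m
        + ennreal (2 powr p) * (\<gamma> m + ennreal ((L * \<epsilon>) powr p) * ennreal J))"
    proof (intro mult_left_mono add_right_mono)
      have "(\<integral>\<^sup>+x. liminf (\<lambda>n. M n x) \<partial>lborel) \<le> liminf (\<lambda>n. \<integral>\<^sup>+x. M n x \<partial>lborel)"
        by (rule nn_integral_liminf) measurable
      also have "\<dots> \<le> liminf (\<lambda>n. ennreal (C * 2 powr p) * (\<gamma> (r n) + \<gamma> m))"
      proof (intro Liminf_mono always_eventually allI)
        fix n
        have "(\<integral>\<^sup>+x. M n x \<partial>lborel) \<le> ennreal C * (\<integral>\<^sup>+x. ennreal (norm (G (r n) x - G m x) powr p) \<partial>lborel)"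
          by (rule M_int)
        also have "\<dots> \<le> ennreal C * (\<integral>\<^sup>+x. ennreal (2 powr p) * (ennreal (norm (G (r n) x - g x) powr p) + ennreal (norm (G m x - g x) powr p)) \<partial>lborel)"
          by (intro mult_left_mono nn_integral_mono norm_diff_powr_le p) auto
        also have "\<dots> = ennreal (C * 2 powr p) * (\<gamma> (r n) + \<gamma> m)"
          using C by (simp add: nn_integral_cmult nn_integral_add \<gamma>_def ennreal_mult mult.assoc)
        finally show "(\<integral>\<^sup>+x. M n x \<partial>lborel) \<le> ennreal (C * 2 powr p) * (\<gamma> (r n) + \<gamma> m)" .
      qed
      \<comment> \<open>\<open>\<gamma> (r n)\<close> tends to 0, so only the error of the fixed
        index \<open>m\<close> survives.\<close>
      also have "\<dots> = ennreal (C * 2 powr p) * (0 + \<gamma> m)"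
        by (intro lim_imp_Liminf ennreal_tendsto_cmult tendsto_add \<gamma>r_lim tendsto_const) auto
      finally show "(\<integral>\<^sup>+x. liminf (\<lambda>n. M n x) \<partial>lborel) \<le> ennreal (C * 2 powr p) * \<gamma> m" by simp
    qed auto
    also have "\<dots> = ennreal D * \<gamma> m + ennreal (\<kappa> * \<epsilon> powr p)"
      using C J L \<epsilon> unfolding D_def \<kappa>_def
      by (simp add: ennreal_mult powr_mult distrib_left distrib_right mult_ac add_ac)
    finally show ?thesis .
  qed
  have "((\<lambda>\<epsilon>. \<kappa> * \<epsilon> powr p) \<longlongrightarrow> \<kappa> * 0) (at_right 0)"
    using p by (intro tendsto_mult tendsto_const tendsto_zero_powrI[where b=p] tendsto_ident_at)
      (auto simp: eventually_at_right_less eventually_at_filter)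
  then have "\<forall>\<^sub>F \<epsilon> in at_right 0. \<kappa> * \<epsilon> powr p < e / 2"
    using e by (intro order_tendstoD) auto
  moreover have "\<forall>\<^sub>F \<epsilon> in at_right (0::real). 0 < \<epsilon> \<and> \<epsilon> \<le> 1"
    unfolding eventually_at_right_field by (intro exI[of _ 1]) auto
  ultimately show "\<forall>\<^sub>F \<epsilon> in at_right 0. (\<integral>\<^sup>+x. taylor_mean p q f g \<epsilon> x \<partial>lborel) \<le> ennreal e"
  proof eventually_elim
    case (elim \<epsilon>)
    have "(\<integral>\<^sup>+x. taylor_mean p q f g \<epsilon> x \<partial>lborel) \<le> ennreal D * \<gamma> m + ennreal (\<kappa> * \<epsilon> powr p)"
      using elim by (intro main) auto
    also have "\<dots> \<le> ennreal D * ennreal (e / (2 * D)) + ennreal (e / 2)"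
      using m elim by (intro add_mono mult_left_mono ennreal_leI) auto
    also have "\<dots> = ennreal e"
      using D e by (simp add: ennreal_mult[symmetric] ennreal_plus[symmetric] del: ennreal_plus)
    finally show ?case .
  qed
qed

section \<open>From Lebesgue to Borel measurable representatives\<close>

lemma lebesgue_measurable_borel_representative:
  fixes u :: "'a::euclidean_space \<Rightarrow> 'b::euclidean_space"
  assumes [measurable]: "u \<in> borel_measurable lebesgue"
  shows "\<exists>u'\<in>borel_measurable borel. AE x in lborel. u x = u' x"
proof -
  have "\<forall>b. \<exists>w. w \<in> borel_measurable lborel \<and> (AE x in lborel. u x \<bullet> b = w x)"
    using completion_ex_borel_measurable_real[of "\<lambda>x. u x \<bullet> b" lborel for b] by auto
  from choice[OF this] obtain w where w: "\<forall>b. w b \<in> borel_measurable lborel \<and> (AE x in lborel. u x \<bullet> b = w b x)"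
    by (rule exE)
  then have [measurable]: "\<And>b. w b \<in> borel_measurable borel" by simp
  have "AE x in lborel. \<forall>b\<in>Basis. u x \<bullet> b = w b x"
    using w by (intro AE_finite_allI) auto
  then have "AE x in lborel. u x = (\<Sum>b\<in>Basis. w b x *\<^sub>R b)"
    by eventually_elim (metis (mono_tags, lifting) euclidean_representation sum.cong)
  then show ?thesis by (intro bexI[of _ "\<lambda>x. \<Sum>b\<in>Basis. w b x *\<^sub>R b"]) auto
qed

text \<open>A pointwise limit of the restrictions to balls, whose measurability is contained in
  their integrability.\<close>

lemma locally_integrable_lebesgue_measurable:
  fixes u :: "'a::euclidean_space \<Rightarrow> 'b::euclidean_space"
  assumes "locally_integrable u"
  shows "u \<in> borel_measurable lebesgue"
proof (rule borel_measurable_LIMSEQ_metric[where f="\<lambda>n x. indicator (cball 0 (real n)) x *\<^sub>R u x"])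
  show "(\<lambda>x. indicator (cball 0 (real n)) x *\<^sub>R u x) \<in> borel_measurable lebesgue" for n
    using assms by (auto simp: locally_integrable_def set_integrable_def dest!: spec[of _ "cball 0 (real n)"])
  fix x :: 'a
  obtain n :: nat where n: "norm x \<le> n" using real_arch_simple by blast
  show "(\<lambda>n. indicator (cball 0 (real n)) x *\<^sub>R u x) \<longlonglongrightarrow> u x"
  proof (rule tendsto_eventually)
    show "\<forall>\<^sub>F n in sequentially. indicator (cball 0 (real n)) x *\<^sub>R u x = u x"
      using eventually_ge_at_top[of n] by eventually_elim (use n in auto)
  qed
qed

lemma loc_integrable_representative:
  assumes u: "locally_integrable u" and u': "u' \<in> borel_measurable borel" and ae: "AE x in lborel. u x = u' x"
  shows "loc_integrable u'"
  unfolding loc_integrable_def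
proof (intro conjI allI u')
  fix R
  have "(\<integral>\<^sup>+y\<in>ball 0 R. ennreal (norm (u' y)) \<partial>lborel)
      \<le> (\<integral>\<^sup>+y. ennreal (norm (indicator (cball 0 R) y *\<^sub>R u y)) \<partial>lborel)"
    using ae by (intro nn_integral_mono_AE) (auto elim!: eventually_mono split: split_indicator)
  also have "\<dots> = (\<integral>\<^sup>+y. ennreal (norm (indicator (cball 0 R) y *\<^sub>R u y)) \<partial>lebesgue)"
    by (simp add: nn_integral_completion)
  also have "\<dots> < top"
    using u by (auto simp: locally_integrable_def set_integrable_def integrable_iff_bounded)
  finally show "(\<integral>\<^sup>+y\<in>ball 0 R. ennreal (norm (u' y)) \<partial>lborel) < top" .
qed

text \<open>The weak gradient identity consists of integrals for the completed measure, which ignore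
  changes on null sets; with Borel integrands these become integrals for
  \<open>lborel\<close>.\<close>

lemma bump_weak_gradient_representative:
  assumes wg: "has_weak_gradient f g"
    and f': "f' \<in> borel_measurable borel" "AE x in lborel. f x = f' x"
    and g': "g' \<in> borel_measurable borel" "AE x in lborel. g x = g' x"
  shows "bump_weak_gradient f' g'"
  unfolding bump_weak_gradient_def
proof (intro conjI allI impI ballI)
  have f: "locally_integrable f" and g: "locally_integrable g" using wg by (auto simp: has_weak_gradient_def)
  show "loc_integrable f'" "loc_integrable g'"
    using loc_integrable_representative f g f' g' by blast+
  note [measurable] = f'(1) g'(1)
  have [measurable]: "f \<in> borel_measurable lebesgue" "g \<in> borel_measurable lebesgue"
    using f g by (auto intro: locally_integrable_lebesgue_measurable)
  have ae: "AE x in lebesgue. f x = f' x" "AE x in lebesgue. g x = g' x"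
    using f'(2) g'(2) by (auto intro: AE_completion)
  fix c :: real and a b :: 'a
  assume c: "0 < c" and b: "b \<in> Basis"
  define P where "P = partial_deriv b (bump c a)"
  have "P = (\<lambda>x. flat_exp 2 (1 - c\<^sup>2 * (norm (x - a))\<^sup>2) * (- 2 * c\<^sup>2 * ((x - a) \<bullet> b)))"
    unfolding P_def by (rule ext) (rule bump_partial_deriv)
  then have P: "P \<in> borel_measurable borel" by simp
  have [measurable]: "P \<in> borel_measurable lebesgue" "bump c a \<in> borel_measurable lebesgue"
    "f' \<in> borel_measurable lebesgue" "g' \<in> borel_measurable lebesgue"
    using P f'(1) g'(1) borel_measurable_bump[of c a] by (auto intro!: measurable_completion)
  have "(\<integral>y. f' y * P y \<partial>lborel) = (\<integral>y. f' y * P y \<partial>lebesgue)"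
    using P by (intro integral_completion[symmetric]) simp
  also have "\<dots> = (\<integral>y. f y * P y \<partial>lebesgue)"
    using ae(1) by (intro integral_cong_AE) (auto elim!: eventually_mono)
  also have "\<dots> = - (\<integral>y. (g y \<bullet> b) * bump c a y \<partial>lebesgue)"
    using wg test_function_bump[OF c] b unfolding has_weak_gradient_def P_def by blast
  also have "(\<integral>y. (g y \<bullet> b) * bump c a y \<partial>lebesgue) = (\<integral>y. (g' y \<bullet> b) * bump c a y \<partial>lebesgue)"
    using ae(2) by (intro integral_cong_AE) (auto elim!: eventually_mono)
  also have "\<dots> = (\<integral>y. (g' y \<bullet> b) * bump c a y \<partial>lborel)"
    by (intro integral_completion) simp
  finally show "(\<integral>y. f' y * partial_deriv b (bump c a) y \<partial>lborel) = - (\<integral>y. (g' y \<bullet> b) * bump c a y \<partial>lborel)"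
    unfolding P_def .
qed

text \<open>The mollifications of both candidates are the classical gradient of the same function
  \<open>mollify c f\<close>, hence equal; so every mollification of \<open>g x - g' x\<close>
  vanishes.\<close>

lemma bump_weak_gradient_unique:
  assumes "bump_weak_gradient f g" "bump_weak_gradient f g'"
  shows "AE x in lborel. g x = g' x"
proof -
  have g: "loc_integrable g" "loc_integrable g'" using assms by (auto simp: bump_weak_gradient_def)
  note [measurable] = loc_integrableD(1)[OF g(1)] loc_integrableD(1)[OF g(2)]
  have "loc_integrable (\<lambda>x. g x - g' x)"
    unfolding loc_integrable_def
  proof (intro conjI allI)
    fix R
    have "(\<integral>\<^sup>+y\<in>ball 0 R. ennreal (norm (g y - g' y)) \<partial>lborel)
        \<le> (\<integral>\<^sup>+y. ennreal (norm (g y)) * indicator (ball 0 R) y + ennreal (norm (g' y)) * indicator (ball 0 R) y \<partial>lborel)"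
      using norm_triangle_ineq4[of "g y" "g' y" for y]
      by (intro nn_integral_mono) (auto simp: ennreal_plus[symmetric] simp del: ennreal_plus intro!: ennreal_leI split: split_indicator)
    also have "\<dots> = (\<integral>\<^sup>+y\<in>ball 0 R. ennreal (norm (g y)) \<partial>lborel) + (\<integral>\<^sup>+y\<in>ball 0 R. ennreal (norm (g' y)) \<partial>lborel)"
      by (rule nn_integral_add) measurable
    also have "\<dots> < top" using loc_integrableD(2)[OF g(1)] loc_integrableD(2)[OF g(2)] by simp
    finally show "(\<integral>\<^sup>+y\<in>ball 0 R. ennreal (norm (g y - g' y)) \<partial>lborel) < top" .
  qed measurable
  moreover have "mollify c (\<lambda>x. g x - g' x) x = 0" if c: "0 < c" for c x
  proof -
    have "(\<lambda>h. mollify c g x \<bullet> h) = (\<lambda>h. mollify c g' x \<bullet> h)"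
      using C1_gradD(2)[OF C1_grad_mollify[OF assms(1) c]] C1_gradD(2)[OF C1_grad_mollify[OF assms(2) c]]
      by (rule has_derivative_unique)
    then have "mollify c g x = mollify c g' x"
      by (metis vector_eq_rdot)
    then show ?thesis
      using integrable_bump_mult[OF g(1) c, of x] integrable_bump_mult[OF g(2) c, of x] bump_mass_pos[OF c, where 'a='a]
      by (simp add: mollify_eq scaleR_right_diff_distrib)
  qed
  ultimately have "AE x in lborel. g x - g' x = 0" by (rule mollify_eq_0_imp_AE)
  then show ?thesis by eventually_elim simp
qed

lemma lebesgue_measurable_translation:
  "(\<lambda>h. x + h) \<in> lebesgue \<rightarrow>\<^sub>M (lebesgue :: 'a::euclidean_space measure)"
  using lebesgue_affine_measurable[of "\<lambda>_. 1" x] by (simp add: euclidean_representation)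

text \<open>The values at \<open>x\<close> occur in every quotient, so equality is assumed there; in
  \<open>h\<close> only a translated null set is changed. Measurability of \<open>f\<close> enters
  through the essential supremum.\<close>

lemma taylor_mean_cong_AE:
  fixes f f' :: "'a::euclidean_space \<Rightarrow> real"
  assumes f: "f \<in> borel_measurable lebesgue" and f': "f' \<in> borel_measurable borel"
    and ae: "AE y in lborel. f y = f' y" and x: "f x = f' x" "g x = g' x"
  shows "taylor_mean p q f g \<epsilon> x = taylor_mean p q f' g' \<epsilon> x"
proof -
  have ae': "AE h in lborel. f (x + h) = f' (x + h)" by (rule AE_lborel_translate[OF ae])
  have "(\<lambda>h. f (x + h)) \<in> borel_measurable lebesgue"
    using measurable_compose[OF lebesgue_measurable_translation f] .
  then have fx[measurable]: "(\<lambda>h. f (x + h)) \<in> borel_measurable (lebesgue_on (ball 0 \<epsilon>))"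
    by (rule measurable_restrict_space1)
  have fx'[measurable]: "(\<lambda>h. f' (x + h)) \<in> borel_measurable (lebesgue_on (ball 0 \<epsilon>))"
    by (rule measurable_lebesgue_on_ball) (use f' in measurable)
  have [measurable]: "(\<lambda>h. h) \<in> borel_measurable (lebesgue_on (ball (0::'a) \<epsilon>))"
    by (rule measurable_lebesgue_on_ball) measurable
  have "esssup (lebesgue_on (ball 0 \<epsilon>)) (\<lambda>h. ennreal (\<bar>f (x + h) - f x - g x \<bullet> h\<bar> / norm h))
      = esssup (lebesgue_on (ball 0 \<epsilon>)) (\<lambda>h. ennreal (\<bar>f' (x + h) - f' x - g' x \<bullet> h\<bar> / norm h))"
  proof (rule esssup_AE_cong)
    show "AE h in lebesgue_on (ball 0 \<epsilon>). ennreal (\<bar>f (x + h) - f x - g x \<bullet> h\<bar> / norm h)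
        = ennreal (\<bar>f' (x + h) - f' x - g' x \<bullet> h\<bar> / norm h)"
      unfolding AE_lebesgue_on_ball_iff using ae' by eventually_elim (simp add: x)
  qed measurable
  moreover have "(\<integral>\<^sup>+h\<in>ball 0 \<epsilon>. ennreal (\<bar>f (x + h) - f x - g x \<bullet> h\<bar> powr s / norm h powr s) \<partial>lebesgue)
      = (\<integral>\<^sup>+h\<in>ball 0 \<epsilon>. ennreal (\<bar>f' (x + h) - f' x - g' x \<bullet> h\<bar> powr s / norm h powr s) \<partial>lebesgue)" for s
    unfolding nn_integral_completion using ae' by (intro nn_integral_cong_AE) (auto elim!: eventually_mono simp: x)
  ultimately show ?thesis by (simp add: taylor_mean_def)
qed

lemma Lp_space_representative:
  assumes u: "u \<in> Lp_space p" and u': "u' \<in> borel_measurable borel" and ae: "AE x in lborel. u x = u' x"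
  shows "(\<integral>\<^sup>+x. ennreal (norm (u' x) powr p) \<partial>lborel) < top"
proof -
  have "(\<integral>\<^sup>+x. ennreal (norm (u' x) powr p) \<partial>lborel) = (\<integral>\<^sup>+x. ennreal (norm (u x) powr p) \<partial>lborel)"
    using ae by (intro nn_integral_cong_AE) (auto elim!: eventually_mono)
  also have "\<dots> < top"
    using u by (auto simp: Lp_space_def integrable_iff_bounded nn_integral_completion)
  finally show ?thesis .
qed

lemma taylor_mean_dominated_admissible:
  assumes p: "1 \<le> p" and q: "1 \<le> q"
    and sub: "p < real DIM('a) \<Longrightarrow> q \<le> ereal (real DIM('a) / (real DIM('a) - p))"
    and crit: "p = real DIM('a) \<Longrightarrow> q < \<infinity>"
  shows "taylor_mean_dominated TYPE('a::euclidean_space) p q"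
proof -
  consider "p < real DIM('a)" | "p = real DIM('a)" | "real DIM('a) < p" by linarith
  then show ?thesis
  proof cases
    case 1
    have "1 \<le> real DIM('a) / (real DIM('a) - p)" using 1 p by simp
    then have "taylor_mean_dominated TYPE('a) p (ereal (real DIM('a) / (real DIM('a) - p)))"
      using 1 by (intro taylor_mean_dominated_finite p) auto
    then show ?thesis using 1 by (rule taylor_mean_dominated_mono[OF _ p q sub])
  next
    case 2
    with crit q obtain r where "q = ereal r" "1 \<le> r" by (cases q) auto
    then show ?thesis using 2 p by (auto intro: taylor_mean_dominated_finite)
  next
    case 3
    show ?thesis
      by (rule taylor_mean_dominated_mono[OF taylor_mean_dominated_infinity[OF 3] p q]) simp
  qed
qed

theorem theorem1p2:
  fixes f :: "real ^ 'n \<Rightarrow> real" and g :: "real ^ 'n \<Rightarrow> real ^ 'n"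
    and p :: real and q :: ereal
  assumes "1 \<le> p"
    and "f \<in> W1p p"
    and "has_weak_gradient f g"
    and "1 \<le> q"
    and "p < real CARD('n) \<Longrightarrow> q \<le> ereal (real CARD('n) / (real CARD('n) - p))"
    and "p = real CARD('n) \<Longrightarrow> q < \<infinity>"
  shows "((\<lambda>\<epsilon>::real. \<integral>\<^sup>+x. taylor_mean p q f g \<epsilon> x \<partial>lebesgue) \<longlongrightarrow> 0) (at_right 0)"
proof -
  \<comment> \<open>Membership in \<open>W1p\<close> supplies some gradient \<open>g0\<close> in
    L^p. The given \<open>g\<close> is a priori only locally integrable and has to be identified
    with it.\<close>
  obtain g0 where f: "f \<in> Lp_space p" and g0: "g0 \<in> Lp_space p" "has_weak_gradient f g0"
    using assms(2) by (auto simp: W1p_def)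
  have fm: "f \<in> borel_measurable lebesgue" and g0m: "g0 \<in> borel_measurable lebesgue"
    using f g0 by (auto simp: Lp_space_def)
  have gm: "g \<in> borel_measurable lebesgue"
    using assms(3) by (intro locally_integrable_lebesgue_measurable) (simp add: has_weak_gradient_def)
  obtain f' where f': "f' \<in> borel_measurable borel" "AE x in lborel. f x = f' x"
    using lebesgue_measurable_borel_representative[OF fm] by blast
  obtain g0' where g0': "g0' \<in> borel_measurable borel" "AE x in lborel. g0 x = g0' x"
    using lebesgue_measurable_borel_representative[OF g0m] by blast
  obtain g' where g': "g' \<in> borel_measurable borel" "AE x in lborel. g x = g' x"
    using lebesgue_measurable_borel_representative[OF gm] by blast
  have wg: "bump_weak_gradient f' g0'" "bump_weak_gradient f' g'"
    by (rule bump_weak_gradient_representative[OF g0(2) f' g0'],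
        rule bump_weak_gradient_representative[OF assms(3) f' g'])
  \<comment> \<open>Uniqueness identifies \<open>g\<close> with the representative of
    \<open>g0\<close> almost everywhere, so the p-integrable \<open>g0'\<close> may replace it under
    the integral over \<open>x\<close>.\<close>
  have "AE x in lborel. f x = f' x \<and> g x = g0' x"
    using f'(2) g'(2) bump_weak_gradient_unique[OF wg] by eventually_elim simp
  then have "(\<integral>\<^sup>+x. taylor_mean p q f g \<epsilon> x \<partial>lebesgue) = (\<integral>\<^sup>+x. taylor_mean p q f' g0' \<epsilon> x \<partial>lborel)" for \<epsilon>
    unfolding nn_integral_completion
    by (intro nn_integral_cong_AE, elim eventually_mono) (auto intro: taylor_mean_cong_AE[OF fm f'])
  moreover have "((\<lambda>\<epsilon>. \<integral>\<^sup>+x. taylor_mean p q f' g0' \<epsilon> x \<partial>lborel) \<longlongrightarrow> 0) (at_right 0)"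
  proof (rule taylor_mean_tendsto_0)
    show "taylor_mean_dominated TYPE(real ^ 'n) p q"
      using assms by (intro taylor_mean_dominated_admissible) auto
    show "(\<integral>\<^sup>+x. ennreal (\<bar>f' x\<bar> powr p) \<partial>lborel) < top"
      using Lp_space_representative[OF f f'] by simp
    show "(\<integral>\<^sup>+x. ennreal (norm (g0' x) powr p) \<partial>lborel) < top"
      using Lp_space_representative[OF g0(1) g0'] .
  qed (use assms f' g0' wg in auto)
  ultimately show ?thesis by simp
qed

end
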